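(* Let $(Q_k)_{k\ge1}$ be a nondecreasing sequence of reals with $Q_k\ge2$ such that either $(Q_k)$ is bounded, or $Q_k\nearrow\infty$ with $Q_k<\log k$ for all large $k$. Let $b_k=e^{-k}$, $I_k=[a_k,b_k]$ with $|I_k|=b_k-a_k=b_k^{Q_k}$, and $K=\{0\}\cup\bigcup_{k=1}^\infty I_k$. Let $h=h_0^{\alpha}$, where $h_0(t)=(\log\frac1t)^{-1}$ and either $\alpha(t)\equiv\alpha_0$ with $\alpha_0\in(0,1]$, or $\alpha(t)=\alpha_0+\varepsilon_m(t)$, or $\alpha(t)=\alpha_0-\varepsilon_m(t)$, with $0<\alpha_0<1$, $m>2$ an integer and $\varepsilon_m(t)=(\log_{(m)}\frac1t)^{-1}$. Then $K$ has the extension property if and only if $\phi_h(K)>0$.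
   Context: $\log_{(m)}$ denotes the $m$-fold iteration $\log\cdots\log$ of the natural logarithm; $h(t)=h_0(t)^{\alpha(t)}$ is considered for small $t>0$, on an interval where it is a dimension function (continuous, nondecreasing, positive, $h(t)\to0$ as $t\to0$). The $h$-Hausdorff content is $M_h(E)=\inf\{\sum h(|G_i|):E\subset\bigcup G_i\}$, over at most countable coverings of $E\subset\mathbb R$ by intervals $G_i$ (open or closed), $|G|$ being the length. With $B(x,r)=[x-r,x+r]$, the lower density of the Hausdorff content is $$\phi_h(K)=\liminf_{r\to0}\ \inf_{x\in K}\frac{M_h(K\cap B(x,r))}{M_h(B(x,r))},$$ and $M_h(B(x,r))=h(2r)$ for these $h$ and small $r$. Extension property: for a perfect compact set $K\subset\mathbb R$, $\mathcal E(K)$ is the Fréchet space of Whitney functions on $K$, i.e. of traces $f=F|_K$ of functions $F\in C^\infty(\mathbb R)$ (since $K$ is perfect, $f$ determines the derivatives $f^{(k)}=F^{(k)}|_K$), with the topology given by the norms $$\|f\|_q=|f|_{q,K}+\sup\Big\{\frac{|(R_y^qf)^{(k)}(x)|}{|x-y|^{q-k}}:x,y\in K,\ x\ne y,\ k=0,\dots,q\Big\},\quad q=0,1,2,\dots,$$ where $|f|_{q,K}=\sup\{|f^{(k)}(x)|:x\in K,k\le q\}$ and $R_y^qf=f-T_y^qf$ is the Taylor remainder. $K$ has the extension property if there is a continuous linear operator $W:\mathcal E(K)\to C^\infty(\mathbb R)$ with $W(f)|_K=f$ for all $f\in\mathcal E(K)$. *)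

theory Defs
  imports "HOL-Analysis.Analysis"
begin

section \<open>Whitney functions and the extension property\<close>

definition smooth :: "(real \<Rightarrow> real) \<Rightarrow> bool" where
  "smooth F \<longleftrightarrow> (\<forall>n x. (deriv ^^ n) F field_differentiable at x)"

text \<open>A function on \<open>K\<close> is represented by its extension by zero to the whole line, so that
  the traces form a linear space under the pointwise operations.\<close>

definition whitney_functions :: "real set \<Rightarrow> (real \<Rightarrow> real) set" where
  "whitney_functions K = {f. \<exists>F. smooth F \<and> f = (\<lambda>x. if x \<in> K then F x else 0)}"

text \<open>The derivatives of a trace are those of any smooth function inducing it. If \<open>K\<close> is
  perfect, they do not depend on the choice. Only the values of \<open>f\<close> on \<open>K\<close> matter.\<close>

definition whitney_deriv :: "real set \<Rightarrow> nat \<Rightarrow> (real \<Rightarrow> real) \<Rightarrow> real \<Rightarrow> real" where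
  "whitney_deriv K k f = (deriv ^^ k) (SOME F. smooth F \<and> (\<forall>x\<in>K. F x = f x))"

definition taylor_poly :: "real set \<Rightarrow> nat \<Rightarrow> real \<Rightarrow> (real \<Rightarrow> real) \<Rightarrow> real \<Rightarrow> real" where
  "taylor_poly K q y f x = (\<Sum>i\<le>q. whitney_deriv K i f y / fact i * (x - y) ^ i)"

definition taylor_rem :: "real set \<Rightarrow> nat \<Rightarrow> real \<Rightarrow> (real \<Rightarrow> real) \<Rightarrow> real \<Rightarrow> real" where
  "taylor_rem K q y f x = f x - taylor_poly K q y f x"

text \<open>For compact perfect nonempty \<open>K\<close> and a Whitney function \<open>f\<close>, both suprema below are
  over nonempty bounded sets of reals.\<close>

definition whitney_norm :: "real set \<Rightarrow> nat \<Rightarrow> (real \<Rightarrow> real) \<Rightarrow> real" where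
  "whitney_norm K q f =
     Sup {\<bar>whitney_deriv K k f x\<bar> | x k. x \<in> K \<and> k \<le> q}
   + Sup {\<bar>whitney_deriv K k (taylor_rem K q y f) x\<bar> / \<bar>x - y\<bar> ^ (q - k)
           | x y k. x \<in> K \<and> y \<in> K \<and> x \<noteq> y \<and> k \<le> q}"

text \<open>Uniform convergence of all derivatives on compact sets.\<close>

definition smooth_seminorm :: "nat \<Rightarrow> (real \<Rightarrow> real) \<Rightarrow> real" where
  "smooth_seminorm n F = Sup {\<bar>(deriv ^^ k) F x\<bar> | x k. x \<in> {- real n..real n} \<and> k \<le> n}"

definition seminorm_topology ::
    "(real \<Rightarrow> real) set \<Rightarrow> (nat \<Rightarrow> (real \<Rightarrow> real) \<Rightarrow> real) \<Rightarrow> (real \<Rightarrow> real) topology" where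
  "seminorm_topology V p = topology_generated_by
     {{g \<in> V. p n (\<lambda>x. g x - f x) < e} | f n e. f \<in> V \<and> e > 0}"

definition whitney_space :: "real set \<Rightarrow> (real \<Rightarrow> real) topology" where
  "whitney_space K = seminorm_topology (whitney_functions K) (whitney_norm K)"

definition smooth_space :: "(real \<Rightarrow> real) topology" where
  "smooth_space = seminorm_topology {F. smooth F} smooth_seminorm"

definition extension_property :: "real set \<Rightarrow> bool" where
  "extension_property K \<longleftrightarrow>
     (\<exists>W. continuous_map (whitney_space K) smooth_space W
        \<and> (\<forall>f\<in>whitney_functions K. \<forall>g\<in>whitney_functions K. \<forall>c d.
             W (\<lambda>x. c * f x + d * g x) = (\<lambda>x. c * W f x + d * W g x))
        \<and> (\<forall>f\<in>whitney_functions K. \<forall>x\<in>K. W f x = f x))"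

section \<open>Hausdorff content and its lower density\<close>

definition dimension_function_on :: "real \<Rightarrow> (real \<Rightarrow> real) \<Rightarrow> bool" where
  "dimension_function_on T h \<longleftrightarrow>
     continuous_on {0<..<T} h \<and> mono_on {0<..<T} h \<and> (\<forall>t\<in>{0<..<T}. h t > 0) \<and>
     (h \<longlongrightarrow> 0) (at_right 0)"

text \<open>The dimension functions considered here are only given on some interval \<open>(0, T)\<close>, so the
  covering intervals are taken with length in this range. By monotonicity of \<open>h\<close>, longer
  intervals would not lower the content of a set of diameter less than \<open>T\<close>, and
  degenerate ones are limits of short ones since \<open>h\<close> tends to \<open>0\<close>. Repetitions in a covering
  only increase the sum, so coverings are sets of intervals.\<close>

definition cover_intervals :: "real \<Rightarrow> real set set" where
  "cover_intervals T = {G. \<exists>a b. a < b \<and> b - a < T \<and> (G = {a..b} \<or> G = {a<..<b})}"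

definition hausdorff_content :: "real \<Rightarrow> (real \<Rightarrow> real) \<Rightarrow> real set \<Rightarrow> ennreal" where
  "hausdorff_content T h E =
     (INF C \<in> {C. countable C \<and> C \<subseteq> cover_intervals T \<and> E \<subseteq> \<Union>C}.
        \<Sum>\<^sub>\<infinity>G\<in>C. ennreal (h (measure lborel G)))"

definition lower_content_density :: "real \<Rightarrow> (real \<Rightarrow> real) \<Rightarrow> real set \<Rightarrow> ennreal" where
  "lower_content_density T h K =
     Liminf (at_right 0) (\<lambda>r. INF x\<in>K.
       hausdorff_content T h (K \<inter> cball x r) / hausdorff_content T h (cball x r))"

section \<open>The sets and the dimension functions\<close>

definition interval_seq_set :: "(nat \<Rightarrow> real) \<Rightarrow> real set" where
  "interval_seq_set Q =
     {0} \<union> (\<Union>k\<in>{1..}. let b = exp (- real k) in {b - b powr Q k..b})"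

definition h0 :: "real \<Rightarrow> real" where
  "h0 t = inverse (ln (1 / t))"

text \<open>Genuine only where the iterated logarithms are defined and nonzero, as is the case for
  small \<open>t > 0\<close>.\<close>

definition eps :: "nat \<Rightarrow> real \<Rightarrow> real" where
  "eps m t = inverse ((ln ^^ m) (1 / t))"

end

theory Submission
  imports Defs "HOL-Real_Asymp.Real_Asymp"
begin

text \<open>Both properties are equivalent to boundedness of the exponents \<open>Q\<close>.

  Suppose that \<open>W\<close> is an extension operator and let \<open>f\<close> be \<open>(x - b k) ^ N\<close> on \<open>I k\<close> and \<open>0\<close> on the
  rest of \<open>K\<close>. A Whitney norm of order below \<open>N\<close> of \<open>f\<close> is at most a constant times the length \<open>\<delta> k\<close>,
  since \<open>f\<close> can be cut off at distance \<open>\<delta> k\<close> from \<open>b k\<close>; a norm of higher order \<open>r\<close> is at most a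
  constant times \<open>b k powr (- r)\<close>, since \<open>f\<close> can also be cut off at distance \<open>b k / 4\<close>. The \<open>N\<close>-th
  derivative of \<open>W f\<close> at \<open>b k\<close> is \<open>fact N\<close>, and it is controlled by the maximum of \<open>\<bar>W f\<bar>\<close> together
  with the next derivative, so \<open>\<delta> k\<close> cannot be smaller than a fixed power of \<open>b k\<close>.

  Conversely, from the values of a Whitney function at the points \<open>exp (- k)\<close> one obtains, linearly
  and continuously, a smooth function with the same jet at \<open>0\<close>: glue interpolation polynomials of
  slowly increasing degree, each on its own scale. After subtracting it, the function is flat at
  \<open>0\<close>. The same construction at the two endpoints of \<open>I k\<close> extends the restriction to \<open>I k\<close> to a
  neighbourhood of size \<open>\<delta> k\<close>. This costs powers of \<open>1 / \<delta> k\<close>, which the flatness absorbs when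
  \<open>\<delta> k\<close> is at least a power of \<open>b k\<close>.

  On the side of the content, the ratio of \<open>h\<close> at \<open>exp (- v)\<close> and \<open>exp (- u)\<close> lies between two negative
  powers of \<open>v / u\<close> if \<open>v \<ge> u\<close> and \<open>u\<close> is large. In particular \<open>h t / t\<close> decreases for small \<open>t\<close>, so intervals have content
  \<open>h\<close> of their length. Every small ball around a point of \<open>K\<close> contains an interval of \<open>K\<close> whose length
  is at least a fixed power of the radius if \<open>Q\<close> is bounded, whereas the ball of radius \<open>b k / 4\<close>
  around \<open>b k\<close> meets \<open>K\<close> only in \<open>I k\<close>, where \<open>h (\<delta> k)\<close> is negligible if \<open>Q\<close> tends to infinity.\<close>

section \<open>Smooth functions\<close>

lemma smooth_DERIV:
  assumes "smooth F"
  shows "((deriv ^^ n) F has_real_derivative (deriv ^^ Suc n) F x) (at x)"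
  using assms unfolding smooth_def by (auto simp: DERIV_deriv_iff_field_differentiable)

lemma smooth_DERIV':
  assumes "smooth F"
  shows "(F has_real_derivative deriv F x) (at x)"
  using smooth_DERIV[OF assms, of 0 x] by simp

text \<open>Together with \<open>smoothI\<close> this gives smoothness and all derivatives at once
  from a guessed sequence \<open>D\<close> of successive derivatives, the pattern of most closure
  properties below.\<close>

lemma higher_deriv_eqI:
  assumes "\<And>n x. (D n has_real_derivative D (Suc n) x) (at x)"
  shows "(deriv ^^ n) (D 0) = D n"
proof (induction n)
  case (Suc n)
  have "deriv (D n) = D (Suc n)"
    using assms by (intro ext DERIV_imp_deriv)
  with Suc show ?case by simp
qed simp

lemma smoothI:
  assumes "\<And>n x. (D n has_real_derivative D (Suc n) x) (at x)"
  shows "smooth (D 0)"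
  unfolding smooth_def higher_deriv_eqI[of D, OF assms]
  using assms field_differentiable_def by blast

lemma smooth_deriv: "smooth F \<Longrightarrow> smooth (deriv F)"
  unfolding smooth_def by (metis comp_apply funpow_Suc_right)

lemma smooth_higher_deriv: "smooth F \<Longrightarrow> smooth ((deriv ^^ n) F)"
  by (induction n) (auto intro: smooth_deriv)

lemma smooth_continuous_on: "smooth F \<Longrightarrow> continuous_on S ((deriv ^^ n) F)"
  by (meson DERIV_isCont continuous_at_imp_continuous_on smooth_DERIV)

lemma smooth_lincomb:
  assumes "smooth F" "smooth G"
  shows "smooth (\<lambda>x. c * F x + d * G x)"
    and "(deriv ^^ n) (\<lambda>x. c * F x + d * G x) = (\<lambda>x. c * (deriv ^^ n) F x + d * (deriv ^^ n) G x)"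
proof -
  define D where "D n x = c * (deriv ^^ n) F x + d * (deriv ^^ n) G x" for n x
  have D: "(D n has_real_derivative D (Suc n) x) (at x)" for n x
    unfolding D_def by (intro derivative_intros DERIV_cmult smooth_DERIV assms)
  show "smooth (\<lambda>x. c * F x + d * G x)"
    using smoothI[of D, OF D] by (simp add: D_def[abs_def])
  show "(deriv ^^ n) (\<lambda>x. c * F x + d * G x) = (\<lambda>x. c * (deriv ^^ n) F x + d * (deriv ^^ n) G x)"
    using higher_deriv_eqI[of D n, OF D] by (simp add: D_def[abs_def])
qed

lemma smooth_diff:
  assumes "smooth F" "smooth G"
  shows "smooth (\<lambda>x. F x - G x)"
    and "(deriv ^^ n) (\<lambda>x. F x - G x) = (\<lambda>x. (deriv ^^ n) F x - (deriv ^^ n) G x)"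
  using smooth_lincomb(1)[OF assms, of 1 "-1"] smooth_lincomb(2)[OF assms, of n 1 "-1"] by simp_all

lemma smooth_add:
  assumes "smooth F" "smooth G"
  shows "smooth (\<lambda>x. F x + G x)"
    and "(deriv ^^ n) (\<lambda>x. F x + G x) = (\<lambda>x. (deriv ^^ n) F x + (deriv ^^ n) G x)"
  using smooth_lincomb(1)[OF assms, of 1 1] smooth_lincomb(2)[OF assms, of n 1 1] by simp_all

lemma smooth_cmult:
  assumes "smooth F"
  shows "smooth (\<lambda>x. c * F x)"
    and "(deriv ^^ n) (\<lambda>x. c * F x) = (\<lambda>x. c * (deriv ^^ n) F x)"
  using smooth_lincomb(1)[OF assms assms, of c 0] smooth_lincomb(2)[OF assms assms, of n c 0]
  by simp_all

lemma smooth_zero: "smooth (\<lambda>x. 0)" "(deriv ^^ n) (\<lambda>x::real. 0) = (\<lambda>x. 0::real)"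
  using smoothI[of "\<lambda>n x. 0"] higher_deriv_eqI[of "\<lambda>n x. 0" n] by simp_all

lemma smooth_const: "smooth (\<lambda>x. c)"
  using smoothI[of "\<lambda>n x. if n = 0 then c else 0"] by simp

lemma smooth_ident: "smooth (\<lambda>x. x)"
proof -
  define D :: "nat \<Rightarrow> real \<Rightarrow> real"
    where "D n x = (if n = 0 then x else if n = 1 then 1 else 0)" for n x
  have "(D n has_real_derivative D (Suc n) x) (at x)" for n x
    unfolding D_def by (cases n) auto
  from smoothI[of D, OF this] show ?thesis by (simp add: D_def[abs_def])
qed

lemma smooth_sum:
  assumes "\<And>i. i \<in> I \<Longrightarrow> smooth (F i)"
  shows "smooth (\<lambda>x. \<Sum>i\<in>I. c i * F i x)"
    and "(deriv ^^ n) (\<lambda>x. \<Sum>i\<in>I. c i * F i x) = (\<lambda>x. \<Sum>i\<in>I. c i * (deriv ^^ n) (F i) x)"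
proof -
  define D where "D n x = (\<Sum>i\<in>I. c i * (deriv ^^ n) (F i) x)" for n x
  have D: "(D n has_real_derivative D (Suc n) x) (at x)" for n x
    unfolding D_def by (intro DERIV_sum DERIV_cmult smooth_DERIV assms)
  show "smooth (\<lambda>x. \<Sum>i\<in>I. c i * F i x)"
    using smoothI[of D, OF D] by (simp add: D_def[abs_def])
  show "(deriv ^^ n) (\<lambda>x. \<Sum>i\<in>I. c i * F i x) = (\<lambda>x. \<Sum>i\<in>I. c i * (deriv ^^ n) (F i) x)"
    using higher_deriv_eqI[of D n, OF D] by (simp add: D_def[abs_def])
qed

lemma smooth_affine:
  assumes "smooth F"
  shows "smooth (\<lambda>x. F (a * x + b))"
    and "(deriv ^^ n) (\<lambda>x. F (a * x + b)) = (\<lambda>x. a ^ n * (deriv ^^ n) F (a * x + b))"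
proof -
  define D where "D n x = a ^ n * (deriv ^^ n) F (a * x + b)" for n x
  have "((\<lambda>x. (deriv ^^ n) F (a * x + b)) has_real_derivative (deriv ^^ Suc n) F (a * x + b) * a) (at x)"
    for n x
    by (rule DERIV_chain'[OF _ smooth_DERIV[OF assms]]) (auto intro!: derivative_eq_intros)
  then have D: "(D n has_real_derivative D (Suc n) x) (at x)" for n x
    unfolding D_def by (auto intro!: derivative_eq_intros simp: mult_ac)
  show "smooth (\<lambda>x. F (a * x + b))"
    using smoothI[of D, OF D] by (simp add: D_def[abs_def])
  show "(deriv ^^ n) (\<lambda>x. F (a * x + b)) = (\<lambda>x. a ^ n * (deriv ^^ n) F (a * x + b))"
    using higher_deriv_eqI[of D n, OF D] by (simp add: D_def[abs_def])
qed

text \<open>A class closed under differentiation contains only smooth functions: choosing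
  derivatives inside the class produces the sequence that \<open>smoothI\<close> asks for. No closed
  formula for higher derivatives is needed.\<close>

lemma smooth_coinduct:
  assumes "P f"
    and step: "\<And>f. P f \<Longrightarrow> \<exists>f'. P f' \<and> (\<forall>x. (f has_real_derivative f' x) (at x))"
  shows "smooth f"
proof -
  obtain next_deriv where next_deriv:
    "\<And>f. P f \<Longrightarrow> P (next_deriv f) \<and> (\<forall>x. (f has_real_derivative next_deriv f x) (at x))"
    using step by metis
  have "P ((next_deriv ^^ n) f)" for n
    by (induction n) (use assms(1) next_deriv in auto)
  then have "((next_deriv ^^ n) f has_real_derivative (next_deriv ^^ Suc n) f x) (at x)" for n x
    using next_deriv by simp
  from smoothI[of "\<lambda>n. (next_deriv ^^ n) f", OF this] show ?thesis by simp
qed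

text \<open>Products of smooth functions are not closed under differentiation, but by the Leibniz
  rule their finite sums are.\<close>

inductive product_span :: "(real \<Rightarrow> real) \<Rightarrow> bool" where
  product_span_mult: "smooth F \<Longrightarrow> smooth G \<Longrightarrow> product_span (\<lambda>x. F x * G x)"
| product_span_add: "product_span f \<Longrightarrow> product_span g \<Longrightarrow> product_span (\<lambda>x. f x + g x)"

lemma product_span_deriv:
  assumes "product_span f"
  shows "\<exists>f'. product_span f' \<and> (\<forall>x. (f has_real_derivative f' x) (at x))"
  using assms
proof induction
  case (product_span_mult F G)
  show ?case
  proof (intro exI conjI allI)
    show "product_span (\<lambda>x. deriv F x * G x + F x * deriv G x)"
      using product_span_mult by (intro product_span.intros smooth_deriv)
    show "((\<lambda>x. F x * G x) has_real_derivative deriv F x * G x + F x * deriv G x) (at x)" for x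
      using product_span_mult
      by (auto intro!: derivative_eq_intros smooth_DERIV')
  qed
next
  case (product_span_add f g)
  then obtain f' g' where
    "product_span f'" "\<And>x. (f has_real_derivative f' x) (at x)"
    "product_span g'" "\<And>x. (g has_real_derivative g' x) (at x)" by blast
  then show ?case
    by (intro exI[of _ "\<lambda>x. f' x + g' x"]) (auto intro: product_span.intros DERIV_add)
qed

lemma smooth_mult:
  assumes "smooth F" "smooth G"
  shows "smooth (\<lambda>x. F x * G x)"
  using product_span_mult[OF assms] product_span_deriv by (rule smooth_coinduct)

lemma smooth_power: "smooth F \<Longrightarrow> smooth (\<lambda>x. F x ^ n)"
  by (induction n) (auto intro: smooth_const smooth_mult)

text \<open>The quotients \<open>u x / G x ^ n\<close> with smooth \<open>u\<close> and varying
  \<open>n\<close> are closed under differentiation; the numerator \<open>?v\<close> below is what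
  the quotient rule gives over \<open>G x ^ Suc n\<close>.\<close>

lemma smooth_divide:
  assumes "smooth F" "smooth G" "\<And>x. G x \<noteq> 0"
  shows "smooth (\<lambda>x. F x / G x)"
proof (rule smooth_coinduct)
  let ?P = "\<lambda>f. \<exists>u n. smooth u \<and> f = (\<lambda>x. u x / G x ^ n)"
  show "?P (\<lambda>x. F x / G x)"
    using assms(1) by (intro exI[of _ F] exI[of _ 1]) simp
  fix f assume "?P f"
  then obtain u n where u: "smooth u" "f = (\<lambda>x. u x / G x ^ n)" by blast
  let ?v = "\<lambda>x. deriv u x * G x - real n * (u x * deriv G x)"
  have "smooth ?v"
    by (intro smooth_diff smooth_mult smooth_cmult smooth_deriv u assms)
  moreover have "(f has_real_derivative ?v x / G x ^ Suc n) (at x)" for x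
  proof (cases n)
    case 0
    then show ?thesis
      unfolding u using assms(3)[of x] smooth_DERIV'[OF u(1)] by simp
  next
    case (Suc m)
    have "(f has_real_derivative (deriv u x * G x ^ n - u x * ((1 + real m) * (deriv G x * G x ^ m)))
        / (G x ^ n * G x ^ n)) (at x)"
      unfolding u(2) Suc
      by (intro DERIV_divide DERIV_power_Suc smooth_DERIV' u(1) assms(2)) (use assms(3) in simp)
    also have "(deriv u x * G x ^ n - u x * ((1 + real m) * (deriv G x * G x ^ m)))
        / (G x ^ n * G x ^ n) = ?v x / G x ^ Suc n"
      using assms(3)[of x] by (simp add: Suc field_simps)
    finally show ?thesis .
  qed
  ultimately show "\<exists>f'. ?P f' \<and> (\<forall>x. (f has_real_derivative f' x) (at x))" by blast
qed

section \<open>Uniqueness, bounds, gluing and series of smooth functions\<close>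

lemma higher_deriv_cong_open:
  assumes "open S" "\<And>x. x \<in> S \<Longrightarrow> F x = G x" "x \<in> S"
  shows "(deriv ^^ n) F x = (deriv ^^ n) G x"
  using assms(3)
proof (induction n arbitrary: x)
  case (Suc n)
  have "eventually (\<lambda>y. y \<in> S) (nhds x)"
    using assms(1) Suc.prems by (rule eventually_nhds_in_open)
  then have "eventually (\<lambda>y. (deriv ^^ n) F y = (deriv ^^ n) G y) (nhds x)"
    by eventually_elim (rule Suc.IH)
  from deriv_cong_ev[OF this refl] show ?case by simp
qed (use assms(2) in simp)

text \<open>At a limit point of \<open>K\<close> the difference quotients taken within
  \<open>K\<close> already determine the derivative, so agreement on \<open>K\<close> passes from
  each derivative to the next.\<close>

lemma higher_deriv_eq_on:
  assumes "smooth F" "smooth G" "\<And>x. x \<in> K \<Longrightarrow> F x = G x"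
    and "\<And>x. x \<in> K \<Longrightarrow> x islimpt K" "x \<in> K"
  shows "(deriv ^^ n) F x = (deriv ^^ n) G x"
  using assms(5)
proof (induction n arbitrary: x)
  case (Suc n)
  have "((\<lambda>y. ((deriv ^^ n) H y - (deriv ^^ n) H x) / (y - x)) \<longlongrightarrow> (deriv ^^ Suc n) H x) (at x within K)"
    if "smooth H" for H
    using has_field_derivative_at_within[OF smooth_DERIV[OF that]]
    unfolding has_field_derivative_iff .
  from this[OF assms(1)] this[OF assms(2)]
  have "((\<lambda>y. ((deriv ^^ n) F y - (deriv ^^ n) F x) / (y - x)) \<longlongrightarrow> (deriv ^^ Suc n) F x) (at x within K)"
       "((\<lambda>y. ((deriv ^^ n) F y - (deriv ^^ n) F x) / (y - x)) \<longlongrightarrow> (deriv ^^ Suc n) G x) (at x within K)"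
    using Suc.IH Suc.prems
    by (auto cong: Lim_cong_within)
  moreover have "at x within K \<noteq> bot"
    using assms(4)[OF Suc.prems] by (simp add: trivial_limit_within)
  ultimately show ?case using tendsto_unique by blast
qed (use assms(3) in simp)

lemma smooth_bounded_on_interval:
  assumes "smooth F"
  obtains B where "0 \<le> B" "\<And>x k. x \<in> {a..b} \<Longrightarrow> k \<le> q \<Longrightarrow> \<bar>(deriv ^^ k) F x\<bar> \<le> B"
proof -
  have "\<exists>B. \<forall>x\<in>{a..b}. \<bar>(deriv ^^ k) F x\<bar> \<le> B" for k
  proof -
    have "compact ((deriv ^^ k) F ` {a..b})"
      by (intro compact_continuous_image smooth_continuous_on assms) auto
    from compact_imp_bounded[OF this] show ?thesis
      by (auto simp: bounded_iff)
  qed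
  then obtain B where B: "\<And>k x. x \<in> {a..b} \<Longrightarrow> \<bar>(deriv ^^ k) F x\<bar> \<le> B k" by metis
  show ?thesis
  proof (rule that)
    show "0 \<le> (\<Sum>k\<le>q. \<bar>B k\<bar>)" by (simp add: sum_nonneg)
    fix x k assume "x \<in> {a..b}" "k \<le> q"
    then have "\<bar>(deriv ^^ k) F x\<bar> \<le> \<bar>B k\<bar>" using B[of x k] by linarith
    also have "\<dots> \<le> (\<Sum>k\<le>q. \<bar>B k\<bar>)"
      using \<open>k \<le> q\<close> by (intro member_le_sum) auto
    finally show "\<bar>(deriv ^^ k) F x\<bar> \<le> (\<Sum>k\<le>q. \<bar>B k\<bar>)" .
  qed
qed

text \<open>Derivatives vanish on the open complement of the interval and are continuous on the
  compact interval itself.\<close>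

lemma higher_deriv_bounded:
  assumes "smooth F" "\<And>x. x \<notin> {a..b} \<Longrightarrow> F x = 0"
  obtains B where "\<And>x. \<bar>(deriv ^^ n) F x\<bar> \<le> B"
proof -
  have 1: "(deriv ^^ n) F x = 0" if "x \<notin> {a..b}" for x
    using higher_deriv_cong_open[of "- {a..b}" F "\<lambda>x. 0" x n] that assms(2)
    by (auto simp: smooth_zero open_Compl)
  obtain B where B: "\<And>x k. x \<in> {a..b} \<Longrightarrow> k \<le> n \<Longrightarrow> \<bar>(deriv ^^ k) F x\<bar> \<le> B"
    using smooth_bounded_on_interval[OF assms(1)] by metis
  have "\<bar>(deriv ^^ n) F x\<bar> \<le> max B 0" for x
    using B[of x n] 1[of x] by (cases "x \<in> {a..b}") auto
  then show ?thesis by (rule that)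
qed

text \<open>Only the point \<open>c\<close> needs care: there the piecewise defined candidate has a
  derivative from each side, and the two agree because all derivatives of \<open>F\<close> and
  \<open>G\<close> match at \<open>c\<close>.\<close>

lemma smooth_glue:
  assumes "smooth F" "smooth G" "\<And>n. (deriv ^^ n) F c = (deriv ^^ n) G c"
  shows "smooth (\<lambda>x. if x \<le> c then F x else G x)"
    and "(deriv ^^ n) (\<lambda>x. if x \<le> c then F x else G x) =
      (\<lambda>x. if x \<le> c then (deriv ^^ n) F x else (deriv ^^ n) G x)"
proof -
  define D where "D n x = (if x \<le> c then (deriv ^^ n) F x else (deriv ^^ n) G x)" for n x
  have D: "(D n has_real_derivative D (Suc n) x) (at x)" for n x
  proof -
    consider "x < c" | "x > c" | "x = c" by linarith
    then show ?thesis
    proof cases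
      case 1
      then have "eventually (\<lambda>y. y \<in> {..<c}) (nhds x)" by (intro eventually_nhds_in_open) auto
      then have "eventually (\<lambda>y. D n y = (deriv ^^ n) F y) (nhds x)"
        by eventually_elim (simp add: D_def)
      then show ?thesis
        using smooth_DERIV[OF assms(1), of n x] 1 by (simp add: DERIV_cong_ev D_def)
    next
      case 2
      then have "eventually (\<lambda>y. y \<in> {c<..}) (nhds x)" by (intro eventually_nhds_in_open) auto
      then have "eventually (\<lambda>y. D n y = (deriv ^^ n) G y) (nhds x)"
        by eventually_elim (simp add: D_def)
      then show ?thesis
        using smooth_DERIV[OF assms(2), of n x] 2 by (simp add: DERIV_cong_ev D_def)
    next
      case 3
      have "(D n has_real_derivative D (Suc n) c) (at c within {..c})"
        by (rule has_field_derivative_transform_within[where f = "(deriv ^^ n) F" and d = 1])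
          (use smooth_DERIV[OF assms(1), of n c] assms(3)
            in \<open>auto simp: D_def simp del: funpow.simps intro: has_field_derivative_at_within\<close>)
      moreover have "(D n has_real_derivative D (Suc n) c) (at c within {c..})"
        by (rule has_field_derivative_transform_within[where f = "(deriv ^^ n) G" and d = 1])
          (use smooth_DERIV[OF assms(2), of n c] assms(3)
            in \<open>auto simp: D_def simp del: funpow.simps intro: has_field_derivative_at_within\<close>)
      ultimately have "(D n has_real_derivative D (Suc n) c) (at c within {..c} \<union> {c..})"
        unfolding has_field_derivative_iff by (rule Lim_Un)
      moreover have "{..c} \<union> {c..} = UNIV" by auto
      ultimately show ?thesis using 3 by simp
    qed
  qed
  show "smooth (\<lambda>x. if x \<le> c then F x else G x)"
    using smoothI[of D, OF D] by (simp add: D_def[abs_def] cong: if_cong)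
  show "(deriv ^^ n) (\<lambda>x. if x \<le> c then F x else G x) =
      (\<lambda>x. if x \<le> c then (deriv ^^ n) F x else (deriv ^^ n) G x)"
    using higher_deriv_eqI[of D n, OF D] by (simp add: D_def[abs_def] cong: if_cong)
qed

text \<open>The Weierstrass test for the series of each derivative justifies termwise
  differentiation at every order.\<close>

lemma smooth_suminf:
  fixes s :: "nat \<Rightarrow> real \<Rightarrow> real"
  assumes "\<And>k. smooth (s k)"
    and "\<And>n. summable (M n)"
    and bound: "\<And>n k x. \<bar>(deriv ^^ n) (s k) x\<bar> \<le> M n k"
  shows "smooth (\<lambda>x. \<Sum>k. s k x)"
    and "(deriv ^^ n) (\<lambda>x. \<Sum>k. s k x) = (\<lambda>x. \<Sum>k. (deriv ^^ n) (s k) x)"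
proof -
  define D where "D n x = (\<Sum>k. (deriv ^^ n) (s k) x)" for n x
  have D: "(D n has_real_derivative D (Suc n) x) (at x)" for n x
    unfolding D_def
  proof (rule has_field_derivative_series'[where S = UNIV and ?x0.0 = 0])
    show "uniformly_convergent_on UNIV (\<lambda>m x. \<Sum>k<m. (deriv ^^ Suc n) (s k) x)"
      by (rule Weierstrass_m_test'[OF _ assms(2)[of "Suc n"]])
        (simp only: real_norm_def bound)
    show "summable (\<lambda>k. (deriv ^^ n) (s k) 0)"
      by (rule summable_comparison_test'[OF assms(2)[of n], of 0]) (simp only: real_norm_def bound)
  qed (use assms(1) in \<open>auto intro: smooth_DERIV simp del: funpow.simps\<close>)
  show "smooth (\<lambda>x. \<Sum>k. s k x)"
    using smoothI[of D, OF D] by (simp add: D_def[abs_def])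
  show "(deriv ^^ n) (\<lambda>x. \<Sum>k. s k x) = (\<lambda>x. \<Sum>k. (deriv ^^ n) (s k) x)"
    using higher_deriv_eqI[of D n, OF D] by (simp add: D_def[abs_def])
qed

section \<open>A bump function and Taylor remainders\<close>

text \<open>The classical flat function \<open>exp (- (1 / x))\<close>, multiplied by polynomials in
  \<open>1 / x\<close> so that the family is closed under differentiation.\<close>

definition exp_recip :: "real poly \<Rightarrow> real \<Rightarrow> real" where
  "exp_recip p x = (if x > 0 then poly p (1 / x) * exp (- (1 / x)) else 0)"

lemma poly_exp_tendsto_0: "((\<lambda>y. poly p y * exp (- y)) \<longlongrightarrow> (0::real)) at_top"
proof -
  have "((\<lambda>y. \<Sum>i\<le>degree p. coeff p i * (y ^ i / exp y)) \<longlongrightarrow> (\<Sum>i\<le>degree p. coeff p i * (0::real))) at_top"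
    by (intro tendsto_sum tendsto_mult_left tendsto_power_div_exp_0)
  then show ?thesis
    by (simp add: poly_altdef sum_distrib_right exp_minus divide_inverse mult.assoc)
qed

lemma exp_recip_tendsto_0: "(exp_recip p \<longlongrightarrow> 0) (at 0)"
proof (rule filterlim_split_at_real)
  show "(exp_recip p \<longlongrightarrow> 0) (at_left 0)"
    by (rule tendsto_eventually) (auto simp: eventually_at_filter exp_recip_def)
  have "((\<lambda>x::real. poly p (1 / x) * exp (- (1 / x))) \<longlongrightarrow> 0) (at_right 0)"
    using filterlim_compose[OF poly_exp_tendsto_0 filterlim_inverse_at_top_right]
    by (simp add: field_simps)
  moreover have "eventually (\<lambda>x. poly p (1 / x) * exp (- (1 / x)) = exp_recip p x) (at_right 0)"
    by (simp add: eventually_at_filter exp_recip_def)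
  ultimately show "(exp_recip p \<longlongrightarrow> 0) (at_right 0)"
    by (rule Lim_transform_eventually)
qed

text \<open>\<open>[:0, 0, 1:]\<close> is the square of the indeterminate and supplies the factor
  \<open>1 / x\<^sup>2\<close> of the chain rule. At \<open>0\<close> the difference quotient is
  again a member of the family, and members tend to \<open>0\<close> there.\<close>

lemma exp_recip_DERIV:
  "(exp_recip p has_real_derivative exp_recip ([:0, 0, 1:] * (p - pderiv p)) x) (at x)"
proof -
  consider "x < 0" | "x > 0" | "x = 0" by linarith
  then show ?thesis
  proof cases
    case 1
    then have "eventually (\<lambda>y. y \<in> {..<0}) (nhds x)" by (intro eventually_nhds_in_open) auto
    then have "eventually (\<lambda>y. exp_recip p y = 0) (nhds x)"
      by eventually_elim (simp add: exp_recip_def)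
    then show ?thesis
      using 1 by (simp add: DERIV_cong_ev exp_recip_def)
  next
    case 2
    then have "eventually (\<lambda>y. y \<in> {0<..}) (nhds x)" by (intro eventually_nhds_in_open) auto
    then have ev: "eventually (\<lambda>y. exp_recip p y = poly p (1 / y) * exp (- (1 / y))) (nhds x)"
      by eventually_elim (simp add: exp_recip_def)
    have "((\<lambda>y. poly p (1 / y)) has_real_derivative poly (pderiv p) (1 / x) * (- (1 / x\<^sup>2))) (at x)"
      by (rule DERIV_chain'[OF _ poly_DERIV])
        (use 2 in \<open>auto intro!: derivative_eq_intros simp: power2_eq_square\<close>)
    moreover have "((\<lambda>y. exp (- (1 / y))) has_real_derivative exp (- (1 / x)) * (1 / x\<^sup>2)) (at x)"
      using 2 by (auto intro!: derivative_eq_intros simp: power2_eq_square)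
    ultimately have "((\<lambda>y. poly p (1 / y) * exp (- (1 / y))) has_real_derivative
        poly (pderiv p) (1 / x) * (- (1 / x\<^sup>2)) * exp (- (1 / x)) +
        exp (- (1 / x)) * (1 / x\<^sup>2) * poly p (1 / x)) (at x)"
      by (rule DERIV_mult)
    moreover have "exp_recip ([:0, 0, 1:] * (p - pderiv p)) x =
        poly (pderiv p) (1 / x) * (- (1 / x\<^sup>2)) * exp (- (1 / x)) +
        exp (- (1 / x)) * (1 / x\<^sup>2) * poly p (1 / x)"
    proof -
      have "exp_recip ([:0, 0, 1:] * (p - pderiv p)) x =
        (1 / x * (1 / x)) * (poly p (1 / x) - poly (pderiv p) (1 / x)) * exp (- (1 / x))"
        using 2 by (simp add: exp_recip_def)
      also have "1 / x * (1 / x) = 1 / x\<^sup>2" by (simp add: power2_eq_square)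
      finally show ?thesis by (simp only: algebra_simps)
    qed
    ultimately show ?thesis
      using DERIV_cong_ev[OF refl ev refl] by simp
  next
    case 3
    have "(exp_recip p y - exp_recip p 0) / (y - 0) = exp_recip ([:0, 1:] * p) y" for y
      by (simp add: exp_recip_def)
    then show ?thesis
      using exp_recip_tendsto_0[of "[:0, 1:] * p"]
      by (simp add: 3 has_field_derivative_iff exp_recip_def[of _ 0])
  qed
qed

lemma smooth_exp_recip: "smooth (exp_recip p)"
  by (rule smooth_coinduct[where P = "\<lambda>f. \<exists>p. f = exp_recip p"]) (use exp_recip_DERIV in blast)+

text \<open>The denominator never vanishes, since \<open>x\<close> and \<open>1 - x\<close> cannot
  both be nonpositive. Dividing by it makes the transition end exactly at the value
  \<open>1\<close>.\<close>

definition smooth_step :: "real \<Rightarrow> real" where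
  "smooth_step x = exp_recip 1 x / (exp_recip 1 x + exp_recip 1 (1 - x))"

lemma smooth_smooth_step: "smooth smooth_step"
  unfolding smooth_step_def[abs_def]
proof (rule smooth_divide)
  have "smooth (\<lambda>x. exp_recip 1 (1 - x))"
    using smooth_affine(1)[OF smooth_exp_recip, of 1 "- 1" 1] by simp
  then show "smooth (\<lambda>x. exp_recip 1 x + exp_recip 1 (1 - x))"
    by (intro smooth_add smooth_exp_recip)
  show "exp_recip 1 x + exp_recip 1 (1 - x) \<noteq> 0" for x
  proof -
    have "exp_recip 1 x > 0 \<or> exp_recip 1 (1 - x) > 0"
      by (auto simp: exp_recip_def)
    moreover have "exp_recip 1 x \<ge> 0" "exp_recip 1 (1 - x) \<ge> 0"
      by (auto simp: exp_recip_def)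
    ultimately show ?thesis by linarith
  qed
qed (rule smooth_exp_recip)

lemma smooth_step_eq: "x \<le> 0 \<Longrightarrow> smooth_step x = 0" "x \<ge> 1 \<Longrightarrow> smooth_step x = 1"
  by (auto simp: smooth_step_def exp_recip_def)

text \<open>The radius \<open>1 / 4\<close> of the support becomes the support condition of
  \<open>jet_extension\<close>, which later keeps the extension near one interval of
  \<open>K\<close> away from the rest of \<open>K\<close>.\<close>

definition bump :: "real \<Rightarrow> real" where
  "bump x = smooth_step (2 - 8 * x) * smooth_step (2 + 8 * x)"

lemma smooth_bump: "smooth bump"
proof -
  have "smooth (\<lambda>x. smooth_step (2 - 8 * x))" "smooth (\<lambda>x. smooth_step (2 + 8 * x))"
    using smooth_affine(1)[OF smooth_smooth_step, of "- 8" 2]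
      smooth_affine(1)[OF smooth_smooth_step, of 8 2] by (simp_all add: algebra_simps)
  then show ?thesis unfolding bump_def[abs_def] by (rule smooth_mult)
qed

lemma bump_eq_1: "\<bar>x\<bar> \<le> 1 / 8 \<Longrightarrow> bump x = 1"
  by (simp add: bump_def smooth_step_eq)

lemma bump_eq_0: "\<bar>x\<bar> \<ge> 1 / 4 \<Longrightarrow> bump x = 0"
  by (cases "x \<ge> 0") (simp_all add: bump_def smooth_step_eq)

text \<open>Lagrange's form of the remainder, with \<open>1 / fact n\<close> estimated by
  \<open>1\<close>.\<close>

lemma taylor_remainder_bound:
  assumes "smooth F" "\<And>t. t \<in> closed_segment c x \<Longrightarrow> \<bar>(deriv ^^ n) F t\<bar> \<le> S"
  shows "\<bar>F x - (\<Sum>i<n. (deriv ^^ i) F c / fact i * (x - c) ^ i)\<bar> \<le> S * \<bar>x - c\<bar> ^ n"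
proof -
  have S: "S \<ge> 0" using assms(2)[of c] by force
  consider "n = 0" | "x = c" "n > 0" | "x \<noteq> c" "n > 0" by auto
  then show ?thesis
  proof cases
    case 3
    have "\<exists>t. (if x < c then x < t \<and> t < c else c < t \<and> t < x) \<and>
      F x = (\<Sum>m<n. (deriv ^^ m) F c / fact m * (x - c) ^ m) + (deriv ^^ n) F t / fact n * (x - c) ^ n"
      by (rule Taylor[where a = "min x c" and b = "max x c"])
        (use 3 smooth_DERIV[OF assms(1)] in \<open>auto simp del: funpow.simps(2)\<close>)
    then obtain t where t: "if x < c then x < t \<and> t < c else c < t \<and> t < x"
      "F x = (\<Sum>m<n. (deriv ^^ m) F c / fact m * (x - c) ^ m) + (deriv ^^ n) F t / fact n * (x - c) ^ n"
      by blast
    from t(1) have "t \<in> closed_segment c x"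
      by (auto simp: closed_segment_eq_real_ivl split: if_splits)
    then have "\<bar>(deriv ^^ n) F t\<bar> / fact n \<le> S / 1"
      by (intro frac_le assms(2)) (use S in \<open>auto simp: fact_ge_1\<close>)
    then have "\<bar>(deriv ^^ n) F t\<bar> / fact n * \<bar>x - c\<bar> ^ n \<le> S * \<bar>x - c\<bar> ^ n"
      by (intro mult_right_mono) auto
    then show ?thesis using t(2) by (simp add: abs_mult power_abs)
  next
    case 2
    then obtain m where "n = Suc m" by (cases n) auto
    then show ?thesis using 2 by (simp add: sum.lessThan_Suc_shift)
  qed (use assms(2) in simp)
qed

text \<open>The Taylor polynomial here includes the term of order \<open>n\<close>, as in the
  Whitney norm. That term is itself bounded by \<open>S * \<bar>x - c\<bar> ^ n\<close>, whence the
  factor \<open>2\<close>.\<close>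

lemma taylor_remainder_bound_le:
  assumes "smooth F" "\<And>t. t \<in> closed_segment c x \<Longrightarrow> \<bar>(deriv ^^ n) F t\<bar> \<le> S"
  shows "\<bar>F x - (\<Sum>i\<le>n. (deriv ^^ i) F c / fact i * (x - c) ^ i)\<bar> \<le> 2 * S * \<bar>x - c\<bar> ^ n"
proof -
  let ?last = "(deriv ^^ n) F c / fact n * (x - c) ^ n"
  have "\<bar>(deriv ^^ n) F c\<bar> / fact n \<le> S / 1"
    using assms(2)[of c] by (intro frac_le) (auto simp: fact_ge_1)
  then have "\<bar>(deriv ^^ n) F c\<bar> / fact n * \<bar>x - c\<bar> ^ n \<le> S * \<bar>x - c\<bar> ^ n"
    by (intro mult_right_mono) auto
  then have "\<bar>?last\<bar> \<le> S * \<bar>x - c\<bar> ^ n" by (simp add: abs_mult power_abs)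
  moreover have "(\<Sum>i\<le>n. (deriv ^^ i) F c / fact i * (x - c) ^ i)
      = (\<Sum>i<n. (deriv ^^ i) F c / fact i * (x - c) ^ i) + ?last"
    by (simp flip: lessThan_Suc_atMost)
  moreover have "\<bar>F x - (\<Sum>i<n. (deriv ^^ i) F c / fact i * (x - c) ^ i)\<bar> \<le> S * \<bar>x - c\<bar> ^ n"
    using assms by (rule taylor_remainder_bound)
  ultimately show ?thesis by linarith
qed

text \<open>With the factorials split off, differentiation merely shifts the coefficient sequence
  \<open>a\<close>.\<close>

lemma higher_deriv_taylor_poly:
  fixes a :: "nat \<Rightarrow> real" and y :: real and q :: nat
  defines "T \<equiv> \<lambda>x. \<Sum>i\<le>q. a i / fact i * (x - y) ^ i"
  shows "smooth T"
    and "k \<le> q \<Longrightarrow> (deriv ^^ k) T x = (\<Sum>i\<le>q - k. a (k + i) / fact i * (x - y) ^ i)"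
proof -
  define D where "D k x = (\<Sum>i=k..q. a i / fact (i - k) * (x - y) ^ (i - k))" for k x
  have D: "(D k has_real_derivative D (Suc k) x) (at x)" for k x
  proof -
    have "((\<lambda>x. a i / fact (i - k) * (x - y) ^ (i - k)) has_real_derivative
        (if i \<ge> Suc k then a i / fact (i - Suc k) * (x - y) ^ (i - Suc k) else 0)) (at x)"
      if "i \<in> {k..q}" for i
    proof (cases "i = k")
      case False
      define m where "m = i - Suc k"
      have m: "i - k = Suc m" "i \<ge> Suc k" using that False by (auto simp: m_def)
      have "((\<lambda>x. (x - y) ^ Suc m) has_real_derivative (1 + real m) * (1 * (x - y) ^ m)) (at x)"
        by (intro DERIV_power_Suc) (auto intro!: derivative_eq_intros)
      from DERIV_cmult[OF this, of "a i / fact (Suc m)"]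
      have "((\<lambda>x. a i / fact (Suc m) * (x - y) ^ Suc m) has_real_derivative
          a i / ((1 + real m) * fact m) * ((1 + real m) * (x - y) ^ m)) (at x)" by simp
      also have "a i / ((1 + real m) * fact m) * ((1 + real m) * (x - y) ^ m) = a i / fact m * (x - y) ^ m"
        by (simp add: add_nonneg_eq_0_iff)
      finally show ?thesis
        using m by (simp add: m_def[symmetric] del: power_Suc fact_Suc)
    qed simp
    then have "(D k has_real_derivative
        (\<Sum>i=k..q. if i \<ge> Suc k then a i / fact (i - Suc k) * (x - y) ^ (i - Suc k) else 0)) (at x)"
      unfolding D_def by (rule DERIV_sum)
    also have "(\<Sum>i=k..q. if i \<ge> Suc k then a i / fact (i - Suc k) * (x - y) ^ (i - Suc k) else 0)
        = D (Suc k) x"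
      unfolding D_def by (intro sum.mono_neutral_cong_right) auto
    finally show ?thesis .
  qed
  have T: "D 0 = T" by (simp add: D_def T_def fun_eq_iff atLeast0AtMost)
  show "smooth T" using smoothI[of D, OF D] T by simp
  assume "k \<le> q"
  then have "D k x = (\<Sum>i\<le>q - k. a (k + i) / fact i * (x - y) ^ i)"
    unfolding D_def by (intro sum.reindex_bij_witness[of _ "\<lambda>i. k + i" "\<lambda>i. i - k"]) auto
  then show "(deriv ^^ k) T x = (\<Sum>i\<le>q - k. a (k + i) / fact i * (x - y) ^ i)"
    using higher_deriv_eqI[of D k, OF D] T by simp
qed

section \<open>Extending a jet at zero from values at a geometric sequence\<close>

text \<open>The Lagrange basis for the nodes \<open>exp 0, ..., exp N\<close>. These are the points
  \<open>exp (- k + i)\<close> after magnification by \<open>exp k\<close>.\<close>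

definition lagrange_poly :: "nat \<Rightarrow> nat \<Rightarrow> real poly" where
  "lagrange_poly N i =
     (\<Prod>j\<in>{..N} - {i}. smult (1 / (exp (real i) - exp (real j))) [:- exp (real j), 1:])"

lemma degree_lagrange_poly:
  assumes "i \<le> N" shows "degree (lagrange_poly N i) \<le> N"
proof -
  have "degree (lagrange_poly N i) \<le>
      (\<Sum>j\<in>{..N} - {i}. degree (smult (1 / (exp (real i) - exp (real j))) [:- exp (real j), 1:]))"
    unfolding lagrange_poly_def
    by (rule order_trans[OF degree_prod_sum_le]) (simp_all add: o_def)
  also have "\<dots> \<le> (\<Sum>j\<in>{..N} - {i}. 1)"
    by (intro sum_mono) auto
  also have "\<dots> = N" using assms by simp
  finally show ?thesis .
qed

lemma poly_lagrange_poly_node: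
  assumes "i \<le> N" "j \<le> N"
  shows "poly (lagrange_poly N i) (exp (real j)) = (if i = j then 1 else 0)"
proof (cases "i = j")
  case True
  then have "poly (lagrange_poly N i) (exp (real j)) = (\<Prod>l\<in>{..N} - {j}. 1)"
    unfolding lagrange_poly_def poly_prod
    by (intro prod.cong) (auto simp flip: diff_divide_distrib)
  then show ?thesis using True by simp
next
  case False
  then show ?thesis
    unfolding lagrange_poly_def poly_prod using assms by (auto intro!: prod_zero)
qed

text \<open>Both sides are polynomials in \<open>y\<close> of degree at most \<open>N\<close>, and
  they agree at the \<open>N + 1\<close> nodes.\<close>

lemma lagrange_reproduces_power:
  assumes "n \<le> N"
  shows "(\<Sum>i\<le>N. exp (real i) ^ n * poly (lagrange_poly N i) y) = y ^ n"
proof -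
  define p where "p = (\<Sum>i\<le>N. smult (exp (real i) ^ n) (lagrange_poly N i))"
  have inj: "inj_on (\<lambda>i. exp (real i)) {..N}" by (auto simp: inj_on_def)
  have "p = monom 1 n"
  proof (rule poly_eqI_degree)
    show "poly p x = poly (monom 1 n) x" if x: "x \<in> (\<lambda>i. exp (real i)) ` {..N}" for x
    proof -
      obtain j where j: "j \<le> N" "x = exp (real j)" using x by auto
      have "poly p x = (\<Sum>i\<le>N. if i = j then exp (real i) ^ n else 0)"
        unfolding p_def poly_sum using j by (intro sum.cong) (auto simp: poly_lagrange_poly_node)
      then show ?thesis using j by (simp add: poly_monom)
    qed
    have "degree p \<le> N"
      unfolding p_def
      by (intro degree_sum_le) (auto intro: order_trans[OF degree_smult_le] degree_lagrange_poly)
    then show "card ((\<lambda>i. exp (real i)) ` {..N}) > degree p"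
      by (simp add: card_image[OF inj])
    show "card ((\<lambda>i. exp (real i)) ` {..N}) > degree (monom (1::real) n)"
      using assms by (simp add: card_image[OF inj] degree_monom_eq)
  qed
  then have "poly p y = y ^ n" by (simp add: poly_monom)
  then show ?thesis by (simp add: p_def poly_sum)
qed

lemma smooth_poly: "smooth (poly p)"
proof -
  have "smooth (\<lambda>x. \<Sum>i\<le>degree p. coeff p i * x ^ i)"
    by (intro smooth_sum(1) smooth_power smooth_ident)
  then show ?thesis by (simp add: poly_altdef[abs_def])
qed

text \<open>The factor \<open>\<mu>\<close> acts on the polynomial but not on the cut-off: with
  \<open>\<mu> = exp (- 1)\<close> an interpolant belonging to the next coarser scale is written,
  and cut off, on the current scale.\<close>

definition lagrange_atom :: "nat \<Rightarrow> real \<Rightarrow> nat \<Rightarrow> real \<Rightarrow> real" where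
  "lagrange_atom N \<mu> i y = poly (lagrange_poly N i) (\<mu> * y) * bump y"

lemma smooth_lagrange_atom: "smooth (lagrange_atom N \<mu> i)"
proof -
  have "smooth (\<lambda>y. poly (lagrange_poly N i) (\<mu> * y))"
    using smooth_affine(1)[OF smooth_poly, of "lagrange_poly N i" \<mu> 0] by simp
  then show ?thesis
    unfolding lagrange_atom_def[abs_def] by (intro smooth_mult smooth_bump)
qed

text \<open>The bound may depend on \<open>N\<close> in an uncontrolled way, which is why the
  degrees are later made to grow slowly.\<close>

lemma lagrange_atom_bounded:
  "\<exists>B. (\<forall>N q. B N q \<ge> 0) \<and>
     (\<forall>N q i y. i \<le> N \<longrightarrow> \<bar>(deriv ^^ q) (lagrange_atom N \<mu> i) y\<bar> \<le> B N q)"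
proof -
  have ex: "\<exists>B. \<forall>y. \<bar>(deriv ^^ q) (lagrange_atom N \<mu> i) y\<bar> \<le> B" for N q i
  proof -
    have "lagrange_atom N \<mu> i x = 0" if "x \<notin> {- (1 / 4)..1 / 4}" for x
      using that bump_eq_0[of x] by (auto simp: lagrange_atom_def)
    then show ?thesis
      using higher_deriv_bounded[OF smooth_lagrange_atom] by metis
  qed
  define B
    where "B N q i = (SOME B. \<forall>y. \<bar>(deriv ^^ q) (lagrange_atom N \<mu> i) y\<bar> \<le> B)" for N q i
  have B: "\<bar>(deriv ^^ q) (lagrange_atom N \<mu> i) y\<bar> \<le> B N q i" for N q i y
    using someI_ex[OF ex[of q N i]] unfolding B_def by blast
  show ?thesis
  proof (intro exI[of _ "\<lambda>N q. \<Sum>i\<le>N. \<bar>B N q i\<bar>"] conjI allI impI)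
    fix N q i :: nat and y :: real assume "i \<le> N"
    have "\<bar>(deriv ^^ q) (lagrange_atom N \<mu> i) y\<bar> \<le> \<bar>B N q i\<bar>" using B[of q N i y] by linarith
    also have "\<dots> \<le> (\<Sum>i\<le>N. \<bar>B N q i\<bar>)" using \<open>i \<le> N\<close> by (intro member_le_sum) auto
    finally show "\<bar>(deriv ^^ q) (lagrange_atom N \<mu> i) y\<bar> \<le> (\<Sum>i\<le>N. \<bar>B N q i\<bar>)" .
  qed (simp add: sum_nonneg)
qed

text \<open>\<open>N k\<close> is the largest \<open>n \<le> k\<close> whose cost \<open>B n\<close>
  is affordable at stage \<open>k\<close>. The constant \<open>\<bar>B 0\<bar> + 1\<close> makes
  \<open>n = 0\<close> always affordable, and since \<open>g\<close> tends to infinity every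
  \<open>n\<close> eventually is.\<close>

lemma slowly_growing_index:
  fixes B g :: "nat \<Rightarrow> real"
  assumes g: "filterlim g at_top sequentially" "\<And>k. g k \<ge> 1"
  obtains N where "\<And>k. N k \<le> k" "\<And>k. B (N k) \<le> (\<bar>B 0\<bar> + 1) * g k"
    "filterlim N at_top sequentially"
proof -
  define A where "A k = {n. n \<le> k \<and> B n \<le> (\<bar>B 0\<bar> + 1) * g k}" for k
  have "\<bar>B 0\<bar> * 1 \<le> (\<bar>B 0\<bar> + 1) * g k" for k
    using g(2)[of k] by (intro mult_mono) auto
  then have 0: "0 \<in> A k" for k unfolding A_def by (auto intro: order_trans[OF abs_ge_self])
  have fin: "finite (A k)" for k unfolding A_def by auto
  have Max: "Max (A k) \<in> A k" for k using 0[of k] fin[of k] by (intro Max_in) auto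
  show ?thesis
  proof (rule that[of "\<lambda>k. Max (A k)"])
    show "filterlim (\<lambda>k. Max (A k)) at_top sequentially"
      unfolding filterlim_at_top
    proof
      fix m :: nat
      have "eventually (\<lambda>k. g k \<ge> B m) sequentially" using g(1) unfolding filterlim_at_top by blast
      then show "eventually (\<lambda>k. Max (A k) \<ge> m) sequentially"
        using eventually_ge_at_top[of m]
      proof eventually_elim
        case (elim k)
        have "1 * g k \<le> (\<bar>B 0\<bar> + 1) * g k" using g(2)[of k] by (intro mult_right_mono) auto
        with elim have "m \<in> A k" unfolding A_def by auto
        then show ?case using fin by (rule Max_ge[rotated])
      qed
    qed
  qed (use Max in \<open>auto simp: A_def\<close>)
qed

text \<open>The \<open>a m\<close> play the role of Taylor coefficients at \<open>0\<close>, with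
  the factorial already divided out, of a function whose value at \<open>exp (- j)\<close> is
  \<open>v j\<close>.\<close>

definition jet_approx :: "(nat \<Rightarrow> real) \<Rightarrow> (nat \<Rightarrow> real) \<Rightarrow> nat \<Rightarrow> real \<Rightarrow> bool" where
  "jet_approx v a r M \<longleftrightarrow> (\<forall>m\<le>r. \<bar>a m\<bar> \<le> M) \<and>
     (\<forall>j. \<bar>v j - (\<Sum>m\<le>r. a m * exp (- real j) ^ m)\<bar> \<le> M * exp (- real j) ^ r)"

text \<open>Approximability to every order makes \<open>J v\<close> smooth, but its constants do not
  enter \<open>bound\<close>: the derivative of order \<open>q\<close> is controlled by the
  approximation of order \<open>Suc q\<close> alone.\<close>

locale jet_extension =
  fixes J :: "(nat \<Rightarrow> real) \<Rightarrow> real \<Rightarrow> real" and C :: "nat \<Rightarrow> real"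
  assumes support: "\<bar>x\<bar> \<ge> 1 / 4 \<Longrightarrow> J v x = 0"
    and smooth: "(\<And>r. \<exists>M. jet_approx v a r M) \<Longrightarrow> smooth (J v)"
    and jet: "(\<And>r. \<exists>M. jet_approx v a r M) \<Longrightarrow> (deriv ^^ q) (J v) 0 = fact q * a q"
    and bound: "(\<And>r. \<exists>M. jet_approx v a r M) \<Longrightarrow> jet_approx v a (Suc q) M \<Longrightarrow>
      \<bar>(deriv ^^ q) (J v) x\<bar> \<le> C q * M"
    and linear: "(\<And>r. \<exists>M. jet_approx v a r M) \<Longrightarrow> (\<And>r. \<exists>M. jet_approx w b r M) \<Longrightarrow>
      J (\<lambda>j. c * v j + d * w j) x = c * J v x + d * J w x"

text \<open>The value \<open>v j\<close> stands for the value of a function at \<open>exp (- j)\<close>. On the scale \<open>exp (- k)\<close> this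
  function is interpolated at the \<open>N k + 1\<close> nodes \<open>exp (- k + i)\<close>; the terms below are the
  differences of consecutive interpolants, cut off at this scale.\<close>

definition jet_term :: "(nat \<Rightarrow> nat) \<Rightarrow> (nat \<Rightarrow> real) \<Rightarrow> nat \<Rightarrow> real \<Rightarrow> real" where
  "jet_term N v k x =
     (\<Sum>i\<le>N k. v (k - i) * lagrange_atom (N k) 1 i (exp (real k) * x)) -
     (if k = 0 then 0
      else \<Sum>i\<le>N (k - 1). v (k - 1 - i) * lagrange_atom (N (k - 1)) (exp (- 1)) i (exp (real k) * x))"

lemma jet_term_linear:
  "jet_term N (\<lambda>j. c * v j + d * w j) k x = c * jet_term N v k x + d * jet_term N w k x"
  by (simp add: jet_term_def sum.distrib sum_distrib_left algebra_simps)

lemma smooth_jet_term: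
  shows "smooth (jet_term N v k)"
    and "(deriv ^^ q) (jet_term N v k) x = exp (real k) ^ q *
     ((\<Sum>i\<le>N k. v (k - i) * (deriv ^^ q) (lagrange_atom (N k) 1 i) (exp (real k) * x)) -
     (if k = 0 then 0
      else \<Sum>i\<le>N (k - 1). v (k - 1 - i) *
        (deriv ^^ q) (lagrange_atom (N (k - 1)) (exp (- 1)) i) (exp (real k) * x)))"
proof -
  define S where "S M \<mu> l x = (\<Sum>i\<le>M. v (l - i) * lagrange_atom M \<mu> i x)" for M \<mu> l x
  have S: "smooth (S M \<mu> l)"
    "(deriv ^^ q) (S M \<mu> l) = (\<lambda>x. \<Sum>i\<le>M. v (l - i) * (deriv ^^ q) (lagrange_atom M \<mu> i) x)" for M \<mu> l q
    unfolding S_def[abs_def] by (intro smooth_sum smooth_lagrange_atom)+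
  have A: "smooth (\<lambda>x. S M \<mu> l (exp (real k) * x))"
    "(deriv ^^ q) (\<lambda>x. S M \<mu> l (exp (real k) * x)) = (\<lambda>x. exp (real k) ^ q * (deriv ^^ q) (S M \<mu> l) (exp (real k) * x))"
    for M \<mu> l q
    using smooth_affine(1)[OF S(1), of M \<mu> l "exp (real k)" 0]
      smooth_affine(2)[OF S(1), of q M \<mu> l "exp (real k)" 0] by simp_all
  have eq: "jet_term N v k = (if k = 0 then (\<lambda>x. S (N k) 1 k (exp (real k) * x)) else
      (\<lambda>x. S (N k) 1 k (exp (real k) * x) - S (N (k - 1)) (exp (- 1)) (k - 1) (exp (real k) * x)))"
    by (auto simp: jet_term_def S_def fun_eq_iff)
  show "smooth (jet_term N v k)"
    unfolding eq using A(1) by (auto intro: smooth_diff)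
  show "(deriv ^^ q) (jet_term N v k) x = exp (real k) ^ q *
     ((\<Sum>i\<le>N k. v (k - i) * (deriv ^^ q) (lagrange_atom (N k) 1 i) (exp (real k) * x)) -
     (if k = 0 then 0
      else \<Sum>i\<le>N (k - 1). v (k - 1 - i) *
        (deriv ^^ q) (lagrange_atom (N (k - 1)) (exp (- 1)) i) (exp (real k) * x)))"
    unfolding eq by (auto simp: smooth_diff(2)[OF A(1) A(1)] A(2) S(2) right_diff_distrib)
qed

text \<open>Because of \<open>N \<le> l\<close> the difference \<open>l - i\<close> is not
  truncated, so the sampled powers are, up to the factor \<open>exp (- real l) ^ m\<close>, powers
  of the nodes.\<close>

lemma lagrange_atom_reproduces:
  assumes "N \<le> l" "r \<le> N"
  shows "(\<Sum>i\<le>N. (\<Sum>m\<le>r. a m * exp (- real (l - i)) ^ m) * lagrange_atom N \<mu> i y) =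
    (\<Sum>m\<le>r. a m * (exp (- real l) * \<mu> * y) ^ m) * bump y"
proof -
  have "(\<Sum>i\<le>N. (\<Sum>m\<le>r. a m * exp (- real (l - i)) ^ m) * lagrange_atom N \<mu> i y) =
    (\<Sum>m\<le>r. a m * exp (- real l) ^ m * (\<Sum>i\<le>N. exp (real i) ^ m * poly (lagrange_poly N i) (\<mu> * y)) * bump y)"
    unfolding sum_distrib_left sum_distrib_right lagrange_atom_def
  proof (subst sum.swap, intro sum.cong refl)
    fix m i assume "i \<in> {..N}"
    then have "exp (- real (l - i)) = exp (- real l) * exp (real i)"
      using assms by (simp add: of_nat_diff flip: exp_add)
    then show "a m * exp (- real (l - i)) ^ m * (poly (lagrange_poly N i) (\<mu> * y) * bump y) =
         a m * exp (- real l) ^ m * (exp (real i) ^ m * poly (lagrange_poly N i) (\<mu> * y)) * bump y"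
      by (simp add: power_mult_distrib)
  qed
  also have "\<dots> = (\<Sum>m\<le>r. a m * exp (- real l) ^ m * (\<mu> * y) ^ m * bump y)"
    using assms by (intro sum.cong refl) (simp add: lagrange_reproduces_power)
  finally show ?thesis
    by (simp add: sum_distrib_right power_mult_distrib mult.assoc)
qed

text \<open>Both consecutive interpolants reproduce a polynomial of degree \<open>r\<close>, so
  their difference vanishes. Hence a term of high index sees only the Taylor remainder of the
  data.\<close>

lemma jet_term_taylor:
  assumes "\<And>k. N k \<le> k" "k > 0" "r \<le> N k" "r \<le> N (k - 1)"
  shows "jet_term N (\<lambda>j. \<Sum>m\<le>r. a m * exp (- real j) ^ m) k x = 0"
proof -
  have "exp (- real k) * exp (real k) = 1" by (simp flip: exp_add)
  moreover have "exp (- real (k - 1)) * exp (- 1) * exp (real k) = 1"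
    using assms(2) by (simp add: of_nat_diff flip: exp_add)
  ultimately have eqs: "exp (- real k) * 1 * (exp (real k) * x) = x"
    "exp (- real (k - 1)) * exp (- 1) * (exp (real k) * x) = x"
    by (simp_all flip: mult.assoc)
  then show ?thesis
    using assms(2) unfolding jet_term_def
      lagrange_atom_reproduces[OF assms(1)[of k] assms(3)]
      lagrange_atom_reproduces[OF assms(1)[of "k - 1"] assms(4)] eqs
    by simp
qed

text \<open>Near \<open>0\<close> the cut-offs equal \<open>1\<close>, so the atom with factor
  \<open>\<mu>\<close> is a dilation of the atom with factor \<open>1\<close>. This makes the
  derivatives of \<open>jet_term\<close> at \<open>0\<close> telescope.\<close>

lemma lagrange_atom_scaled_deriv_at_0:
  assumes "\<bar>\<mu>\<bar> \<le> 1"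
  shows "(deriv ^^ q) (lagrange_atom n \<mu> i) 0 = \<mu> ^ q * (deriv ^^ q) (lagrange_atom n 1 i) 0"
proof -
  have "(deriv ^^ q) (lagrange_atom n \<mu> i) 0 = (deriv ^^ q) (\<lambda>y. lagrange_atom n 1 i (\<mu> * y + 0)) 0"
  proof (rule higher_deriv_cong_open[of "ball 0 (1 / 8)"])
    fix y :: real assume "y \<in> ball 0 (1 / 8)"
    then have "\<bar>y\<bar> \<le> 1 / 8" by auto
    moreover from this have "\<bar>\<mu> * y\<bar> \<le> 1 * (1 / 8)"
      unfolding abs_mult using assms by (intro mult_mono) auto
    ultimately show "lagrange_atom n \<mu> i y = lagrange_atom n 1 i (\<mu> * y + 0)"
      by (simp add: lagrange_atom_def bump_eq_1)
  qed auto
  also have "\<dots> = \<mu> ^ q * (deriv ^^ q) (lagrange_atom n 1 i) (\<mu> * 0 + 0)"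
    by (subst smooth_affine(2)[OF smooth_lagrange_atom]) (rule refl)
  finally show ?thesis by simp
qed

lemma lagrange_sum_taylor_deriv_at_0:
  assumes "N \<le> k" "r \<le> N" "q \<le> r"
  shows "(\<Sum>i\<le>N. (\<Sum>m\<le>r. a m * exp (- real (k - i)) ^ m) * (deriv ^^ q) (lagrange_atom N 1 i) 0) =
    exp (- real k) ^ q * (fact q * a q)"
proof -
  let ?c = "\<lambda>m. exp (- real k) ^ m * (fact m * a m)"
  have "(\<Sum>i\<le>N. (\<Sum>m\<le>r. a m * exp (- real (k - i)) ^ m) * (deriv ^^ q) (lagrange_atom N 1 i) 0) =
    (deriv ^^ q) (\<lambda>y. \<Sum>i\<le>N. (\<Sum>m\<le>r. a m * exp (- real (k - i)) ^ m) * lagrange_atom N 1 i y) 0"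
    by (simp add: smooth_sum(2)[OF smooth_lagrange_atom])
  also have "\<dots> = (deriv ^^ q) (\<lambda>y. \<Sum>m\<le>r. ?c m / fact m * (y - 0) ^ m) 0"
  proof (rule higher_deriv_cong_open[of "ball 0 (1 / 8)"])
    fix y :: real assume "y \<in> ball 0 (1 / 8)"
    then show "(\<Sum>i\<le>N. (\<Sum>m\<le>r. a m * exp (- real (k - i)) ^ m) * lagrange_atom N 1 i y) =
        (\<Sum>m\<le>r. ?c m / fact m * (y - 0) ^ m)"
      unfolding lagrange_atom_reproduces[OF assms(1,2)]
      by (auto simp: bump_eq_1 power_mult_distrib intro!: sum.cong)
  qed auto
  also have "\<dots> = (\<Sum>i\<le>r - q. ?c (q + i) / fact i * (0 - 0) ^ i)"
    by (rule higher_deriv_taylor_poly(2)[OF assms(3)])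
  also have "\<dots> = (\<Sum>i\<in>{0::nat}. ?c q)"
    by (intro sum.mono_neutral_cong_right) auto
  finally show ?thesis by simp
qed

text \<open>In the term of index \<open>k\<close>, differentiating \<open>q\<close> times costs
  \<open>exp (real k) ^ q\<close>, while a remainder of order \<open>Suc q\<close> gains
  \<open>exp (- real k) ^ Suc q\<close>. Allowing the interpolation constants to grow like
  \<open>exp (real k / 2)\<close> still leaves a convergent geometric series.\<close>

theorem jet_extension_exists: "\<exists>J C. jet_extension J C"
proof -
  obtain B1 where "(\<forall>N q. B1 N q \<ge> 0) \<and>
      (\<forall>N q i y. i \<le> N \<longrightarrow> \<bar>(deriv ^^ q) (lagrange_atom N 1 i) y\<bar> \<le> B1 N q)"
    using lagrange_atom_bounded ..
  then have B1: "B1 N q \<ge> 0" "i \<le> N \<Longrightarrow> \<bar>(deriv ^^ q) (lagrange_atom N 1 i) y\<bar> \<le> B1 N q"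
    for N q i y by auto
  obtain B2 where "(\<forall>N q. B2 N q \<ge> 0) \<and>
      (\<forall>N q i y. i \<le> N \<longrightarrow> \<bar>(deriv ^^ q) (lagrange_atom N (exp (- 1)) i) y\<bar> \<le> B2 N q)"
    using lagrange_atom_bounded ..
  then have B2: "B2 N q \<ge> 0"
    "i \<le> N \<Longrightarrow> \<bar>(deriv ^^ q) (lagrange_atom N (exp (- 1)) i) y\<bar> \<le> B2 N q"
    for N q i y by auto
  define B where "B N q = B1 N q + B2 N q" for N q
  have Bpos: "B N q \<ge> 0" for N q using B1(1) B2(1) by (simp add: B_def)
  have BB1: "\<bar>(deriv ^^ q) (lagrange_atom N 1 i) y\<bar> \<le> B N q" if "i \<le> N" for N q i y
    using B1(2)[OF that, of q y] B2(1)[of N q] unfolding B_def by linarith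
  have BB2: "\<bar>(deriv ^^ q) (lagrange_atom N (exp (- 1)) i) y\<bar> \<le> B N q" if "i \<le> N" for N q i y
    using B2(2)[OF that, of q y] B1(1)[of N q] unfolding B_def by linarith
  \<comment> \<open>Number of nodes, loss from the largest node, and atom bounds for all orders up
    to \<open>N\<close>. Summing over the orders lets one choice of degrees serve every
    \<open>q\<close>.\<close>
  define cost where "cost N = real (N + 1) * (exp (real N + 1) ^ N * (\<Sum>q\<le>N. B N q))" for N
  have cost_pos: "cost N \<ge> 0" for N
    unfolding cost_def by (intro mult_nonneg_nonneg sum_nonneg Bpos) auto
  have "filterlim (\<lambda>k::nat. exp (real k / 2)) at_top sequentially"
    by real_asymp
  then obtain N where N: "\<And>k. N k \<le> k" "\<And>k. cost (N k) \<le> (\<bar>cost 0\<bar> + 1) * exp (real k / 2)"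
    "filterlim N at_top sequentially"
    using slowly_growing_index[of "\<lambda>k. exp (real k / 2)" cost] by auto
  define D where "D = \<bar>cost 0\<bar> + 1"
  have D: "D > 0" by (simp add: D_def)

  \<comment> \<open>The shift to \<open>real l + 1\<close> makes one estimate fit both interpolants
    of a term: for \<open>l = k - 1\<close> it yields exactly \<open>exp (- real k)\<close>, for
    \<open>l = k\<close> something smaller.\<close>
  have weighted: "\<bar>\<Sum>i\<le>n. d (l - i) * A i\<bar> \<le> M * exp (- (real l + 1)) ^ r * cost n"
    if "n \<le> l" "r \<le> n" "q \<le> n" "\<And>j. \<bar>d j\<bar> \<le> M * exp (- real j) ^ r" "\<And>i. i \<le> n \<Longrightarrow> \<bar>A i\<bar> \<le> B n q"
    for n l r q and d A :: "nat \<Rightarrow> real" and M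
  proof -
    have M: "M \<ge> 0" using that(4)[of 0] by simp
    have Bsum: "B n q \<le> (\<Sum>q\<le>n. B n q)" using that(3) by (intro member_le_sum) (auto simp: Bpos)
    have "\<bar>\<Sum>i\<le>n. d (l - i) * A i\<bar> \<le> (\<Sum>i\<le>n. \<bar>d (l - i)\<bar> * \<bar>A i\<bar>)"
      by (rule order_trans[OF sum_abs]) (simp add: abs_mult)
    also have "\<dots> \<le> (\<Sum>i\<le>n. M * exp (- (real l + 1)) ^ r * (exp (real n + 1) ^ n * (\<Sum>q\<le>n. B n q)))"
    proof (rule sum_mono)
      fix i assume "i \<in> {..n}"
      then have i: "i \<le> n" by simp
      have "exp (- real (l - i)) ^ r = exp (- (real l + 1)) ^ r * exp (real i + 1) ^ r"
        using i that(1) by (simp add: of_nat_diff flip: exp_add power_mult_distrib)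
      also have "\<dots> \<le> exp (- (real l + 1)) ^ r * exp (real n + 1) ^ n"
      proof (intro mult_left_mono)
        have "exp (real i + 1) ^ r \<le> exp (real n + 1) ^ r" using i by (intro power_mono) auto
        also have "\<dots> \<le> exp (real n + 1) ^ n" using that(2) by (intro power_increasing) auto
        finally show "exp (real i + 1) ^ r \<le> exp (real n + 1) ^ n" .
      qed auto
      finally have "\<bar>d (l - i)\<bar> \<le> M * (exp (- (real l + 1)) ^ r * exp (real n + 1) ^ n)"
        using that(4)[of "l - i"] M by (meson mult_left_mono order_trans)
      moreover have "\<bar>A i\<bar> \<le> (\<Sum>q\<le>n. B n q)" using that(5)[OF i] Bsum by linarith
      ultimately have "\<bar>d (l - i)\<bar> * \<bar>A i\<bar> \<le>
          M * (exp (- (real l + 1)) ^ r * exp (real n + 1) ^ n) * (\<Sum>q\<le>n. B n q)"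
        using M by (intro mult_mono) auto
      then show "\<bar>d (l - i)\<bar> * \<bar>A i\<bar> \<le>
          M * exp (- (real l + 1)) ^ r * (exp (real n + 1) ^ n * (\<Sum>q\<le>n. B n q))"
        by (simp add: mult_ac)
    qed
    finally show ?thesis by (simp add: cost_def mult_ac)
  qed

  \<comment> \<open>This bound serves the finitely many \<open>k\<close> for which the degrees are
    still below \<open>Suc q\<close>, or \<open>k = 0\<close>; there no decay is required.\<close>
  define crude where "crude q k = exp (real k) ^ q *
    (real (N k + 1) * (real (q + 3) * B (N k) q) + real (N (k - 1) + 1) * (real (q + 3) * B (N (k - 1)) q))"
    for q k
  define c where "c q k = (if k > 0 \<and> Suc q \<le> N k \<and> Suc q \<le> N (k - 1)
    then 2 * D * exp (- (1 / 2)) ^ k else crude q k)" for q k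

  have summable_c: "summable (c q)" for q
  proof -
    obtain K where K: "\<And>k. k \<ge> K \<Longrightarrow> Suc q \<le> N k"
      using N(3) unfolding filterlim_at_top eventually_sequentially by metis
    have "eventually (\<lambda>k. c q k = 2 * D * exp (- (1 / 2)) ^ k) sequentially"
      using eventually_ge_at_top[of "Suc K"]
      by eventually_elim (use K in \<open>auto simp: c_def\<close>)
    moreover have "summable (\<lambda>k. 2 * D * exp (- (1 / 2) :: real) ^ k)"
      by (intro summable_mult summable_geometric) auto
    ultimately show ?thesis by (subst summable_cong)
  qed

  have term_bound: "\<bar>(deriv ^^ q) (jet_term N v k) x\<bar> \<le> M * c q k"
    if va: "jet_approx v a (Suc q) M" for v a q M k x
  proof (cases "k > 0 \<and> Suc q \<le> N k \<and> Suc q \<le> N (k - 1)")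
    case True
    \<comment> \<open>Subtracting the Taylor part does not change the term, by
      \<open>jet_term_taylor\<close>, and leaves data of size
      \<open>M * exp (- real j) ^ Suc q\<close>.\<close>
    define T where "T j = (\<Sum>m\<le>Suc q. a m * exp (- real j) ^ m)" for j
    define d where "d j = v j - T j" for j
    have d: "\<bar>d j\<bar> \<le> M * exp (- real j) ^ Suc q" for j
      using va unfolding jet_approx_def d_def T_def by blast
    have "jet_term N v k x = jet_term N d k x" for x
      using jet_term_linear[of N 1 d 1 T k x] jet_term_taylor[of N k "Suc q" a x] N(1) True
      by (simp add: d_def T_def[abs_def])
    then have vd: "jet_term N v k = jet_term N d k" by blast
    have "(deriv ^^ q) (jet_term N v k) x = exp (real k) ^ q *
     ((\<Sum>i\<le>N k. d (k - i) * (deriv ^^ q) (lagrange_atom (N k) 1 i) (exp (real k) * x)) -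
      (\<Sum>i\<le>N (k - 1). d (k - 1 - i) *
        (deriv ^^ q) (lagrange_atom (N (k - 1)) (exp (- 1)) i) (exp (real k) * x)))"
      (is "_ = _ * (?S1 - ?S2)")
      unfolding vd smooth_jet_term(2) using True by simp
    moreover have "\<bar>?S1 - ?S2\<bar> \<le> M * exp (- real k) ^ Suc q * (D * exp (real k / 2)) * 2"
    proof -
      have M: "M \<ge> 0" using d[of 0] by simp
      have "\<bar>?S1\<bar> \<le> M * exp (- (real k + 1)) ^ Suc q * cost (N k)"
        using True by (intro weighted[where q = q] N d BB1) auto
      also have "\<dots> \<le> M * exp (- real k) ^ Suc q * (D * exp (real k / 2))"
        using M N(2)[of k] unfolding D_def[symmetric] by (intro mult_mono power_mono) (auto simp: cost_pos)
      finally have S1: "\<bar>?S1\<bar> \<le> M * exp (- real k) ^ Suc q * (D * exp (real k / 2))" .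
      have "\<bar>?S2\<bar> \<le> M * exp (- (real (k - 1) + 1)) ^ Suc q * cost (N (k - 1))"
        using True by (intro weighted[where q = q] N d BB2) auto
      also have "\<dots> = M * exp (- real k) ^ Suc q * cost (N (k - 1))"
        using True by (simp add: of_nat_diff)
      also have "\<dots> \<le> M * exp (- real k) ^ Suc q * (D * exp (real (k - 1) / 2))"
        using M N(2)[of "k - 1"] unfolding D_def[symmetric] by (intro mult_left_mono) auto
      also have "\<dots> \<le> M * exp (- real k) ^ Suc q * (D * exp (real k / 2))"
        using M D by (intro mult_left_mono) auto
      finally show ?thesis using S1 by linarith
    qed
    ultimately have "\<bar>(deriv ^^ q) (jet_term N v k) x\<bar> \<le>
        exp (real k) ^ q * (M * exp (- real k) ^ Suc q * (D * exp (real k / 2)) * 2)"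
      by (simp add: abs_mult)
    also have "\<dots> = M * (2 * D * (exp (real k) ^ q * exp (- real k) ^ Suc q * exp (real k / 2)))"
      by (simp add: mult_ac)
    also have "exp (real k) ^ q * exp (- real k) ^ Suc q * exp (real k / 2) = exp (- (1 / 2)) ^ k"
      by (simp flip: exp_of_nat_mult exp_add)
    finally show ?thesis using True by (simp add: c_def)
  next
    case False
    have M: "M \<ge> 0" using va unfolding jet_approx_def by (meson abs_ge_zero le0 order_trans)
    \<comment> \<open>There are \<open>q + 2\<close> Taylor coefficients, and the remainder
      contributes one more \<open>M\<close>.\<close>
    have v: "\<bar>v j\<bar> \<le> real (q + 3) * M" for j
    proof -
      have e: "exp (- real j) ^ m \<le> 1" for m by (intro power_le_one) auto
      have "\<bar>\<Sum>m\<le>Suc q. a m * exp (- real j) ^ m\<bar> \<le> (\<Sum>m\<le>Suc q. \<bar>a m\<bar> * exp (- real j) ^ m)"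
        by (rule order_trans[OF sum_abs]) (simp add: abs_mult)
      also have "\<dots> \<le> (\<Sum>m\<le>Suc q. M * 1)"
        using va e M unfolding jet_approx_def by (intro sum_mono mult_mono) auto
      finally have "\<bar>\<Sum>m\<le>Suc q. a m * exp (- real j) ^ m\<bar> \<le> real (q + 2) * M" by simp
      moreover have "\<bar>v j - (\<Sum>m\<le>Suc q. a m * exp (- real j) ^ m)\<bar> \<le> M * 1"
        using va e M unfolding jet_approx_def by (meson mult_left_mono order_trans)
      moreover have "real (q + 3) * M = real (q + 2) * M + M * 1" by (simp add: algebra_simps)
      ultimately show ?thesis by linarith
    qed
    have S: "\<bar>\<Sum>i\<le>n. v (l - i) * A i\<bar> \<le> M * (real (n + 1) * (real (q + 3) * B n q))"
      if "\<And>i. i \<le> n \<Longrightarrow> \<bar>A i\<bar> \<le> B n q" for n l and A :: "nat \<Rightarrow> real"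
    proof -
      have "\<bar>\<Sum>i\<le>n. v (l - i) * A i\<bar> \<le> (\<Sum>i\<le>n. \<bar>v (l - i)\<bar> * \<bar>A i\<bar>)"
        by (rule order_trans[OF sum_abs]) (simp add: abs_mult)
      also have "\<dots> \<le> (\<Sum>i\<le>n. (real (q + 3) * M) * B n q)"
        using that v M by (intro sum_mono mult_mono) auto
      finally show ?thesis by (simp add: mult_ac)
    qed
    let ?S1 = "\<Sum>i\<le>N k. v (k - i) * (deriv ^^ q) (lagrange_atom (N k) 1 i) (exp (real k) * x)"
    let ?S2 = "\<Sum>i\<le>N (k - 1). v (k - 1 - i) *
        (deriv ^^ q) (lagrange_atom (N (k - 1)) (exp (- 1)) i) (exp (real k) * x)"
    have "\<bar>?S1 - (if k = 0 then 0 else ?S2)\<bar> \<le> M * (real (N k + 1) * (real (q + 3) * B (N k) q)) +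
        M * (real (N (k - 1) + 1) * (real (q + 3) * B (N (k - 1)) q))"
    proof -
      have "\<bar>?S1\<bar> \<le> M * (real (N k + 1) * (real (q + 3) * B (N k) q))"
        by (rule S) (rule BB1)
      moreover have "\<bar>?S2\<bar> \<le> M * (real (N (k - 1) + 1) * (real (q + 3) * B (N (k - 1)) q))"
        by (rule S) (rule BB2)
      moreover have "\<bar>?S1 - (if k = 0 then 0 else ?S2)\<bar> \<le> \<bar>?S1\<bar> + \<bar>?S2\<bar>"
        using abs_triangle_ineq4[of ?S1 ?S2] by auto
      ultimately show ?thesis by linarith
    qed
    then have "exp (real k) ^ q * \<bar>?S1 - (if k = 0 then 0 else ?S2)\<bar> \<le>
      exp (real k) ^ q * (M * (real (N k + 1) * (real (q + 3) * B (N k) q)) +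
        M * (real (N (k - 1) + 1) * (real (q + 3) * B (N (k - 1)) q)))"
      by (intro mult_left_mono) auto
    also have "\<dots> = M * crude q k" unfolding crude_def by (simp only: algebra_simps)
    finally have "exp (real k) ^ q * \<bar>?S1 - (if k = 0 then 0 else ?S2)\<bar> \<le> M * crude q k" .
    moreover have "c q k = crude q k" unfolding c_def using False by (rule if_not_P)
    ultimately show ?thesis
      unfolding smooth_jet_term(2) by (simp add: abs_mult)
  qed

  define J where "J v x = (\<Sum>k. jet_term N v k x)" for v x
  have good: "\<exists>m. \<forall>q k x. \<bar>(deriv ^^ q) (jet_term N v k) x\<bar> \<le> m q * c q k"
    if "\<And>r. \<exists>M. jet_approx v a r M" for v a
  proof (intro choice allI)
    show "\<exists>M. \<forall>k x. \<bar>(deriv ^^ q) (jet_term N v k) x\<bar> \<le> M * c q k" for q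
      using that[of "Suc q"] term_bound by blast
  qed
  have J_series: "smooth (J v)" "(deriv ^^ q) (J v) = (\<lambda>x. \<Sum>k. (deriv ^^ q) (jet_term N v k) x)"
    if va: "\<And>r. \<exists>M. jet_approx v a r M" for v a q
  proof -
    obtain m where m: "\<And>q k x. \<bar>(deriv ^^ q) (jet_term N v k) x\<bar> \<le> m q * c q k"
      using good[OF va] by blast
    have *: "summable (\<lambda>k. m q * c q k)" for q by (intro summable_mult summable_c)
    show "smooth (J v)" "(deriv ^^ q) (J v) = (\<lambda>x. \<Sum>k. (deriv ^^ q) (jet_term N v k) x)"
      unfolding J_def[abs_def] by (intro smooth_suminf[OF smooth_jet_term(1) * m])+
  qed
  have J_summable: "summable (\<lambda>k. (deriv ^^ q) (jet_term N v k) x)"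
    if va: "\<And>r. \<exists>M. jet_approx v a r M" for v a q x
  proof -
    obtain m where m: "\<And>q k x. \<bar>(deriv ^^ q) (jet_term N v k) x\<bar> \<le> m q * c q k"
      using good[OF va] by blast
    have "summable (\<lambda>k. m q * c q k)" by (intro summable_mult summable_c)
    then show ?thesis
      by (rule summable_comparison_test'[where N = 0]) (simp only: real_norm_def m)
  qed

  have "jet_extension J (\<lambda>q. \<Sum>k. c q k)"
  proof
    fix x :: real and v assume x: "\<bar>x\<bar> \<ge> 1 / 4"
    have "bump (exp (real k) * x) = 0" for k
    proof (rule bump_eq_0)
      have "1 * \<bar>x\<bar> \<le> exp (real k) * \<bar>x\<bar>" by (intro mult_right_mono) auto
      then show "\<bar>exp (real k) * x\<bar> \<ge> 1 / 4" using x by (simp add: abs_mult)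
    qed
    then have "jet_term N v k x = 0" for k
      unfolding jet_term_def by (auto simp: lagrange_atom_def)
    then show "J v x = 0" by (simp add: J_def)
  next
    fix v a assume va: "\<And>r. \<exists>M. jet_approx v a r M"
    show "smooth (J v)" using J_series(1)[OF va] .
    fix q
    show "\<bar>(deriv ^^ q) (J v) x\<bar> \<le> (\<Sum>k. c q k) * M" if "jet_approx v a (Suc q) M" for M x
    proof -
      have sM: "summable (\<lambda>k. M * c q k)" by (intro summable_mult summable_c)
      have "\<bar>(deriv ^^ q) (J v) x\<bar> \<le> (\<Sum>k. M * c q k)"
        unfolding J_series(2)[OF va] real_norm_def[symmetric]
        by (rule norm_suminf_le[OF _ sM]) (simp only: real_norm_def term_bound[OF that])
      then show ?thesis by (simp add: suminf_mult[OF summable_c] mult.commute)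
    qed
    show "(deriv ^^ q) (J v) 0 = fact q * a q"
    proof -
      \<comment> \<open>The derivative at \<open>0\<close> of the interpolant on the scale
        \<open>exp (- real k)\<close>. The partial sums of the differentiated series at
        \<open>0\<close> telescope to it.\<close>
      define p where "p k = exp (real k) ^ q * (\<Sum>i\<le>N k. v (k - i) * (deriv ^^ q) (lagrange_atom (N k) 1 i) 0)" for k
      have term0: "(deriv ^^ q) (jet_term N v k) 0 = p k - (if k = 0 then 0 else p (k - 1))" for k
      proof (cases "k = 0")
        case False
        let ?A = "\<lambda>i. (deriv ^^ q) (lagrange_atom (N (k - 1)) 1 i) 0"
        have e: "exp (real (k - 1)) ^ q = exp (real k) ^ q * exp (- 1) ^ q"
          using False by (simp add: of_nat_diff flip: power_mult_distrib exp_add)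
        have "exp (real k) ^ q * (\<Sum>i\<le>N (k - 1). v (k - 1 - i) * (exp (- 1) ^ q * ?A i)) = p (k - 1)"
          unfolding p_def e sum_distrib_left by (intro sum.cong refl) (simp only: mult_ac)
        then show ?thesis
          using False
          by (simp add: smooth_jet_term(2) lagrange_atom_scaled_deriv_at_0[of "exp (- 1)"]
              right_diff_distrib p_def[of k])
      qed (simp add: smooth_jet_term(2) p_def)
      have psum: "(\<Sum>k<Suc n. (deriv ^^ q) (jet_term N v k) 0) = p n" for n
        by (induction n) (simp_all add: term0)
      have "(\<lambda>n. \<Sum>k<n. (deriv ^^ q) (jet_term N v k) 0) \<longlonglongrightarrow> (deriv ^^ q) (J v) 0"
        unfolding J_series(2)[OF va] by (rule summable_LIMSEQ[OF J_summable[OF va]])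
      from LIMSEQ_Suc[OF this] have lim1: "p \<longlonglongrightarrow> (deriv ^^ q) (J v) 0"
        unfolding psum .
      obtain M where M: "jet_approx v a (Suc q) M" using va by blast
      define T where "T j = (\<Sum>m\<le>Suc q. a m * exp (- real j) ^ m)" for j
      have d: "\<bar>v j - T j\<bar> \<le> M * exp (- real j) ^ Suc q" for j
        using M unfolding jet_approx_def T_def by blast
      have M0: "M \<ge> 0" using d[of 0] by simp
      have "eventually (\<lambda>k. N k \<ge> Suc q) sequentially" using N(3) unfolding filterlim_at_top by blast
      then have "eventually (\<lambda>k. norm (p k - fact q * a q) \<le> M * D * exp (- (1 / 2)) ^ k) sequentially"
      proof eventually_elim
        case (elim k)
        let ?A = "\<lambda>i. (deriv ^^ q) (lagrange_atom (N k) 1 i) 0"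
        \<comment> \<open>The Taylor part is interpolated exactly and gives the limit; what the
          remainder adds decays like \<open>exp (- (1 / 2)) ^ k\<close>.\<close>
        have "exp (real k) ^ q * (\<Sum>i\<le>N k. T (k - i) * ?A i) = fact q * a q"
          unfolding T_def lagrange_sum_taylor_deriv_at_0[OF N(1) elim le_SucI[OF order_refl]]
          by (simp flip: mult.assoc power_mult_distrib exp_add)
        then have "p k - fact q * a q = exp (real k) ^ q * (\<Sum>i\<le>N k. (v (k - i) - T (k - i)) * ?A i)"
          by (simp add: p_def left_diff_distrib sum_subtractf right_diff_distrib)
        also have "\<bar>\<dots>\<bar> = exp (real k) ^ q * \<bar>\<Sum>i\<le>N k. (v (k - i) - T (k - i)) * ?A i\<bar>"
          by (simp add: abs_mult)
        also have "\<dots> \<le> exp (real k) ^ q * (M * exp (- (real k + 1)) ^ Suc q * cost (N k))"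
          using elim
          by (intro mult_left_mono weighted[where q = q and d = "\<lambda>j. v j - T j"] N d BB1) auto
        also have "\<dots> \<le> exp (real k) ^ q * (M * exp (- real k) ^ Suc q * (D * exp (real k / 2)))"
          using M0 N(2)[of k] unfolding D_def[symmetric]
          by (intro mult_left_mono mult_mono power_mono) (auto simp: cost_pos)
        also have "\<dots> = M * D * (exp (real k) ^ q * exp (- real k) ^ Suc q * exp (real k / 2))"
          by (simp add: mult_ac)
        also have "exp (real k) ^ q * exp (- real k) ^ Suc q * exp (real k / 2) = exp (- (1 / 2)) ^ k"
          by (simp flip: exp_of_nat_mult exp_add)
        finally show ?case by simp
      qed
      moreover have "(\<lambda>k. M * D * exp (- (1 / 2)) ^ k) \<longlonglongrightarrow> 0"
        using tendsto_mult_left[of "\<lambda>k. exp (- (1 / 2) :: real) ^ k" 0 sequentially "M * D"]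
        by (simp add: LIMSEQ_power_zero)
      ultimately have "(\<lambda>k. p k - fact q * a q) \<longlonglongrightarrow> 0"
        by (rule Lim_null_comparison)
      then have "p \<longlonglongrightarrow> fact q * a q" by (simp add: LIM_zero_iff)
      with lim1 show ?thesis by (rule LIMSEQ_unique)
    qed
    fix w b c d x assume wb: "\<And>r. \<exists>M. jet_approx w b r M"
    show "J (\<lambda>j. c * v j + d * w j) x = c * J v x + d * J w x"
      using J_summable[OF va, of 0 x] J_summable[OF wb, of 0 x]
      unfolding J_def jet_term_linear
      by (simp add: suminf_add[symmetric] suminf_mult summable_mult)
  qed
  then show ?thesis by blast
qed

section \<open>Whitney norms and the extension property\<close>

definition zero_off :: "real set \<Rightarrow> (real \<Rightarrow> real) \<Rightarrow> real \<Rightarrow> real" where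
  "zero_off K F = (\<lambda>x. if x \<in> K then F x else 0)"

lemma whitney_functions_iff: "f \<in> whitney_functions K \<longleftrightarrow> (\<exists>F. smooth F \<and> f = zero_off K F)"
  by (simp add: whitney_functions_def zero_off_def)

lemma zero_off_lincomb:
  "(\<lambda>x. c * zero_off K F x + d * zero_off K G x) = zero_off K (\<lambda>x. c * F x + d * G x)"
  by (auto simp: zero_off_def)

lemma whitney_functions_lincomb:
  assumes "f \<in> whitney_functions K" "g \<in> whitney_functions K"
  shows "(\<lambda>x. c * f x + d * g x) \<in> whitney_functions K"
proof -
  obtain F G where FG: "smooth F" "f = zero_off K F" "smooth G" "g = zero_off K G"
    using assms unfolding whitney_functions_iff by blast
  show ?thesis
    unfolding whitney_functions_iff FG(2,4) zero_off_lincomb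
    using smooth_lincomb(1)[OF FG(1,3)] by blast
qed

locale perfect_in_unit_interval =
  fixes K :: "real set"
  assumes islimpt: "x \<in> K \<Longrightarrow> x islimpt K"
    and subset: "K \<subseteq> {0..1}"
    and nonempty: "K \<noteq> {}"
begin

text \<open>Since every point of \<open>K\<close> is a limit point, all smooth functions inducing
  \<open>f\<close> have the same derivatives on \<open>K\<close>, and the choice in
  \<open>whitney_deriv\<close> is immaterial.\<close>

lemma whitney_deriv_eq:
  assumes "smooth F" "\<And>x. x \<in> K \<Longrightarrow> F x = f x" "x \<in> K"
  shows "whitney_deriv K k f x = (deriv ^^ k) F x"
proof -
  let ?P = "\<lambda>F. smooth F \<and> (\<forall>x\<in>K. F x = f x)"
  have P: "?P (SOME F. ?P F)" using assms by (intro someI[of ?P F]) auto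
  then show ?thesis
    unfolding whitney_deriv_def
    using assms islimpt by (intro higher_deriv_eq_on[of _ F K]) auto
qed

text \<open>On \<open>K\<close> the Taylor remainder of \<open>f\<close> is again the trace of a
  smooth function, namely of \<open>F\<close> minus its Taylor polynomial.\<close>

lemma whitney_deriv_taylor_rem_eq:
  assumes "smooth F" "\<And>x. x \<in> K \<Longrightarrow> F x = f x" "x \<in> K" "y \<in> K" "k \<le> q"
  shows "whitney_deriv K k (taylor_rem K q y f) x =
    (deriv ^^ k) F x - (\<Sum>i\<le>q - k. (deriv ^^ (k + i)) F y / fact i * (x - y) ^ i)"
proof -
  define T where "T x = (\<Sum>i\<le>q. (deriv ^^ i) F y / fact i * (x - y) ^ i)" for x
  have T: "smooth T" "(deriv ^^ k) T x = (\<Sum>i\<le>q - k. (deriv ^^ (k + i)) F y / fact i * (x - y) ^ i)"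
    unfolding T_def[abs_def]
    using higher_deriv_taylor_poly[where a = "\<lambda>i. (deriv ^^ i) F y"] assms(5) by auto
  have "whitney_deriv K k (taylor_rem K q y f) x = (deriv ^^ k) (\<lambda>x. F x - T x) x"
    using assms
    by (intro whitney_deriv_eq smooth_diff T)
      (auto simp: taylor_rem_def taylor_poly_def T_def whitney_deriv_eq[OF assms(1,2)])
  then show ?thesis by (simp add: smooth_diff(2)[OF assms(1) T(1)] T(2))
qed

text \<open>Taylor's formula of order \<open>q - k\<close> for the \<open>k\<close>-th derivative of
  \<open>F\<close>. The segment between two points of \<open>K\<close> stays in
  \<open>{0..1}\<close>, where \<open>F\<close> is controlled.\<close>

lemma remainder_bound:
  assumes "smooth F" "\<And>j x. j \<le> q \<Longrightarrow> x \<in> {0..1} \<Longrightarrow> \<bar>(deriv ^^ j) F x\<bar> \<le> S"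
    and "x \<in> K" "y \<in> K" "k \<le> q"
  shows "\<bar>(deriv ^^ k) F x - (\<Sum>i\<le>q - k. (deriv ^^ (k + i)) F y / fact i * (x - y) ^ i)\<bar>
    \<le> 2 * S * \<bar>x - y\<bar> ^ (q - k)"
proof -
  have eq: "(deriv ^^ i) ((deriv ^^ k) F) = (deriv ^^ (k + i)) F" for i
    by (simp add: funpow_add add.commute[of k])
  have "\<bar>(deriv ^^ k) F x - (\<Sum>i\<le>q - k. (deriv ^^ i) ((deriv ^^ k) F) y / fact i * (x - y) ^ i)\<bar>
    \<le> 2 * S * \<bar>x - y\<bar> ^ (q - k)"
  proof (intro taylor_remainder_bound_le smooth_higher_deriv assms)
    fix t assume "t \<in> closed_segment y x"
    moreover have "closed_segment y x \<subseteq> {0..1}"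
      using assms(3,4) subset by (intro closed_segment_subset) auto
    ultimately show "\<bar>(deriv ^^ (q - k)) ((deriv ^^ k) F) t\<bar> \<le> S"
      using assms(2)[of q t] assms(5) by (auto simp: eq)
  qed
  then show ?thesis by (simp add: eq)
qed

lemma exists_two_points: "\<exists>x\<in>K. \<exists>y\<in>K. x \<noteq> y"
proof -
  obtain x where x: "x \<in> K" using nonempty by blast
  then have "\<exists>y\<in>K. y \<in> UNIV \<and> y \<noteq> x"
    using islimpt[OF x] unfolding islimpt_def by (elim allE[of _ UNIV]) simp
  with x show ?thesis by blast
qed

context
  fixes F f q S
  assumes smooth: "smooth F" and ext: "\<And>x. x \<in> K \<Longrightarrow> F x = f x"
    and S: "\<And>j x. j \<le> q \<Longrightarrow> x \<in> {0..1} \<Longrightarrow> \<bar>(deriv ^^ j) F x\<bar> \<le> S"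
begin

lemma whitney_derivs_le: "z \<in> {\<bar>whitney_deriv K k f x\<bar> | x k. x \<in> K \<and> k \<le> q} \<Longrightarrow> z \<le> S"
proof -
  assume "z \<in> {\<bar>whitney_deriv K k f x\<bar> | x k. x \<in> K \<and> k \<le> q}"
  then obtain x k where "x \<in> K" "k \<le> q" "z = \<bar>whitney_deriv K k f x\<bar>" by blast
  then show ?thesis using S[of k x] subset by (auto simp: whitney_deriv_eq[OF smooth ext])
qed

lemma whitney_rems_le:
  "z \<in> {\<bar>whitney_deriv K k (taylor_rem K q y f) x\<bar> / \<bar>x - y\<bar> ^ (q - k)
    | x y k. x \<in> K \<and> y \<in> K \<and> x \<noteq> y \<and> k \<le> q} \<Longrightarrow> z \<le> 2 * S"
proof -
  assume "z \<in> {\<bar>whitney_deriv K k (taylor_rem K q y f) x\<bar> / \<bar>x - y\<bar> ^ (q - k)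
    | x y k. x \<in> K \<and> y \<in> K \<and> x \<noteq> y \<and> k \<le> q}"
  then obtain x y k where z: "x \<in> K" "y \<in> K" "x \<noteq> y" "k \<le> q"
    "z = \<bar>whitney_deriv K k (taylor_rem K q y f) x\<bar> / \<bar>x - y\<bar> ^ (q - k)" by blast
  have "\<bar>whitney_deriv K k (taylor_rem K q y f) x\<bar> \<le> 2 * S * \<bar>x - y\<bar> ^ (q - k)"
    using remainder_bound[of F q S x y k] smooth S z(1,2,4)
    by (simp add: whitney_deriv_taylor_rem_eq[OF smooth ext])
  then show ?thesis using z(3,5) by (simp add: pos_divide_le_eq)
qed

text \<open>Whitney norms are estimated from above through any convenient smooth function inducing
  \<open>f\<close>: the derivatives contribute \<open>S\<close> and the remainders
  \<open>2 * S\<close>.\<close>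

lemma whitney_norm_le: "whitney_norm K q f \<le> 3 * S"
proof -
  obtain x y where "x \<in> K" "y \<in> K" "x \<noteq> y" using exists_two_points by blast
  then have "Sup {\<bar>whitney_deriv K k f x\<bar> | x k. x \<in> K \<and> k \<le> q} \<le> S"
    "Sup {\<bar>whitney_deriv K k (taylor_rem K q y f) x\<bar> / \<bar>x - y\<bar> ^ (q - k)
    | x y k. x \<in> K \<and> y \<in> K \<and> x \<noteq> y \<and> k \<le> q} \<le> 2 * S"
    by (intro cSup_least; use whitney_derivs_le whitney_rems_le in blast)+
  then show ?thesis unfolding whitney_norm_def by linarith
qed

text \<open>The bound \<open>S\<close> ensures that both suprema are over bounded sets. The other
  summand of the norm is nonnegative because \<open>K\<close> has two points, so each single
  quantity is below the norm.\<close>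

lemma whitney_norm_ge:
  assumes "x \<in> K" "k \<le> q"
  shows "\<bar>(deriv ^^ k) F x\<bar> \<le> whitney_norm K q f"
    and "y \<in> K \<Longrightarrow> \<bar>(deriv ^^ k) F x - (\<Sum>i\<le>q - k. (deriv ^^ (k + i)) F y / fact i * (x - y) ^ i)\<bar>
      \<le> whitney_norm K q f * \<bar>x - y\<bar> ^ (q - k)"
proof -
  let ?A = "{\<bar>whitney_deriv K k f x\<bar> | x k. x \<in> K \<and> k \<le> q}"
  let ?B = "{\<bar>whitney_deriv K k (taylor_rem K q y f) x\<bar> / \<bar>x - y\<bar> ^ (q - k)
    | x y k. x \<in> K \<and> y \<in> K \<and> x \<noteq> y \<and> k \<le> q}"
  have A: "bdd_above ?A" by (rule bdd_aboveI) (rule whitney_derivs_le)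
  have B: "bdd_above ?B" by (rule bdd_aboveI) (rule whitney_rems_le)
  obtain x' y' where xy: "x' \<in> K" "y' \<in> K" "x' \<noteq> y'" using exists_two_points by blast
  have "\<bar>whitney_deriv K 0 f x'\<bar> \<in> ?A" using xy by blast
  then have "\<bar>whitney_deriv K 0 f x'\<bar> \<le> Sup ?A" using A by (rule cSup_upper)
  then have SA: "Sup ?A \<ge> 0" by linarith
  have "\<bar>whitney_deriv K 0 (taylor_rem K q y' f) x'\<bar> / \<bar>x' - y'\<bar> ^ (q - 0) \<in> ?B" using xy by blast
  then have "\<bar>whitney_deriv K 0 (taylor_rem K q y' f) x'\<bar> / \<bar>x' - y'\<bar> ^ (q - 0) \<le> Sup ?B"
    using B by (rule cSup_upper)
  then have SB: "Sup ?B \<ge> 0" by (rule order_trans[rotated]) simp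
  have "\<bar>whitney_deriv K k f x\<bar> \<in> ?A" using assms by blast
  then have "\<bar>whitney_deriv K k f x\<bar> \<le> Sup ?A" using A by (rule cSup_upper)
  then show "\<bar>(deriv ^^ k) F x\<bar> \<le> whitney_norm K q f"
    using SB assms unfolding whitney_norm_def by (simp add: whitney_deriv_eq[OF smooth ext])
  assume y: "y \<in> K"
  let ?R = "(deriv ^^ k) F x - (\<Sum>i\<le>q - k. (deriv ^^ (k + i)) F y / fact i * (x - y) ^ i)"
  show "\<bar>?R\<bar> \<le> whitney_norm K q f * \<bar>x - y\<bar> ^ (q - k)"
  proof (cases "x = y")
    case True
    have "(\<Sum>i\<le>q - k. (deriv ^^ (k + i)) F y / fact i * (x - y) ^ i) =
        (\<Sum>i\<in>{0::nat}. (deriv ^^ k) F x)"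
      unfolding True by (intro sum.mono_neutral_cong_right) auto
    then have "?R = 0" by simp
    then show ?thesis using SA SB unfolding whitney_norm_def by simp
  next
    case False
    then have "\<bar>whitney_deriv K k (taylor_rem K q y f) x\<bar> / \<bar>x - y\<bar> ^ (q - k) \<in> ?B"
      using assms y by blast
    then have "\<bar>whitney_deriv K k (taylor_rem K q y f) x\<bar> / \<bar>x - y\<bar> ^ (q - k) \<le> Sup ?B"
      using B by (rule cSup_upper)
    also have "\<dots> \<le> whitney_norm K q f" using SA unfolding whitney_norm_def by simp
    finally show ?thesis
      using False assms y by (simp add: divide_le_eq whitney_deriv_taylor_rem_eq[OF smooth ext])
  qed
qed

end

lemma whitney_norm_geI:
  assumes "smooth F" "\<And>x. x \<in> K \<Longrightarrow> F x = f x" "x \<in> K" "k \<le> q"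
  shows "\<bar>(deriv ^^ k) F x\<bar> \<le> whitney_norm K q f"
    and "y \<in> K \<Longrightarrow> \<bar>(deriv ^^ k) F x - (\<Sum>i\<le>q - k. (deriv ^^ (k + i)) F y / fact i * (x - y) ^ i)\<bar>
      \<le> whitney_norm K q f * \<bar>x - y\<bar> ^ (q - k)"
proof -
  obtain S where S: "\<And>x j. x \<in> {0..1} \<Longrightarrow> j \<le> q \<Longrightarrow> \<bar>(deriv ^^ j) F x\<bar> \<le> S"
    using smooth_bounded_on_interval[OF assms(1), of 0 1 q] by metis
  show "\<bar>(deriv ^^ k) F x\<bar> \<le> whitney_norm K q f"
    by (rule whitney_norm_ge(1)[OF assms(1,2) S assms(3,4)])
  show "\<bar>(deriv ^^ k) F x - (\<Sum>i\<le>q - k. (deriv ^^ (k + i)) F y / fact i * (x - y) ^ i)\<bar>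
      \<le> whitney_norm K q f * \<bar>x - y\<bar> ^ (q - k)" if "y \<in> K"
    by (rule whitney_norm_ge(2)[OF assms(1,2) S assms(3,4) that])
qed

lemma whitney_norm_triangle:
  assumes "f \<in> whitney_functions K" "g \<in> whitney_functions K"
  shows "whitney_norm K q (\<lambda>x. f x + g x) \<le> whitney_norm K q f + whitney_norm K q g"
proof -
  obtain F G where F: "smooth F" "\<And>x. x \<in> K \<Longrightarrow> F x = f x" and G: "smooth G" "\<And>x. x \<in> K \<Longrightarrow> G x = g x"
    using assms unfolding whitney_functions_iff zero_off_def by force
  note H = smooth_add(1)[OF F(1) G(1)]
  let ?H = "\<lambda>x. F x + G x" and ?h = "\<lambda>x. f x + g x"
  have ext: "?H x = ?h x" if "x \<in> K" for x using F(2) G(2) that by simp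
  let ?A = "\<lambda>f. {\<bar>whitney_deriv K k f x\<bar> | x k. x \<in> K \<and> k \<le> q}"
  let ?B = "\<lambda>f. {\<bar>whitney_deriv K k (taylor_rem K q y f) x\<bar> / \<bar>x - y\<bar> ^ (q - k)
    | x y k. x \<in> K \<and> y \<in> K \<and> x \<noteq> y \<and> k \<le> q}"
  obtain SF where SF: "\<And>x j. x \<in> {0..1} \<Longrightarrow> j \<le> q \<Longrightarrow> \<bar>(deriv ^^ j) F x\<bar> \<le> SF"
    using smooth_bounded_on_interval[OF F(1), of 0 1 q] by metis
  obtain SG where SG: "\<And>x j. x \<in> {0..1} \<Longrightarrow> j \<le> q \<Longrightarrow> \<bar>(deriv ^^ j) G x\<bar> \<le> SG"
    using smooth_bounded_on_interval[OF G(1), of 0 1 q] by metis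
  have AF: "bdd_above (?A f)" by (rule bdd_aboveI) (rule whitney_derivs_le[OF F SF])
  have AG: "bdd_above (?A g)" by (rule bdd_aboveI) (rule whitney_derivs_le[OF G SG])
  have BF: "bdd_above (?B f)" by (rule bdd_aboveI) (rule whitney_rems_le[OF F SF])
  have BG: "bdd_above (?B g)" by (rule bdd_aboveI) (rule whitney_rems_le[OF G SG])
  obtain x' y' where xy: "x' \<in> K" "y' \<in> K" "x' \<noteq> y'" using exists_two_points by blast
  have "Sup (?A ?h) \<le> Sup (?A f) + Sup (?A g)"
  proof (rule cSup_least)
    show "?A ?h \<noteq> {}" using xy by blast
    fix z assume "z \<in> ?A ?h"
    then obtain x k where xk: "x \<in> K" "k \<le> q" "z = \<bar>whitney_deriv K k ?h x\<bar>" by blast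
    then have "z = \<bar>whitney_deriv K k f x + whitney_deriv K k g x\<bar>"
      by (simp add: whitney_deriv_eq[OF H ext] whitney_deriv_eq[OF F] whitney_deriv_eq[OF G]
          smooth_add(2)[OF F(1) G(1)])
    also have "\<dots> \<le> \<bar>whitney_deriv K k f x\<bar> + \<bar>whitney_deriv K k g x\<bar>" by (rule abs_triangle_ineq)
    also have "\<dots> \<le> Sup (?A f) + Sup (?A g)"
      using xk by (intro add_mono cSup_upper AF AG) blast+
    finally show "z \<le> Sup (?A f) + Sup (?A g)" .
  qed
  moreover have "Sup (?B ?h) \<le> Sup (?B f) + Sup (?B g)"
  proof (rule cSup_least)
    show "?B ?h \<noteq> {}" using xy by blast
    fix z assume "z \<in> ?B ?h"
    then obtain x y k where xk: "x \<in> K" "y \<in> K" "x \<noteq> y" "k \<le> q"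
      "z = \<bar>whitney_deriv K k (taylor_rem K q y ?h) x\<bar> / \<bar>x - y\<bar> ^ (q - k)" by blast
    have "whitney_deriv K k (taylor_rem K q y ?h) x =
      whitney_deriv K k (taylor_rem K q y f) x + whitney_deriv K k (taylor_rem K q y g) x"
      using xk
      by (simp add: whitney_deriv_taylor_rem_eq[OF H ext] whitney_deriv_taylor_rem_eq[OF F]
          whitney_deriv_taylor_rem_eq[OF G] smooth_add(2)[OF F(1) G(1)]
          sum.distrib add_divide_distrib distrib_right)
    then have "z \<le> \<bar>whitney_deriv K k (taylor_rem K q y f) x\<bar> / \<bar>x - y\<bar> ^ (q - k)
      + \<bar>whitney_deriv K k (taylor_rem K q y g) x\<bar> / \<bar>x - y\<bar> ^ (q - k)"
      unfolding xk(5) by (simp add: divide_right_mono abs_triangle_ineq flip: add_divide_distrib)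
    also have "\<dots> \<le> Sup (?B f) + Sup (?B g)"
      using xk by (intro add_mono cSup_upper BF BG) blast+
    finally show "z \<le> Sup (?B f) + Sup (?B g)" .
  qed
  ultimately show ?thesis unfolding whitney_norm_def by linarith
qed

lemma whitney_norm_zero: "whitney_norm K q (\<lambda>x. 0) \<le> 0"
  using whitney_norm_le[of "\<lambda>x. 0" "\<lambda>x. 0" q 0] by (simp add: smooth_zero)

lemma zero_whitney: "(\<lambda>x. 0) \<in> whitney_functions K"
  unfolding whitney_functions_iff by (intro exI[of _ "\<lambda>x. 0"]) (auto simp: zero_off_def smooth_zero)

end

section \<open>Topologies generated by seminorms\<close>

lemma smooth_seminorm_ge:
  assumes "smooth F" "x \<in> {- real n..real n}" "k \<le> n"
  shows "\<bar>(deriv ^^ k) F x\<bar> \<le> smooth_seminorm n F"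
proof -
  obtain B where B: "\<And>x k. x \<in> {- real n..real n} \<Longrightarrow> k \<le> n \<Longrightarrow> \<bar>(deriv ^^ k) F x\<bar> \<le> B"
    using smooth_bounded_on_interval[OF assms(1)] by metis
  then have "bdd_above {\<bar>(deriv ^^ k) F x\<bar> | x k. x \<in> {- real n..real n} \<and> k \<le> n}"
    by (intro bdd_aboveI[of _ B]) auto
  then show ?thesis
    unfolding smooth_seminorm_def using assms by (intro cSup_upper) auto
qed

lemma smooth_seminorm_le:
  assumes "\<And>x k. x \<in> {- real n..real n} \<Longrightarrow> k \<le> n \<Longrightarrow> \<bar>(deriv ^^ k) F x\<bar> \<le> B"
  shows "smooth_seminorm n F \<le> B"
proof -
  have "\<bar>(deriv ^^ 0) F 0\<bar> \<in> {\<bar>(deriv ^^ k) F x\<bar> | x k. x \<in> {- real n..real n} \<and> k \<le> n}"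
    by (force intro: exI[of _ 0])
  then show ?thesis
    unfolding smooth_seminorm_def using assms by (intro cSup_least) auto
qed

lemma smooth_seminorm_zero: "smooth_seminorm n (\<lambda>x. 0) \<le> 0"
  by (rule smooth_seminorm_le) (simp add: smooth_zero)

lemma openin_seminorm_ball:
  assumes "g \<in> V" "e > 0"
  shows "openin (seminorm_topology V p) {f \<in> V. \<forall>m\<le>r. p m (\<lambda>x. f x - g x) < e}"
proof -
  have "openin (seminorm_topology V p) (\<Inter>m\<in>{..r}. {f \<in> V. p m (\<lambda>x. f x - g x) < e})"
    unfolding seminorm_topology_def
    by (intro openin_Inter) (use assms in \<open>auto intro!: topology_generated_by_Basis\<close>)
  moreover have "(\<Inter>m\<in>{..r}. {f \<in> V. p m (\<lambda>x. f x - g x) < e}) =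
      {f \<in> V. \<forall>m\<le>r. p m (\<lambda>x. f x - g x) < e}" by auto
  ultimately show ?thesis by simp
qed

lemma topspace_seminorm_topology:
  assumes "\<And>n. p n (\<lambda>x. 0) \<le> 0"
  shows "topspace (seminorm_topology V p) = V"
proof -
  have "f \<in> \<Union> {{g \<in> V. p n (\<lambda>x. g x - f x) < e} | f n e. f \<in> V \<and> e > 0}" if "f \<in> V" for f
  proof
    show "f \<in> {g \<in> V. p 0 (\<lambda>x. g x - f x) < 1}"
      using that assms[of 0] by simp
    show "{g \<in> V. p 0 (\<lambda>x. g x - f x) < 1} \<in>
        {{g \<in> V. p n (\<lambda>x. g x - f x) < e} | f n e. f \<in> V \<and> e > 0}"
      using that by (intro CollectI exI[of _ f] exI[of _ 0] exI[of _ 1]) simp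
  qed
  then show ?thesis
    unfolding seminorm_topology_def topology_generated_by_topspace by blast
qed

lemma topspace_smooth_space: "topspace smooth_space = {F. smooth F}"
  unfolding smooth_space_def by (rule topspace_seminorm_topology) (rule smooth_seminorm_zero)

text \<open>Induction over the generation of the topology. A subbasic ball around \<open>f\<close>
  that contains \<open>0\<close> has room \<open>e - p n (\<lambda>x. - f x) > 0\<close>, so by the
  triangle inequality it contains a ball around \<open>0\<close>.\<close>

lemma openin_seminorm_topology_at_0:
  assumes "openin (seminorm_topology V p) U" "(\<lambda>x. 0) \<in> U"
    and "\<And>f. f \<in> V \<Longrightarrow> (\<lambda>x. - f x) \<in> V"
    and "\<And>n f g. f \<in> V \<Longrightarrow> g \<in> V \<Longrightarrow> p n (\<lambda>x. f x + g x) \<le> p n f + p n g"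
  shows "\<exists>r. \<exists>e>0. \<forall>g\<in>V. (\<forall>m\<le>r. p m g < e) \<longrightarrow> g \<in> U"
proof -
  have "generate_topology_on {{g \<in> V. p n (\<lambda>x. g x - f x) < e} | f n e. f \<in> V \<and> e > 0} U"
    using assms(1) unfolding seminorm_topology_def by (rule openin_topology_generated_by)
  then show ?thesis using assms(2)
  proof induction
    case (Int a b)
    then obtain r1 e1 r2 e2 where
      "e1 > 0" "\<forall>g\<in>V. (\<forall>m\<le>r1. p m g < e1) \<longrightarrow> g \<in> a"
      "e2 > 0" "\<forall>g\<in>V. (\<forall>m\<le>r2. p m g < e2) \<longrightarrow> g \<in> b" by blast
    then show ?case
      by (intro exI[of _ "max r1 r2"] exI[of _ "min e1 e2"]) auto
  next
    case (UN k)
    then obtain a where "a \<in> k" "(\<lambda>x. 0) \<in> a" by blast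
    then obtain r e where "e > 0" "\<forall>g\<in>V. (\<forall>m\<le>r. p m g < e) \<longrightarrow> g \<in> a"
      using UN.IH by meson
    with \<open>a \<in> k\<close> show ?case by blast
  next
    case (Basis s)
    then obtain f n e where s: "s = {g \<in> V. p n (\<lambda>x. g x - f x) < e}" "f \<in> V" by blast
    then have e: "e - p n (\<lambda>x. - f x) > 0" using Basis by simp
    have "g \<in> s" if "g \<in> V" "p n g < e - p n (\<lambda>x. - f x)" for g
      using assms(4)[of g "\<lambda>x. - f x" n] assms(3) that s by auto
    with e show ?case by blast
  qed simp
qed

context perfect_in_unit_interval
begin

lemma topspace_whitney_space: "topspace (whitney_space K) = whitney_functions K"
  unfolding whitney_space_def by (rule topspace_seminorm_topology) (rule whitney_norm_zero)

text \<open>A linear map bounded by finitely many seminorms is continuous: linearity transports the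
  estimate at \<open>0\<close> to every point \<open>g0\<close>.\<close>

lemma extension_propertyI:
  assumes smooth: "\<And>f. f \<in> whitney_functions K \<Longrightarrow> smooth (W f)"
    and linear: "\<And>f g c d. f \<in> whitney_functions K \<Longrightarrow> g \<in> whitney_functions K \<Longrightarrow>
      W (\<lambda>x. c * f x + d * g x) = (\<lambda>x. c * W f x + d * W g x)"
    and ext: "\<And>f x. f \<in> whitney_functions K \<Longrightarrow> x \<in> K \<Longrightarrow> W f x = f x"
    and bound: "\<And>n. \<exists>r C. \<forall>f B. f \<in> whitney_functions K \<longrightarrow> (\<forall>m\<le>r. whitney_norm K m f \<le> B) \<longrightarrow>
      (\<forall>k\<le>n. \<forall>x. \<bar>(deriv ^^ k) (W f) x\<bar> \<le> C * B)"
  shows "extension_property K"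
proof -
  have "continuous_map (whitney_space K) smooth_space W"
    unfolding smooth_space_def seminorm_topology_def
  proof (rule continuous_on_generated_topo)
    fix U assume "U \<in> {{g \<in> {F. smooth F}. smooth_seminorm n (\<lambda>x. g x - f x) < e} | f n e. f \<in> {F. smooth F} \<and> e > 0}"
    then obtain f n e where f: "smooth f"
      and U: "U = {g \<in> {F. smooth F}. smooth_seminorm n (\<lambda>x. g x - f x) < e}" by blast
    obtain r C where C: "\<And>f B k x. f \<in> whitney_functions K \<Longrightarrow> (\<forall>m\<le>r. whitney_norm K m f \<le> B) \<Longrightarrow>
        k \<le> n \<Longrightarrow> \<bar>(deriv ^^ k) (W f) x\<bar> \<le> C * B"
      using bound[of n] by blast
    show "openin (whitney_space K) (W -` U \<inter> topspace (whitney_space K))"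
      unfolding topspace_whitney_space
    proof (subst openin_subopen, intro ballI)
      fix g0 assume "g0 \<in> W -` U \<inter> whitney_functions K"
      then have g0: "g0 \<in> whitney_functions K" "smooth_seminorm n (\<lambda>x. W g0 x - f x) < e"
        using U by auto
      define s where "s = e - smooth_seminorm n (\<lambda>x. W g0 x - f x)"
      \<comment> \<open>\<open>\<bar>C\<bar> + 1\<close> is positive whatever \<open>C\<close> is;
        with this radius at most half of the slack \<open>s\<close> is used.\<close>
      define \<epsilon> where "\<epsilon> = s / (2 * (\<bar>C\<bar> + 1))"
      have s: "s > 0" using g0 by (simp add: s_def)
      have \<epsilon>: "\<epsilon> > 0" unfolding \<epsilon>_def using s by (intro divide_pos_pos) auto
      have "C * \<epsilon> \<le> (\<bar>C\<bar> + 1) * \<epsilon>" using \<epsilon> by (intro mult_right_mono) auto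
      also have "\<dots> = s / 2" unfolding \<epsilon>_def by (simp add: field_simps)
      finally have C\<epsilon>: "C * \<epsilon> \<le> s / 2" .
      let ?T = "{g \<in> whitney_functions K. \<forall>m\<le>r. whitney_norm K m (\<lambda>x. g x - g0 x) < \<epsilon>}"
      have "openin (whitney_space K) ?T"
        unfolding whitney_space_def using g0(1) \<epsilon> by (rule openin_seminorm_ball)
      moreover have "g0 \<in> ?T" using g0 \<epsilon> whitney_norm_zero by (auto intro: le_less_trans)
      moreover have "?T \<subseteq> W -` U \<inter> whitney_functions K"
      proof
        fix g assume g: "g \<in> ?T"
        let ?d = "\<lambda>x. 1 * g x + (- 1) * g0 x"
        have d: "?d \<in> whitney_functions K" using g g0 by (intro whitney_functions_lincomb) auto
        have Wd: "W ?d = (\<lambda>x. 1 * W g x + (- 1) * W g0 x)" using g g0 by (intro linear) auto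
        have "(\<lambda>x. W g x - f x) = (\<lambda>x. W ?d x + (W g0 x - f x))" unfolding Wd by auto
        then have "smooth_seminorm n (\<lambda>x. W g x - f x) = smooth_seminorm n (\<lambda>x. W ?d x + (W g0 x - f x))"
          by simp
        also have "\<dots> \<le> s / 2 + smooth_seminorm n (\<lambda>x. W g0 x - f x)"
        proof (rule smooth_seminorm_le)
          fix x k assume xk: "x \<in> {- real n..real n}" "k \<le> n"
          have sm: "smooth (\<lambda>x. W g0 x - f x)" using smooth g0 f by (intro smooth_diff) auto
          have "\<bar>(deriv ^^ k) (W ?d) x\<bar> \<le> C * \<epsilon>"
            using g by (intro C d xk) (auto intro: less_imp_le)
          moreover have "\<bar>(deriv ^^ k) (\<lambda>x. W g0 x - f x) x\<bar> \<le> smooth_seminorm n (\<lambda>x. W g0 x - f x)"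
            by (rule smooth_seminorm_ge[OF sm xk])
          ultimately show "\<bar>(deriv ^^ k) (\<lambda>x. W ?d x + (W g0 x - f x)) x\<bar>
              \<le> s / 2 + smooth_seminorm n (\<lambda>x. W g0 x - f x)"
            using C\<epsilon> unfolding smooth_add(2)[OF smooth[OF d] sm] by linarith
        qed
        also have "\<dots> < e" using s unfolding s_def by (simp add: field_simps)
        finally show "g \<in> W -` U \<inter> whitney_functions K" using g smooth by (auto simp: U)
      qed
      ultimately show "\<exists>T. openin (whitney_space K) T \<and> g0 \<in> T \<and> T \<subseteq> W -` U \<inter> whitney_functions K"
        by blast
    qed
  next
    have "W f \<in> topspace smooth_space" if "f \<in> whitney_functions K" for f
      using that smooth by (simp add: topspace_smooth_space)
    then show "W ` topspace (whitney_space K) \<subseteq>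
      \<Union> {{g \<in> {F. smooth F}. smooth_seminorm n (\<lambda>x. g x - f x) < e} | f n e. f \<in> {F. smooth F} \<and> e > 0}"
      unfolding topspace_whitney_space smooth_space_def seminorm_topology_def
        topology_generated_by_topspace by blast
  qed
  then show ?thesis
    unfolding extension_property_def using linear ext by blast
qed

text \<open>Continuity at \<open>0\<close> together with scaling gives seminorm estimates. They are
  phrased through an arbitrary smooth \<open>F\<close> inducing the trace, because later two
  different such functions are used for the same trace.\<close>

lemma extension_propertyD:
  assumes "extension_property K"
  shows "\<exists>W. (\<forall>f\<in>whitney_functions K. smooth (W f) \<and> (\<forall>x\<in>K. W f x = f x)) \<and>
    (\<forall>n. \<exists>r C. \<forall>F S. S > 0 \<longrightarrow> smooth F \<longrightarrow> (\<forall>j\<le>r. \<forall>x\<in>{0..1}. \<bar>(deriv ^^ j) F x\<bar> \<le> S) \<longrightarrow>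
      (\<forall>k\<le>n. \<forall>x\<in>{- real n..real n}. \<bar>(deriv ^^ k) (W (zero_off K F)) x\<bar> \<le> C * S))"
proof -
  let ?V = "whitney_functions K"
  obtain W where cont: "continuous_map (whitney_space K) smooth_space W"
    and linear: "\<And>f g c d. f \<in> ?V \<Longrightarrow> g \<in> ?V \<Longrightarrow>
      W (\<lambda>x. c * f x + d * g x) = (\<lambda>x. c * W f x + d * W g x)"
    and ext: "\<And>f x. f \<in> ?V \<Longrightarrow> x \<in> K \<Longrightarrow> W f x = f x"
    using assms unfolding extension_property_def by blast
  have smooth: "smooth (W f)" if "f \<in> ?V" for f
    using continuous_map_image_subset_topspace[OF cont] that
    unfolding topspace_whitney_space topspace_smooth_space by blast
  have "\<exists>r C. \<forall>F S. S > 0 \<longrightarrow> smooth F \<longrightarrow> (\<forall>j\<le>r. \<forall>x\<in>{0..1}. \<bar>(deriv ^^ j) F x\<bar> \<le> S) \<longrightarrow>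
      (\<forall>k\<le>n. \<forall>x\<in>{- real n..real n}. \<bar>(deriv ^^ k) (W (zero_off K F)) x\<bar> \<le> C * S)" for n
  proof -
    let ?U = "{g \<in> {F. smooth F}. \<forall>m\<le>n. smooth_seminorm m (\<lambda>x. g x - 0) < 1}"
    have "openin smooth_space ?U"
      unfolding smooth_space_def by (rule openin_seminorm_ball) (auto simp: smooth_zero)
    then have op: "openin (whitney_space K) {f \<in> topspace (whitney_space K). W f \<in> ?U}"
      by (rule openin_continuous_map_preimage[OF cont])
    have "W (\<lambda>x. 0) = (\<lambda>x. 0)"
      using linear[OF zero_whitney zero_whitney, of 0 0] by simp
    then have "(\<lambda>x. 0) \<in> {f \<in> topspace (whitney_space K). W f \<in> ?U}"
      unfolding topspace_whitney_space
      by (auto simp: zero_whitney smooth_zero intro: le_less_trans[OF smooth_seminorm_zero])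
    then have "\<exists>r. \<exists>e>0. \<forall>g\<in>?V. (\<forall>m\<le>r. whitney_norm K m g < e) \<longrightarrow>
        g \<in> {f \<in> topspace (whitney_space K). W f \<in> ?U}"
    proof (rule openin_seminorm_topology_at_0[OF op[unfolded whitney_space_def], folded whitney_space_def])
      show "(\<lambda>x. - f x) \<in> ?V" if "f \<in> ?V" for f
        using whitney_functions_lincomb[OF that that, of "- 1" 0] by simp
    qed (rule whitney_norm_triangle)
    then obtain r e where e: "e > 0" and re: "\<And>g. g \<in> ?V \<Longrightarrow> (\<And>m. m \<le> r \<Longrightarrow> whitney_norm K m g < e) \<Longrightarrow> W g \<in> ?U"
      by blast
    have "\<bar>(deriv ^^ k) (W (zero_off K F)) x\<bar> \<le> 4 / e * S"
      if S: "S > 0" "smooth F" "\<forall>j\<le>r. \<forall>x\<in>{0..1}. \<bar>(deriv ^^ j) F x\<bar> \<le> S"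
        and x: "k \<le> n" "x \<in> {- real n..real n}" for F S k x
    proof -
      \<comment> \<open>The scaled trace has norms at most \<open>3 * (c * S)\<close>, that is,
        three quarters of \<open>e\<close>.\<close>
      define c where "c = e / (4 * S)"
      have c: "c > 0" using e S by (simp add: c_def)
      let ?f = "zero_off K F"
      let ?g = "\<lambda>x. c * ?f x + 0 * ?f x"
      have f: "?f \<in> ?V" using S unfolding whitney_functions_iff by blast
      then have g: "?g \<in> ?V" by (intro whitney_functions_lincomb)
      have "whitney_norm K m ?g < e" if m: "m \<le> r" for m
      proof -
        have "whitney_norm K m ?g \<le> 3 * (c * S)"
        proof (rule whitney_norm_le)
          show "smooth (\<lambda>x. c * F x)" using S by (intro smooth_cmult)
          show "\<bar>(deriv ^^ j) (\<lambda>x. c * F x) x\<bar> \<le> c * S" if "j \<le> m" "x \<in> {0..1}" for j x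
            using S that m c unfolding smooth_cmult(2)[OF S(2)] by (simp add: abs_mult)
        qed (simp add: zero_off_def)
        also have "\<dots> < e" using e S by (simp add: c_def)
        finally show ?thesis .
      qed
      then have "W ?g \<in> ?U" using g by (intro re)
      then have "smooth_seminorm n (W ?g) < 1" by simp
      then have "\<bar>(deriv ^^ k) (W ?g) x\<bar> \<le> 1"
        using smooth_seminorm_ge[OF smooth[OF g] x(2,1)] by linarith
      moreover have "W ?g = (\<lambda>x. c * W ?f x)" using linear[OF f f, of c 0] by simp
      ultimately have "c * \<bar>(deriv ^^ k) (W ?f) x\<bar> \<le> 1"
        using c by (simp add: smooth_cmult(2)[OF smooth[OF f]] abs_mult)
      then have "\<bar>(deriv ^^ k) (W ?f) x\<bar> \<le> 1 / c" using c by (simp add: field_simps)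
      then show ?thesis using e S by (simp add: c_def)
    qed
    then show ?thesis by blast
  qed
  with smooth ext show ?thesis by blast
qed

end

section \<open>The set \<open>K\<close>\<close>

locale interval_seq =
  fixes Q :: "nat \<Rightarrow> real"
  assumes Q_ge2: "k \<ge> 1 \<Longrightarrow> Q k \<ge> 2"
begin

definition b :: "nat \<Rightarrow> real" where "b k = exp (- real k)"
definition \<delta> :: "nat \<Rightarrow> real" where "\<delta> k = exp (- real k * Q k)"
definition I :: "nat \<Rightarrow> real set" where "I k = {b k - \<delta> k..b k}"
abbreviation K :: "real set" where "K \<equiv> interval_seq_set Q"

lemma K_eq: "K = {0} \<union> (\<Union>k\<in>{1..}. I k)"
  by (simp add: interval_seq_set_def Let_def I_def b_def \<delta>_def powr_def mult.commute)

lemma in_K_cases: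
  assumes "x \<in> K"
  obtains "x = 0" | k where "k \<ge> 1" "x \<in> I k"
  using assms unfolding K_eq by auto

lemma I_subset_K: "k \<ge> 1 \<Longrightarrow> I k \<subseteq> K"
  unfolding K_eq by auto

lemma zero_in_K: "0 \<in> K"
  unfolding K_eq by simp

lemma b_pos: "b k > 0" and \<delta>_pos: "\<delta> k > 0" and b_le_1: "b k \<le> 1"
  by (simp_all add: b_def \<delta>_def)

lemma b_in_K: "k \<ge> 1 \<Longrightarrow> b k \<in> K"
  using I_subset_K[of k] \<delta>_pos[of k] unfolding I_def by force

text \<open>The rational bound \<open>5 / 2 \<le> exp 1\<close> stands behind the separation
  constants that follow.\<close>

lemma b_Suc_le: "b (Suc k) \<le> 2 / 5 * b k"
proof -
  have "5 / 2 \<le> exp (1::real)"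
    using exp_lower_Taylor_quadratic[of 1] by simp
  then have "exp (- 1) \<le> (2 / 5 :: real)"
    by (simp add: exp_minus field_simps)
  then have "exp (- 1) * exp (- real k) \<le> 2 / 5 * exp (- real k)"
    by (intro mult_right_mono) auto
  then show ?thesis by (simp add: b_def flip: exp_add)
qed

lemma b_mono: "j \<le> k \<Longrightarrow> b k \<le> b j"
  by (simp add: b_def)

lemma b_less_le: "j < k \<Longrightarrow> b k \<le> 2 / 5 * b j"
  using b_mono[of "Suc j" k] b_Suc_le[of j] by linarith

lemma b_le: "k \<ge> 1 \<Longrightarrow> b k \<le> 2 / 5"
  using b_less_le[of 0 k] b_le_1[of 0] by simp

lemma \<delta>_le_b_sq:
  assumes "k \<ge> 1" shows "\<delta> k \<le> b k * b k"
proof -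
  have "real k * 2 \<le> real k * Q k" using Q_ge2[OF assms] by (intro mult_left_mono) auto
  then show ?thesis by (simp add: \<delta>_def b_def flip: exp_add)
qed

text \<open>It is in this form that boundedness of the exponents enters, both for the extension
  operator and for the content.\<close>

lemma \<delta>_ge_power:
  assumes "Q k \<le> real N" shows "b k ^ N \<le> \<delta> k"
proof -
  have "real k * Q k \<le> real k * real N" using assms by (intro mult_left_mono) auto
  then show ?thesis by (simp add: b_def \<delta>_def mult.commute flip: exp_of_nat_mult)
qed

lemma \<delta>_le_b:
  assumes "k \<ge> 1" shows "\<delta> k \<le> 2 / 5 * b k"
proof -
  have "b k * b k \<le> 2 / 5 * b k" using b_le[OF assms] b_pos[of k] by (intro mult_right_mono) auto
  with \<delta>_le_b_sq[OF assms] show ?thesis by linarith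
qed

lemma I_pos: "k \<ge> 1 \<Longrightarrow> x \<in> I k \<Longrightarrow> 0 < x \<and> 3 / 5 * b k \<le> x \<and> x \<le> b k"
  using \<delta>_le_b[of k] b_pos[of k] unfolding I_def by auto

text \<open>Points of \<open>I j\<close> lie between \<open>3 / 5 * b j\<close> and
  \<open>b j\<close>. For \<open>j > k\<close> they are at most \<open>2 / 5 * b k\<close>; for
  \<open>j < k\<close> they are at least \<open>3 / 5 * (5 / 2) * b k\<close>.\<close>

lemma I_separated:
  assumes "j \<ge> 1" "k \<ge> 1" "j \<noteq> k" "x \<in> I j"
  shows "x \<le> 2 / 5 * b k \<or> x \<ge> 3 / 2 * b k"
proof (cases "k < j")
  case True
  then show ?thesis using b_less_le[OF True] assms(4) by (auto simp: I_def)
next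
  case False
  then have "b k \<le> 2 / 5 * b j" using assms by (intro b_less_le) auto
  then show ?thesis using I_pos[OF assms(1,4)] by linarith
qed

lemma K_separated:
  assumes "k \<ge> 1" "x \<in> K" "x \<notin> I k"
  shows "x \<le> 2 / 5 * b k \<or> x \<ge> 3 / 2 * b k"
  using assms(2)
proof (cases rule: in_K_cases)
  case 1
  then show ?thesis using b_pos[of k] by simp
next
  case (2 j)
  then show ?thesis using I_separated[of j k x] assms by blast
qed

lemma b_tendsto_0: "b \<longlonglongrightarrow> 0"
proof -
  have "(\<lambda>k. exp (- 1 :: real) ^ k) \<longlonglongrightarrow> 0" by (intro LIMSEQ_power_zero) auto
  moreover have "b = (\<lambda>k. exp (- 1) ^ k)" by (simp add: b_def[abs_def] flip: exp_of_nat_mult)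
  ultimately show ?thesis by simp
qed

text \<open>The point \<open>0\<close> is the limit of the \<open>b k\<close>, and every other point
  lies in a nondegenerate interval.\<close>

sublocale perfect_in_unit_interval K
proof
  show "K \<noteq> {}" using zero_in_K by blast
  show "K \<subseteq> {0..1}"
  proof
    fix x assume "x \<in> K"
    then show "x \<in> {0..1}"
    proof (cases rule: in_K_cases)
      case (2 k)
      then show ?thesis using I_pos[of k x] b_le_1[of k] by auto
    qed simp
  qed
  fix x assume "x \<in> K"
  then show "x islimpt K"
  proof (cases rule: in_K_cases)
    case 1
    have "b (Suc k) \<in> K - {0}" for k using b_in_K[of "Suc k"] b_pos[of "Suc k"] by auto
    moreover have "(\<lambda>k. b (Suc k)) \<longlonglongrightarrow> 0" by (rule LIMSEQ_Suc[OF b_tendsto_0])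
    ultimately show ?thesis
      unfolding islimpt_sequential 1 by (intro exI[of _ "\<lambda>k. b (Suc k)"]) blast
  next
    case (2 k)
    have "x islimpt I k" using 2 \<delta>_pos[of k] by (simp add: I_def islimpt_Icc)
    then show ?thesis using I_subset_K[OF 2(1)] by (rule islimpt_subset)
  qed
qed

end

section \<open>The jet extension at an arbitrary point and scale\<close>

context jet_extension
begin

text \<open>The samples are taken along a geometric sequence tending to \<open>c\<close>, from the
  left if \<open>s\<close> is negative.\<close>

definition rescaled :: "real \<Rightarrow> real \<Rightarrow> (real \<Rightarrow> real) \<Rightarrow> real \<Rightarrow> real" where
  "rescaled c s f x = J (\<lambda>j. f (c + s * exp (- real j))) ((x - c) / s)"

text \<open>The Taylor coefficients at \<open>0\<close> of \<open>F (c + s * y)\<close> as a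
  function of \<open>y\<close>.\<close>

definition jet_coeffs :: "real \<Rightarrow> real \<Rightarrow> (real \<Rightarrow> real) \<Rightarrow> nat \<Rightarrow> real" where
  "jet_coeffs c s F m = (deriv ^^ m) F c / fact m * s ^ m"

lemma rescaled_support: "s \<noteq> 0 \<Longrightarrow> \<bar>x - c\<bar> \<ge> \<bar>s\<bar> / 4 \<Longrightarrow> rescaled c s f x = 0"
  unfolding rescaled_def by (intro support) (simp add: field_simps)

context
  fixes F f c s
  assumes F: "Defs.smooth F" and s: "s \<noteq> 0" "\<bar>s\<bar> \<le> 1"
    \<comment> \<open>Agreement at the sample points suffices, so \<open>f\<close> may be a trace
      with arbitrary values off \<open>K\<close>.\<close>
    and eq: "\<And>j. f (c + s * exp (- real j)) = F (c + s * exp (- real j))"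
begin

lemma jet_approxI:
  assumes "\<And>m. m \<le> r \<Longrightarrow> \<bar>(deriv ^^ m) F c\<bar> \<le> M"
    and "\<And>j. \<bar>F (c + s * exp (- real j)) - (\<Sum>m\<le>r. (deriv ^^ m) F c / fact m * (s * exp (- real j)) ^ m)\<bar>
      \<le> M * \<bar>s * exp (- real j)\<bar> ^ r"
  shows "jet_approx (\<lambda>j. f (c + s * exp (- real j))) (jet_coeffs c s F) r M"
  unfolding jet_approx_def
proof (intro conjI allI impI)
  have M: "M \<ge> 0" using assms(1)[of 0] by force
  have s1: "\<bar>s\<bar> ^ m \<le> 1" for m using s by (intro power_le_one) auto
  show "\<bar>jet_coeffs c s F m\<bar> \<le> M" if "m \<le> r" for m
  proof -
    have "\<bar>(deriv ^^ m) F c\<bar> / fact m * \<bar>s\<bar> ^ m \<le> (M / 1) * 1"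
      using assms(1)[OF that] M s1 by (intro mult_mono frac_le) (auto simp: fact_ge_1)
    then show ?thesis by (simp add: jet_coeffs_def abs_mult power_abs)
  qed
  fix j
  have "M * \<bar>s * exp (- real j)\<bar> ^ r = M * (\<bar>s\<bar> ^ r * exp (- real j) ^ r)"
    by (simp add: abs_mult power_mult_distrib)
  also have "\<dots> \<le> M * (1 * exp (- real j) ^ r)"
    using M s1 by (intro mult_left_mono mult_right_mono) auto
  finally show "\<bar>f (c + s * exp (- real j)) - (\<Sum>m\<le>r. jet_coeffs c s F m * exp (- real j) ^ m)\<bar>
      \<le> M * exp (- real j) ^ r"
    using assms(2)[of j] by (simp add: eq jet_coeffs_def power_mult_distrib mult.assoc)
qed

lemma jet_approx_segment:
  assumes "\<And>m t. m \<le> r \<Longrightarrow> t \<in> closed_segment c (c + s) \<Longrightarrow> \<bar>(deriv ^^ m) F t\<bar> \<le> S"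
  shows "jet_approx (\<lambda>j. f (c + s * exp (- real j))) (jet_coeffs c s F) r (2 * S)"
proof (rule jet_approxI)
  show "\<bar>(deriv ^^ m) F c\<bar> \<le> 2 * S" if "m \<le> r" for m
    using assms[OF that, of c] by force
  fix j
  have "c + s * exp (- real j) = (1 - exp (- real j)) * c + exp (- real j) * (c + s)"
    by (simp add: algebra_simps)
  then have "c + s * exp (- real j) \<in> closed_segment c (c + s)"
    unfolding closed_segment_def by (auto intro!: exI[of _ "exp (- real j)"])
  then have "closed_segment c (c + s * exp (- real j)) \<subseteq> closed_segment c (c + s)"
    by (simp add: subset_closed_segment)
  then have "\<bar>F (c + s * exp (- real j)) - (\<Sum>m\<le>r. (deriv ^^ m) F c / fact m * (c + s * exp (- real j) - c) ^ m)\<bar>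
      \<le> 2 * S * \<bar>c + s * exp (- real j) - c\<bar> ^ r"
    by (intro taylor_remainder_bound_le[OF F] assms) auto
  then show "\<bar>F (c + s * exp (- real j)) - (\<Sum>m\<le>r. (deriv ^^ m) F c / fact m * (s * exp (- real j)) ^ m)\<bar>
      \<le> 2 * S * \<bar>s * exp (- real j)\<bar> ^ r" by simp
qed

lemma jet_approx_exists: "\<exists>M. jet_approx (\<lambda>j. f (c + s * exp (- real j))) (jet_coeffs c s F) r M"
proof -
  obtain S where "\<And>x k. x \<in> {min c (c + s)..max c (c + s)} \<Longrightarrow> k \<le> r \<Longrightarrow> \<bar>(deriv ^^ k) F x\<bar> \<le> S"
    using smooth_bounded_on_interval[OF F] by metis
  then have "jet_approx (\<lambda>j. f (c + s * exp (- real j))) (jet_coeffs c s F) r (2 * S)"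
    by (intro jet_approx_segment) (auto simp: closed_segment_eq_real_ivl split: if_splits)
  then show ?thesis by blast
qed

lemma rescaled_smooth: "Defs.smooth (rescaled c s f)"
  and rescaled_deriv: "(deriv ^^ q) (rescaled c s f) x =
    (1 / s) ^ q * (deriv ^^ q) (J (\<lambda>j. f (c + s * exp (- real j)))) ((x - c) / s)"
proof -
  note sm = smooth[OF jet_approx_exists]
  have "rescaled c s f = (\<lambda>x. J (\<lambda>j. f (c + s * exp (- real j))) (1 / s * x + (- c / s)))"
    using s by (simp add: rescaled_def fun_eq_iff diff_divide_distrib)
  then show "Defs.smooth (rescaled c s f)" "(deriv ^^ q) (rescaled c s f) x =
    (1 / s) ^ q * (deriv ^^ q) (J (\<lambda>j. f (c + s * exp (- real j)))) ((x - c) / s)"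
    using smooth_affine(1)[OF sm, of "1 / s" "- c / s"] smooth_affine(2)[OF sm, of q "1 / s" "- c / s"]
    by (simp_all add: diff_divide_distrib)
qed

lemma rescaled_jet: "(deriv ^^ q) (rescaled c s f) c = (deriv ^^ q) F c"
  using s jet[OF jet_approx_exists, of q]
  by (simp add: rescaled_deriv jet_coeffs_def power_one_over)

text \<open>Every derivative costs a factor \<open>1 / \<bar>s\<bar>\<close>; for the patches this
  is the loss that flatness at \<open>0\<close> has to absorb.\<close>

lemma rescaled_bound:
  assumes "jet_approx (\<lambda>j. f (c + s * exp (- real j))) (jet_coeffs c s F) (Suc q) M"
  shows "\<bar>(deriv ^^ q) (rescaled c s f) x\<bar> \<le> (1 / \<bar>s\<bar>) ^ q * (C q * M)"
  unfolding rescaled_deriv abs_mult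
  using bound[OF jet_approx_exists assms]
  by (auto intro!: mult_mono simp: power_abs)

end

lemma rescaled_linear:
  assumes "Defs.smooth F" "\<And>j. f (c + s * exp (- real j)) = F (c + s * exp (- real j))"
    and "Defs.smooth G" "\<And>j. g (c + s * exp (- real j)) = G (c + s * exp (- real j))"
    and s: "s \<noteq> 0" "\<bar>s\<bar> \<le> 1"
  shows "rescaled c s (\<lambda>x. \<gamma> * f x + d * g x) x = \<gamma> * rescaled c s f x + d * rescaled c s g x"
  unfolding rescaled_def
  by (rule linear[OF jet_approx_exists[OF assms(1) s assms(2)] jet_approx_exists[OF assms(3) s assms(4)]])

end

section \<open>Bounded exponents give an extension operator\<close>

locale interval_seq_jet = interval_seq Q + jet_extension J C
  for Q :: "nat \<Rightarrow> real" and J :: "(nat \<Rightarrow> real) \<Rightarrow> real \<Rightarrow> real" and C :: "nat \<Rightarrow> real"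
begin

text \<open>The scale \<open>exp (- 1)\<close> makes the sample points the right endpoints
  \<open>b (Suc j)\<close>, which belong to \<open>K\<close>.\<close>

definition base :: "(real \<Rightarrow> real) \<Rightarrow> real \<Rightarrow> real" where
  "base f = rescaled 0 (exp (- 1)) f"

text \<open>On each side of \<open>I k\<close> the jet at the endpoint is extended outwards, from
  samples inside \<open>I k\<close>; hence the negative scale at the right endpoint.\<close>

definition patch :: "nat \<Rightarrow> (real \<Rightarrow> real) \<Rightarrow> real \<Rightarrow> real" where
  "patch k g x =
     (if x \<le> b k - \<delta> k then rescaled (b k - \<delta> k) (\<delta> k) g x
      else if x \<le> b k then g x
      else rescaled (b k) (- \<delta> k) g x)"

definition extend :: "(real \<Rightarrow> real) \<Rightarrow> real \<Rightarrow> real" where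
  "extend f x = base f x + (\<Sum>k. patch (Suc k) (\<lambda>x. f x - base f x) x)"

lemma node_base: "0 + exp (- 1) * exp (- real j) = b (Suc j)"
  by (simp add: b_def flip: exp_add)

lemma node_left: "b k - \<delta> k + \<delta> k * exp (- real j) \<in> I k"
  using \<delta>_pos[of k] mult_left_mono[of "exp (- real j)" 1 "\<delta> k"] by (simp add: I_def)

lemma node_right: "b k + - \<delta> k * exp (- real j) \<in> I k"
  using \<delta>_pos[of k] mult_left_mono[of "exp (- real j)" 1 "\<delta> k"] by (simp add: I_def)

lemma \<delta>_le_1: "k \<ge> 1 \<Longrightarrow> \<delta> k \<le> 1"
  using \<delta>_le_b[of k] b_le_1[of k] by linarith

lemma patch_eq_0:
  assumes "x \<le> b k - \<delta> k - \<delta> k / 4 \<or> b k + \<delta> k / 4 \<le> x"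
  shows "patch k g x = 0"
  using assms \<delta>_pos[of k]
  unfolding patch_def by (auto intro!: rescaled_support)

text \<open>A patch lives within \<open>\<delta> k / 4\<close> of \<open>I k\<close>, and
  \<open>\<delta> k \<le> 2 / 5 * b k\<close> keeps this away from the remaining points of
  \<open>K\<close> as located by \<open>K_separated\<close>.\<close>

lemma patch_off:
  assumes "k \<ge> 1" "x \<le> 2 / 5 * b k \<or> x \<ge> 3 / 2 * b k"
  shows "patch k g x = 0"
proof (rule patch_eq_0)
  have "\<delta> k \<le> 2 / 5 * b k" by (rule \<delta>_le_b[OF assms(1)])
  then show "x \<le> b k - \<delta> k - \<delta> k / 4 \<or> b k + \<delta> k / 4 \<le> x"
    using assms(2) b_pos[of k] by auto
qed

context
  fixes F f
  assumes F: "Defs.smooth F" and ext: "\<And>x. x \<in> K \<Longrightarrow> f x = F x"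
begin

lemma base_node: "f (0 + exp (- 1) * exp (- real j)) = F (0 + exp (- 1) * exp (- real j))"
  unfolding node_base by (intro ext b_in_K) simp

lemma base_smooth: "Defs.smooth (base f)"
  unfolding base_def by (rule rescaled_smooth[OF F _ _ base_node]) auto

lemma base_jet: "(deriv ^^ q) (base f) 0 = (deriv ^^ q) F 0"
  unfolding base_def by (rule rescaled_jet[OF F _ _ base_node]) auto

text \<open>The Whitney remainders between \<open>0\<close> and the points \<open>b (Suc j)\<close>
  are precisely what \<open>jet_approx\<close> asks for, so Whitney norms of \<open>f\<close> bound
  \<open>base f\<close> directly.\<close>

lemma base_bound:
  assumes "\<And>m. m \<le> Suc q \<Longrightarrow> whitney_norm K m f \<le> B"
  shows "\<bar>(deriv ^^ q) (base f) x\<bar> \<le> exp 1 ^ q * (\<bar>C q\<bar> * B)"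
proof -
  note geI = whitney_norm_geI[OF F ext[symmetric]]
  have "jet_approx (\<lambda>j. f (0 + exp (- 1) * exp (- real j))) (jet_coeffs 0 (exp (- 1)) F) (Suc q) B"
  proof (rule jet_approxI[OF F _ _ base_node])
    show "\<bar>(deriv ^^ m) F 0\<bar> \<le> B" if "m \<le> Suc q" for m
      using geI(1)[OF _ zero_in_K that] assms[of "Suc q"] by simp
    fix j
    let ?x = "b (Suc j)"
    have "\<bar>(deriv ^^ 0) F ?x - (\<Sum>i\<le>Suc q - 0. (deriv ^^ (0 + i)) F 0 / fact i * (?x - 0) ^ i)\<bar>
        \<le> whitney_norm K (Suc q) f * \<bar>?x - 0\<bar> ^ (Suc q - 0)"
      by (intro geI(2) zero_in_K b_in_K) auto
    also have "\<dots> \<le> B * \<bar>?x\<bar> ^ Suc q"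
      using assms[of "Suc q"] by (simp del: power_Suc add: mult_right_mono)
    finally show "\<bar>F (0 + exp (- 1) * exp (- real j)) -
        (\<Sum>m\<le>Suc q. (deriv ^^ m) F 0 / fact m * (exp (- 1) * exp (- real j)) ^ m)\<bar>
        \<le> B * \<bar>exp (- 1) * exp (- real j)\<bar> ^ Suc q"
      using node_base[of j] by simp
  qed auto
  then have "\<bar>(deriv ^^ q) (base f) x\<bar> \<le> (1 / \<bar>exp (- 1)\<bar>) ^ q * (C q * B)"
    unfolding base_def by (rule rescaled_bound[OF F _ _ base_node, rotated 2]) auto
  also have "(1 / \<bar>exp (- 1) :: real\<bar>) = exp 1"
    by (simp add: exp_minus field_simps)
  also have "exp 1 ^ q * (C q * B) \<le> exp 1 ^ q * (\<bar>C q\<bar> * B)"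
  proof -
    have "0 \<le> whitney_norm K 0 f"
      using geI(1)[OF _ zero_in_K, of 0 0] by (simp add: order_trans[OF abs_ge_zero])
    then have "B \<ge> 0" using assms[of 0] by simp
    then show ?thesis by (intro mult_left_mono mult_right_mono) auto
  qed
  finally show ?thesis .
qed

text \<open>The first function depends on \<open>f\<close> alone and goes into the operator; the
  second is smooth on the line and serves the estimates. They agree on \<open>K\<close>.\<close>

abbreviation (input) "flat_part \<equiv> \<lambda>x. f x - base f x"
abbreviation (input) "smooth_flat_part \<equiv> \<lambda>x. F x - base f x"

lemma flat_part_ext: "x \<in> K \<Longrightarrow> flat_part x = smooth_flat_part x"
  by (simp add: ext)

lemma smooth_smooth_flat_part: "Defs.smooth smooth_flat_part"
  by (intro smooth_diff F base_smooth)

text \<open>\<open>F\<close> and \<open>base f\<close> share the Taylor polynomial \<open>?T\<close>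
  at \<open>0\<close>, so it cancels. The remainder of \<open>F\<close> is bounded by the Whitney
  norm, that of \<open>base f\<close> by \<open>base_bound\<close>.\<close>

lemma flat_part_bound:
  assumes "\<And>m. m \<le> Suc r \<Longrightarrow> whitney_norm K m f \<le> B" "k \<ge> 1" "x \<in> I k" "i \<le> r"
  shows "\<bar>(deriv ^^ i) smooth_flat_part x\<bar> \<le> (1 + 2 * (exp 1 ^ r * \<bar>C r\<bar>)) * B * b k ^ (r - i)"
proof -
  have x: "x \<in> K" "0 < x" "x \<le> b k" using assms(2,3) I_subset_K I_pos by auto
  let ?T = "\<Sum>l\<le>r - i. (deriv ^^ (i + l)) F 0 / fact l * (x - 0) ^ l"
  have B: "B \<ge> 0"
    using assms(1)[of 0] whitney_norm_geI(1)[OF F ext[symmetric] zero_in_K, of 0 0]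
    by (simp add: order_trans[OF abs_ge_zero])
  have "\<bar>(deriv ^^ i) F x - ?T\<bar> \<le> whitney_norm K r f * \<bar>x - 0\<bar> ^ (r - i)"
    by (intro whitney_norm_geI(2)[OF F ext[symmetric]] x zero_in_K assms(4))
  also have "\<dots> \<le> B * \<bar>x - 0\<bar> ^ (r - i)" using assms(1)[of r] by (intro mult_right_mono) auto
  finally have 1: "\<bar>(deriv ^^ i) F x - ?T\<bar> \<le> B * \<bar>x - 0\<bar> ^ (r - i)" .
  have eq: "(deriv ^^ l) ((deriv ^^ i) (base f)) = (deriv ^^ (i + l)) (base f)" for l
    by (simp add: funpow_add add.commute[of i])
  have "\<bar>(deriv ^^ i) (base f) x - (\<Sum>l\<le>r - i. (deriv ^^ l) ((deriv ^^ i) (base f)) 0 / fact l * (x - 0) ^ l)\<bar>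
      \<le> 2 * (exp 1 ^ r * (\<bar>C r\<bar> * B)) * \<bar>x - 0\<bar> ^ (r - i)"
    using assms(4)
    by (intro taylor_remainder_bound_le smooth_higher_deriv base_smooth) (simp add: eq base_bound assms(1))
  then have 2: "\<bar>(deriv ^^ i) (base f) x - ?T\<bar> \<le> 2 * (exp 1 ^ r * (\<bar>C r\<bar> * B)) * \<bar>x - 0\<bar> ^ (r - i)"
    by (simp add: eq base_jet)
  have "(deriv ^^ i) smooth_flat_part x = (deriv ^^ i) F x - (deriv ^^ i) (base f) x"
    by (simp add: smooth_diff(2)[OF F base_smooth])
  then have "\<bar>(deriv ^^ i) smooth_flat_part x\<bar> \<le>
      B * \<bar>x - 0\<bar> ^ (r - i) + 2 * (exp 1 ^ r * (\<bar>C r\<bar> * B)) * \<bar>x - 0\<bar> ^ (r - i)"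
    using 1 2 by linarith
  also have "\<dots> = (1 + 2 * (exp 1 ^ r * \<bar>C r\<bar>)) * B * \<bar>x - 0\<bar> ^ (r - i)"
    by (simp add: algebra_simps)
  also have "\<dots> \<le> (1 + 2 * (exp 1 ^ r * \<bar>C r\<bar>)) * B * b k ^ (r - i)"
    using x B by (intro mult_left_mono power_mono) auto
  finally show ?thesis .
qed

lemma patch_node_left: "k \<ge> 1 \<Longrightarrow>
    flat_part (b k - \<delta> k + \<delta> k * exp (- real j)) = smooth_flat_part (b k - \<delta> k + \<delta> k * exp (- real j))"
  using node_left[of k j] I_subset_K[of k] by (intro flat_part_ext) auto

lemma patch_node_right: "k \<ge> 1 \<Longrightarrow>
    flat_part (b k + - \<delta> k * exp (- real j)) = smooth_flat_part (b k + - \<delta> k * exp (- real j))"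
  using node_right[of k j] I_subset_K[of k] by (intro flat_part_ext) auto

context
  fixes k :: nat
  assumes k: "k \<ge> 1"
begin

lemma \<delta>_scale: "\<delta> k \<noteq> 0" "\<bar>\<delta> k\<bar> \<le> 1" "- \<delta> k \<noteq> 0" "\<bar>- \<delta> k\<bar> \<le> 1"
  using \<delta>_pos[of k] \<delta>_le_1[OF k] by auto

lemmas left_facts = smooth_smooth_flat_part \<delta>_scale(1,2) patch_node_left[OF k]
lemmas right_facts = smooth_smooth_flat_part \<delta>_scale(3,4) patch_node_right[OF k]

lemma patch_on: "x \<in> I k \<Longrightarrow> patch k flat_part x = flat_part x"
proof -
  assume x: "x \<in> I k"
  then consider "x = b k - \<delta> k" | "b k - \<delta> k < x" "x \<le> b k" by (force simp: I_def)
  then show ?thesis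
  proof cases
    case 1
    \<comment> \<open>The left endpoint falls under the first branch of \<open>patch\<close>, so the
      jet of order \<open>0\<close> is needed there.\<close>
    then show ?thesis
      using rescaled_jet[OF left_facts, of 0] x I_subset_K[OF k] ext by (auto simp: patch_def)
  qed (simp add: patch_def)
qed

text \<open>Two gluings, first at the right endpoint and then at the left one; all derivatives match
  there by \<open>rescaled_jet\<close>.\<close>

lemma patch_smooth: "Defs.smooth (patch k flat_part)"
  and patch_deriv: "(deriv ^^ q) (patch k flat_part) x =
    (if x \<le> b k - \<delta> k then (deriv ^^ q) (rescaled (b k - \<delta> k) (\<delta> k) flat_part) x
     else if x \<le> b k then (deriv ^^ q) smooth_flat_part x
     else (deriv ^^ q) (rescaled (b k) (- \<delta> k) flat_part) x)"
proof -
  note right = smooth_smooth_flat_part rescaled_smooth[OF right_facts] rescaled_jet[OF right_facts, symmetric]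
  let ?inner = "\<lambda>x. if x \<le> b k then smooth_flat_part x else rescaled (b k) (- \<delta> k) flat_part x"
  note inner = smooth_glue[OF right]
  have "(deriv ^^ n) (rescaled (b k - \<delta> k) (\<delta> k) flat_part) (b k - \<delta> k) = (deriv ^^ n) ?inner (b k - \<delta> k)" for n
    using rescaled_jet[OF left_facts, of n] \<delta>_pos[of k] unfolding inner(2) by simp
  note outer = smooth_glue[OF rescaled_smooth[OF left_facts] inner(1) this]
  have "patch k flat_part = (\<lambda>x. if x \<le> b k - \<delta> k then rescaled (b k - \<delta> k) (\<delta> k) flat_part x else ?inner x)"
  proof
    fix x
    have "f x = F x" if "b k - \<delta> k < x" "x \<le> b k"
      using that I_subset_K[OF k] by (intro ext) (auto simp: I_def)
    then show "patch k flat_part x = (if x \<le> b k - \<delta> k then rescaled (b k - \<delta> k) (\<delta> k) flat_part x else ?inner x)"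
      unfolding patch_def by auto
  qed
  then show "Defs.smooth (patch k flat_part)" "(deriv ^^ q) (patch k flat_part) x =
    (if x \<le> b k - \<delta> k then (deriv ^^ q) (rescaled (b k - \<delta> k) (\<delta> k) flat_part) x
     else if x \<le> b k then (deriv ^^ q) smooth_flat_part x
     else (deriv ^^ q) (rescaled (b k) (- \<delta> k) flat_part) x)"
    using outer(1) outer(2)[of q] inner(2)[of q] by simp_all
qed

text \<open>The summand \<open>2 * \<bar>C q\<bar>\<close> covers the two sides, through
  \<open>jet_approx_segment\<close>, and the summand \<open>1\<close> the interval itself.\<close>

lemma patch_bound_S:
  assumes S: "\<And>i t. i \<le> Suc q \<Longrightarrow> t \<in> I k \<Longrightarrow> \<bar>(deriv ^^ i) smooth_flat_part t\<bar> \<le> S"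
  shows "\<bar>(deriv ^^ q) (patch k flat_part) x\<bar> \<le> (1 / \<delta> k) ^ q * ((2 * \<bar>C q\<bar> + 1) * S)"
proof -
  have S0: "S \<ge> 0" using S[of 0 "b k"] \<delta>_pos[of k] by (force simp: I_def)
  have one: "1 \<le> (1 / \<delta> k) ^ q"
    using \<delta>_pos[of k] \<delta>_le_1[OF k] by (intro one_le_power) (simp add: field_simps)
  have C1: "C q * (2 * S) \<le> (2 * \<bar>C q\<bar> + 1) * S"
  proof -
    have "C q * (2 * S) \<le> \<bar>C q\<bar> * (2 * S)" using S0 by (intro mult_right_mono) auto
    then show ?thesis using S0 by (simp add: algebra_simps)
  qed
  have seg: "closed_segment (b k - \<delta> k) (b k - \<delta> k + \<delta> k) = I k" "closed_segment (b k) (b k + - \<delta> k) = I k"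
    using \<delta>_pos[of k] by (simp_all add: closed_segment_eq_real_ivl I_def)
  consider "x \<le> b k - \<delta> k" | "b k - \<delta> k < x" "x \<le> b k" | "x > b k" by linarith
  then show ?thesis
  proof cases
    case 1
    have "jet_approx (\<lambda>j. flat_part (b k - \<delta> k + \<delta> k * exp (- real j)))
        (jet_coeffs (b k - \<delta> k) (\<delta> k) smooth_flat_part) (Suc q) (2 * S)"
      by (rule jet_approx_segment[OF left_facts]) (simp only: seg S)
    from rescaled_bound[OF left_facts this]
    have "\<bar>(deriv ^^ q) (patch k flat_part) x\<bar> \<le> (1 / \<bar>\<delta> k\<bar>) ^ q * (C q * (2 * S))"
      using 1 by (simp add: patch_deriv)
    also have "\<dots> \<le> (1 / \<delta> k) ^ q * ((2 * \<bar>C q\<bar> + 1) * S)"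
      using \<delta>_pos[of k] C1 by (simp add: mult_left_mono divide_right_mono power_one_over)
    finally show ?thesis .
  next
    case 2
    then have "\<bar>(deriv ^^ q) (patch k flat_part) x\<bar> \<le> 1 * (1 * S)"
      using S[of q x] by (simp add: patch_deriv I_def)
    also have "\<dots> \<le> (1 / \<delta> k) ^ q * ((2 * \<bar>C q\<bar> + 1) * S)"
      using S0 one by (intro mult_mono mult_right_mono) auto
    finally show ?thesis .
  next
    case 3
    have "jet_approx (\<lambda>j. flat_part (b k + - \<delta> k * exp (- real j)))
        (jet_coeffs (b k) (- \<delta> k) smooth_flat_part) (Suc q) (2 * S)"
      by (rule jet_approx_segment[OF right_facts]) (simp only: seg S)
    from rescaled_bound[OF right_facts this]
    have "\<bar>(deriv ^^ q) (patch k flat_part) x\<bar> \<le> (1 / \<bar>- \<delta> k\<bar>) ^ q * (C q * (2 * S))"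
      using 3 \<delta>_pos[of k] by (simp add: patch_deriv)
    also have "\<dots> \<le> (1 / \<delta> k) ^ q * ((2 * \<bar>C q\<bar> + 1) * S)"
      using \<delta>_pos[of k] C1 by (simp add: mult_left_mono divide_right_mono power_one_over)
    finally show ?thesis .
  qed
qed

end

end

end

locale interval_seq_bounded = interval_seq_jet +
  fixes N :: nat
  assumes Q_le: "k \<ge> 1 \<Longrightarrow> Q k \<le> real N"
begin

text \<open>After up to \<open>Suc q\<close> derivatives this order leaves the power
  \<open>Suc (N * q)\<close> of \<open>b k\<close>: the part \<open>N * q\<close> compensates
  \<open>(1 / \<delta> k) ^ q\<close>, and the last factor \<open>b k\<close> makes the sum over
  \<open>k\<close> converge.\<close>

definition norm_order :: "nat \<Rightarrow> nat" where
  "norm_order q = q + 2 + N * q"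

definition patch_const :: "nat \<Rightarrow> real" where
  "patch_const q = (2 * \<bar>C q\<bar> + 1) * (1 + 2 * (exp 1 ^ norm_order q * \<bar>C (norm_order q)\<bar>))"

lemma summable_b: "summable (\<lambda>k. b (Suc k))"
proof -
  have "b = (\<lambda>k. exp (- 1) ^ k)" by (simp add: b_def[abs_def] flip: exp_of_nat_mult)
  moreover have "summable (\<lambda>k. exp (- 1 :: real) ^ k)" by (intro summable_geometric) auto
  ultimately have "summable b" by simp
  then show ?thesis by (simp add: summable_Suc_iff)
qed

context
  fixes F f
  assumes F: "Defs.smooth F" and ext: "\<And>x. x \<in> K \<Longrightarrow> f x = F x"
begin

lemma whitney_norm_bound_nonneg:
  assumes "whitney_norm K m f \<le> B" shows "B \<ge> 0"
  using assms whitney_norm_geI(1)[OF F ext[symmetric] zero_in_K, of 0 m]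
  by (simp add: order_trans[OF abs_ge_zero])

lemma patch_bound:
  assumes k: "k \<ge> 1" and B: "\<And>m. m \<le> Suc (norm_order q) \<Longrightarrow> whitney_norm K m f \<le> B"
  shows "\<bar>(deriv ^^ q) (patch k (\<lambda>x. f x - base f x)) x\<bar> \<le> patch_const q * B * b k"
proof -
  define E where "E = 1 + 2 * (exp 1 ^ norm_order q * \<bar>C (norm_order q)\<bar>)"
  have E: "E \<ge> 0" unfolding E_def by simp
  have B0: "B \<ge> 0" using B[of 0] by (rule whitney_norm_bound_nonneg) simp
  have "\<bar>(deriv ^^ i) (\<lambda>x. F x - base f x) t\<bar> \<le> E * B * b k ^ Suc (N * q)"
    if i: "i \<le> Suc q" and t: "t \<in> I k" for i t
  proof -
    have "\<bar>(deriv ^^ i) (\<lambda>x. F x - base f x) t\<bar> \<le> E * B * b k ^ (norm_order q - i)"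
      unfolding E_def using i
      by (intro flat_part_bound[OF F ext B k t]) (auto simp: norm_order_def)
    also have "\<dots> \<le> E * B * b k ^ Suc (N * q)"
      using i b_pos[of k] b_le_1[of k] E B0
      by (intro mult_left_mono power_decreasing) (auto simp: norm_order_def)
    finally show ?thesis .
  qed
  then have "\<bar>(deriv ^^ q) (patch k (\<lambda>x. f x - base f x)) x\<bar> \<le>
      (1 / \<delta> k) ^ q * ((2 * \<bar>C q\<bar> + 1) * (E * B * b k ^ Suc (N * q)))"
    by (intro patch_bound_S[OF F ext k])
  also have "\<dots> = patch_const q * B * b k * ((1 / \<delta> k) * b k ^ N) ^ q"
    by (simp add: patch_const_def E_def power_mult power_mult_distrib power_divide mult_ac)
  also have "\<dots> \<le> patch_const q * B * b k * 1"
  proof (intro mult_left_mono power_le_one)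
    show "1 / \<delta> k * b k ^ N \<le> 1" using \<delta>_ge_power[OF Q_le[OF k]] \<delta>_pos[of k] by simp
    show "0 \<le> 1 / \<delta> k * b k ^ N" using \<delta>_pos[of k] b_pos[of k] by simp
    show "0 \<le> patch_const q * B * b k"
      using b_pos[of k] E B0 by (simp add: patch_const_def flip: E_def)
  qed
  finally show ?thesis by simp
qed

lemma extend_series:
  shows patch_summable: "summable (\<lambda>k. (deriv ^^ q) (patch (Suc k) (\<lambda>x. f x - base f x)) x)"
    and extend_smooth: "Defs.smooth (extend f)"
    and extend_deriv: "(deriv ^^ q) (extend f) x =
      (deriv ^^ q) (base f) x + (\<Sum>k. (deriv ^^ q) (patch (Suc k) (\<lambda>x. f x - base f x)) x)"
proof -
  let ?s = "\<lambda>k. patch (Suc k) (\<lambda>x. f x - base f x)"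
  define B where "B q = (\<Sum>m\<le>Suc (norm_order q). \<bar>whitney_norm K m f\<bar>)" for q
  have B: "whitney_norm K m f \<le> B q" if "m \<le> Suc (norm_order q)" for m q
  proof -
    have "whitney_norm K m f \<le> \<bar>whitney_norm K m f\<bar>" by simp
    also have "\<dots> \<le> B q" unfolding B_def using that by (intro member_le_sum) auto
    finally show ?thesis .
  qed
  have bd: "\<bar>(deriv ^^ q) (?s k) x\<bar> \<le> patch_const q * B q * b (Suc k)" for q k x
    by (intro patch_bound B) auto
  have sm: "summable (\<lambda>k. patch_const q * B q * b (Suc k))" for q
    by (intro summable_mult summable_b)
  show "summable (\<lambda>k. (deriv ^^ q) (?s k) x)"
    by (rule summable_comparison_test'[OF sm[of q], where N = 0]) (simp only: real_norm_def bd)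
  note series = smooth_suminf[OF patch_smooth[OF F ext] sm bd]
  show "Defs.smooth (extend f)"
    unfolding extend_def[abs_def] by (intro smooth_add base_smooth[OF F ext] series) auto
  show "(deriv ^^ q) (extend f) x = (deriv ^^ q) (base f) x + (\<Sum>k. (deriv ^^ q) (?s k) x)"
    unfolding extend_def[abs_def]
    using smooth_add(2)[OF base_smooth[OF F ext] series(1)] series(2)[of q] by simp
qed

lemma extend_bound:
  assumes B: "\<And>m. m \<le> Suc (norm_order q) \<Longrightarrow> whitney_norm K m f \<le> B"
  shows "\<bar>(deriv ^^ q) (extend f) x\<bar> \<le>
    (exp 1 ^ q * \<bar>C q\<bar> + patch_const q * (\<Sum>k. b (Suc k))) * B"
proof -
  have "\<bar>(deriv ^^ q) (base f) x\<bar> \<le> exp 1 ^ q * (\<bar>C q\<bar> * B)"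
    by (intro base_bound[OF F ext] B) (auto simp: norm_order_def)
  moreover have "\<bar>\<Sum>k. (deriv ^^ q) (patch (Suc k) (\<lambda>x. f x - base f x)) x\<bar>
      \<le> (\<Sum>k. patch_const q * B * b (Suc k))"
    unfolding real_norm_def[symmetric]
    by (intro norm_suminf_le summable_mult summable_b) (simp add: patch_bound B del: funpow.simps)
  moreover have "(\<Sum>k. patch_const q * B * b (Suc k)) = patch_const q * B * (\<Sum>k. b (Suc k))"
    by (rule suminf_mult[OF summable_b])
  ultimately show ?thesis
    unfolding extend_deriv by (simp add: algebra_simps)
qed

text \<open>At \<open>0\<close> all patches vanish and \<open>base f\<close> has the right value. On
  \<open>I k\<close> only the patch of \<open>I k\<close> survives, and it restores what
  \<open>base f\<close> misses; its series index is \<open>k - 1\<close>.\<close>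

lemma extend_extends:
  assumes "x \<in> K" shows "extend f x = f x"
  using assms
proof (cases rule: in_K_cases)
  case 1
  have "patch (Suc k) (\<lambda>x. f x - base f x) x = 0" for k
    using b_pos[of "Suc k"] by (intro patch_off) (auto simp: 1)
  then show ?thesis
    using base_jet[OF F ext, of 0] ext[OF zero_in_K] by (simp add: extend_def 1)
next
  case (2 k)
  have "(\<Sum>j. patch (Suc j) (\<lambda>x. f x - base f x) x) =
      (\<Sum>j\<in>{k - 1}. patch (Suc j) (\<lambda>x. f x - base f x) x)"
  proof (rule suminf_finite)
    fix j assume "j \<notin> {k - 1}"
    then show "patch (Suc j) (\<lambda>x. f x - base f x) x = 0"
      using 2 by (intro patch_off I_separated[of k]) auto
  qed simp
  also have "\<dots> = f x - base f x"
    using 2 patch_on[OF F ext, of k x] by simp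
  finally show ?thesis by (simp add: extend_def)
qed

end

lemma extend_linear:
  assumes F: "Defs.smooth F" "\<And>x. x \<in> K \<Longrightarrow> f x = F x"
    and G: "Defs.smooth G" "\<And>x. x \<in> K \<Longrightarrow> g x = G x"
  shows "extend (\<lambda>x. c * f x + d * g x) x = c * extend f x + d * extend g x"
proof -
  have base: "base (\<lambda>x. c * f x + d * g x) x = c * base f x + d * base g x" for x
    unfolding base_def
    by (rule rescaled_linear[OF F(1) base_node[OF F] G(1) base_node[OF G]]) auto
  have "patch k (\<lambda>x. c * f x + d * g x - base (\<lambda>x. c * f x + d * g x) x) x =
      c * patch k (\<lambda>x. f x - base f x) x + d * patch k (\<lambda>x. g x - base g x) x" if k: "k \<ge> 1" for k x
  proof -
    have eq: "(\<lambda>x. c * f x + d * g x - base (\<lambda>x. c * f x + d * g x) x) =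
        (\<lambda>x. c * (f x - base f x) + d * (g x - base g x))"
      unfolding base by (simp add: algebra_simps)
    show ?thesis
      unfolding eq patch_def
      using rescaled_linear[OF smooth_smooth_flat_part[OF F] patch_node_left[OF F k]
          smooth_smooth_flat_part[OF G] patch_node_left[OF G k] \<delta>_scale(1,2)[OF F k]]
        rescaled_linear[OF smooth_smooth_flat_part[OF F] patch_node_right[OF F k]
          smooth_smooth_flat_part[OF G] patch_node_right[OF G k] \<delta>_scale(3,4)[OF F k]]
      by auto
  qed
  then show ?thesis
    unfolding extend_def base
    using patch_summable[OF F, of 0 x] patch_summable[OF G, of 0 x]
    by (simp add: suminf_add[symmetric] suminf_mult summable_mult algebra_simps)
qed

theorem extension_property: "extension_property K"
proof (rule extension_propertyI[of extend])
  have *: "\<exists>F. Defs.smooth F \<and> (\<forall>x\<in>K. f x = F x)" if "f \<in> whitney_functions K" for f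
    using that unfolding whitney_functions_iff zero_off_def by auto
  fix f assume f: "f \<in> whitney_functions K"
  then obtain F where F: "Defs.smooth F" "\<And>x. x \<in> K \<Longrightarrow> f x = F x" using * by blast
  show "Defs.smooth (extend f)" by (rule extend_smooth[OF F])
  show "extend f x = f x" if "x \<in> K" for x by (rule extend_extends[OF F that])
  fix g c d assume "g \<in> whitney_functions K"
  then obtain G where G: "Defs.smooth G" "\<And>x. x \<in> K \<Longrightarrow> g x = G x" using * by blast
  show "extend (\<lambda>x. c * f x + d * g x) = (\<lambda>x. c * extend f x + d * extend g x)"
    by (rule ext) (rule extend_linear[OF F G])
next
  fix n
  let ?c = "\<lambda>q. exp 1 ^ q * \<bar>C q\<bar> + patch_const q * (\<Sum>k. b (Suc k))"
  show "\<exists>r c. \<forall>f B. f \<in> whitney_functions K \<longrightarrow> (\<forall>m\<le>r. whitney_norm K m f \<le> B) \<longrightarrow>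
      (\<forall>k\<le>n. \<forall>x. \<bar>(deriv ^^ k) (extend f) x\<bar> \<le> c * B)"
  proof (intro exI allI impI)
    fix f B k x
    assume f: "f \<in> whitney_functions K" and B: "\<forall>m\<le>Suc (norm_order n). whitney_norm K m f \<le> B"
      and k: "k \<le> n"
    obtain F where F: "Defs.smooth F" "\<And>x. x \<in> K \<Longrightarrow> f x = F x"
      using f unfolding whitney_functions_iff zero_off_def by auto
    have "norm_order k \<le> norm_order n"
      using k unfolding norm_order_def by (intro add_mono mult_le_mono) auto
    then have "\<bar>(deriv ^^ k) (extend f) x\<bar> \<le> ?c k * B"
      using B by (intro extend_bound[OF F]) auto
    also have "\<dots> \<le> (\<Sum>q\<le>n. \<bar>?c q\<bar>) * B"
    proof (rule mult_right_mono)
      have "?c k \<le> \<bar>?c k\<bar>" by simp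
      also have "\<dots> \<le> (\<Sum>q\<le>n. \<bar>?c q\<bar>)" using k by (intro member_le_sum) auto
      finally show "?c k \<le> (\<Sum>q\<le>n. \<bar>?c q\<bar>)" .
      show "0 \<le> B" by (rule whitney_norm_bound_nonneg[OF F B[rule_format, of 0]]) simp_all
    qed
    finally show "\<bar>(deriv ^^ k) (extend f) x\<bar> \<le> (\<Sum>q\<le>n. \<bar>?c q\<bar>) * B" .
  qed
qed

end

lemma (in interval_seq) extension_property_of_bounded:
  assumes "bdd_above (Q ` {1..})"
  shows "extension_property K"
proof -
  obtain M where M: "\<And>k. k \<ge> 1 \<Longrightarrow> Q k \<le> M"
    using assms unfolding bdd_above_def by auto
  obtain J C where "jet_extension J C" using jet_extension_exists by blast
  then interpret jet_extension J C .
  interpret interval_seq_bounded Q J C "nat \<lceil>M\<rceil>"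
    by unfold_locales (use M of_nat_ceiling[of M] in \<open>meson order_trans\<close>)
  show ?thesis by (rule extension_property)
qed

section \<open>The extension property bounds the exponents\<close>

text \<open>Induction by the mean value theorem between good points of the two outer thirds of the
  interval. They are at least \<open>L / 3\<close> apart, which gives \<open>6 * E / L\<close> with
  \<open>E\<close> the bound of order \<open>N\<close> on a third.\<close>

lemma exists_small_higher_deriv:
  "\<exists>D>0. \<forall>F c L A. smooth F \<longrightarrow> L > 0 \<longrightarrow> (\<forall>x\<in>{c..c + L}. \<bar>F x\<bar> \<le> A) \<longrightarrow>
     (\<exists>\<xi>\<in>{c..c + L}. \<bar>(deriv ^^ N) F \<xi>\<bar> \<le> D * A / L ^ N)"
proof (induction N)
  case 0
  have "\<exists>\<xi>\<in>{c..c + L}. \<bar>(deriv ^^ 0) F \<xi>\<bar> \<le> 1 * A / L ^ 0"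
    if "L > 0" "\<forall>x\<in>{c..c + L}. \<bar>F x\<bar> \<le> A" for F :: "real \<Rightarrow> real" and c L A :: real
    using that by (intro bexI[of _ c]) auto
  then show ?case by (intro exI[of _ 1]) simp
next
  case (Suc N)
  then obtain D where D: "D > 0" and IH: "\<And>F c L A. smooth F \<Longrightarrow> L > 0 \<Longrightarrow> (\<forall>x\<in>{c..c + L}. \<bar>F x\<bar> \<le> A) \<Longrightarrow>
     (\<exists>\<xi>\<in>{c..c + L}. \<bar>(deriv ^^ N) F \<xi>\<bar> \<le> D * A / L ^ N)" by blast
  have "\<exists>\<xi>\<in>{c..c + L}. \<bar>(deriv ^^ Suc N) F \<xi>\<bar> \<le> (6 * 3 ^ N * D) * A / L ^ Suc N"
    if F: "smooth F" and L: "L > 0" and A: "\<forall>x\<in>{c..c + L}. \<bar>F x\<bar> \<le> A" for F c L A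
  proof -
    define E where "E = D * A / (L / 3) ^ N"
    obtain x where x: "x \<in> {c..c + L / 3}" "\<bar>(deriv ^^ N) F x\<bar> \<le> E"
      using IH[OF F, of "L / 3" c A] L A unfolding E_def by auto
    obtain y where y: "y \<in> {c + 2 * L / 3..c + 2 * L / 3 + L / 3}" "\<bar>(deriv ^^ N) F y\<bar> \<le> E"
      using IH[OF F, of "L / 3" "c + 2 * L / 3" A] L A unfolding E_def by auto
    have xy: "y - x \<ge> L / 3" "x < y" using x(1) y(1) L by auto
    obtain z where z: "x < z" "z < y"
      and mvt: "(deriv ^^ N) F y - (deriv ^^ N) F x = (y - x) * (deriv ^^ Suc N) F z"
      using MVT2[OF xy(2), of "(deriv ^^ N) F" "(deriv ^^ Suc N) F"] smooth_DERIV[OF F, of N] by blast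
    have "L / 3 * \<bar>(deriv ^^ Suc N) F z\<bar> \<le> \<bar>(y - x) * (deriv ^^ Suc N) F z\<bar>"
      unfolding abs_mult using xy L by (intro mult_right_mono) auto
    also have "\<dots> \<le> 2 * E" unfolding mvt[symmetric] using x(2) y(2) by linarith
    finally have "\<bar>(deriv ^^ Suc N) F z\<bar> \<le> 6 * E / L" using L by (simp add: field_simps)
    also have "6 * E / L = (6 * 3 ^ N * D) * A / L ^ Suc N"
      using L by (simp add: E_def field_simps)
    finally show ?thesis using z x(1) y(1) by (intro bexI[of _ z]) auto
  qed
  then show ?case using D by (intro exI[of _ "6 * 3 ^ N * D"]) auto
qed

section \<open>Cut-off monomials\<close>

definition bump_power :: "nat \<Rightarrow> real \<Rightarrow> real" where
  "bump_power N y = y ^ N * bump (1 / 8 * y + 0)"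

lemma smooth_bump_power: "smooth (bump_power N)"
  unfolding bump_power_def[abs_def]
  by (intro smooth_mult smooth_power smooth_ident smooth_affine(1) smooth_bump)

lemma bump_power_eq: "\<bar>y\<bar> \<le> 1 \<Longrightarrow> bump_power N y = y ^ N" "\<bar>y\<bar> \<ge> 2 \<Longrightarrow> bump_power N y = 0"
  by (simp_all add: bump_power_def bump_eq_1 bump_eq_0)

lemma bump_power_deriv_at_0: "(deriv ^^ N) (bump_power N) 0 = fact N"
proof -
  define a :: "nat \<Rightarrow> real" where "a i = (if i = N then fact N else 0)" for i
  have "(\<Sum>i\<le>N. a i / fact i * (y - 0) ^ i) = y ^ N" for y :: real
  proof -
    have "(\<Sum>i\<le>N. a i / fact i * (y - 0) ^ i) = (\<Sum>i\<in>{N}. y ^ N)"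
      by (intro sum.mono_neutral_cong_right) (auto simp: a_def)
    then show ?thesis by simp
  qed
  then have "(deriv ^^ N) (bump_power N) 0 = (deriv ^^ N) (\<lambda>y. \<Sum>i\<le>N. a i / fact i * (y - 0) ^ i) 0"
    by (intro higher_deriv_cong_open[of "ball 0 1"]) (auto simp: bump_power_eq)
  also have "\<dots> = fact N"
    using higher_deriv_taylor_poly(2)[of N N a 0 0] by (simp add: a_def)
  finally show ?thesis .
qed

lemma bump_power_bounded:
  obtains P where "P > 0" "\<And>j y. j \<le> r \<Longrightarrow> \<bar>(deriv ^^ j) (bump_power N) y\<bar> \<le> P"
proof -
  have ex: "\<exists>B. \<forall>y. \<bar>(deriv ^^ j) (bump_power N) y\<bar> \<le> B" for j
  proof -
    have "bump_power N y = 0" if "y \<notin> {-2..2}" for y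
      using that by (intro bump_power_eq) auto
    then show ?thesis using higher_deriv_bounded[OF smooth_bump_power] by metis
  qed
  define B where "B j = (SOME B. \<forall>y. \<bar>(deriv ^^ j) (bump_power N) y\<bar> \<le> B)" for j
  have B: "\<bar>(deriv ^^ j) (bump_power N) y\<bar> \<le> B j" for j y
    using someI_ex[OF ex[of j]] unfolding B_def by blast
  show ?thesis
  proof (rule that)
    show "1 + (\<Sum>j\<le>r. \<bar>B j\<bar>) > 0" by (simp add: add_pos_nonneg sum_nonneg)
    fix j y assume "j \<le> r"
    have "\<bar>(deriv ^^ j) (bump_power N) y\<bar> \<le> \<bar>B j\<bar>" using B[of j y] by linarith
    also have "\<dots> \<le> (\<Sum>j\<le>r. \<bar>B j\<bar>)" using \<open>j \<le> r\<close> by (intro member_le_sum) auto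
    finally show "\<bar>(deriv ^^ j) (bump_power N) y\<bar> \<le> 1 + (\<Sum>j\<le>r. \<bar>B j\<bar>)" by simp
  qed
qed

text \<open>The monomial \<open>(x - c) ^ N\<close> cut off at distance comparable to
  \<open>w\<close>; the factor \<open>w ^ N\<close> normalises it, so that its \<open>j\<close>-th
  derivative has size \<open>w ^ N / w ^ j\<close>.\<close>

definition scaled_bump_power :: "nat \<Rightarrow> real \<Rightarrow> real \<Rightarrow> real \<Rightarrow> real" where
  "scaled_bump_power N c w x = w ^ N * bump_power N (1 / w * x + (- c / w))"

lemma smooth_scaled_bump_power: "smooth (scaled_bump_power N c w)"
  and scaled_bump_power_deriv: "(deriv ^^ j) (scaled_bump_power N c w) x =
    w ^ N * ((1 / w) ^ j * (deriv ^^ j) (bump_power N) (1 / w * x + (- c / w)))"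
proof -
  have eq: "scaled_bump_power N c w = (\<lambda>x. w ^ N * bump_power N (1 / w * x + (- c / w)))"
    by (simp only: scaled_bump_power_def[abs_def])
  note affine = smooth_affine[OF smooth_bump_power]
  show "smooth (scaled_bump_power N c w)"
    unfolding eq by (rule smooth_cmult(1)[OF affine(1)])
  show "(deriv ^^ j) (scaled_bump_power N c w) x =
    w ^ N * ((1 / w) ^ j * (deriv ^^ j) (bump_power N) (1 / w * x + (- c / w)))"
    unfolding eq smooth_cmult(2)[OF affine(1)] affine(2) ..
qed

lemma scaled_bump_power_eq:
  assumes "w > 0"
  shows "\<bar>x - c\<bar> \<le> w \<Longrightarrow> scaled_bump_power N c w x = (x - c) ^ N"
    and "\<bar>x - c\<bar> \<ge> 2 * w \<Longrightarrow> scaled_bump_power N c w x = 0"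
proof -
  have arg: "1 / w * x + (- c / w) = (x - c) / w" by (simp add: diff_divide_distrib)
  show "scaled_bump_power N c w x = (x - c) ^ N" if "\<bar>x - c\<bar> \<le> w"
    using assms that unfolding scaled_bump_power_def arg
    by (subst bump_power_eq(1)) (simp_all add: power_divide)
  show "scaled_bump_power N c w x = 0" if "\<bar>x - c\<bar> \<ge> 2 * w"
    using assms that unfolding scaled_bump_power_def arg
    by (subst bump_power_eq(2)) (simp_all add: field_simps)
qed

context interval_seq
begin

text \<open>All widths \<open>w\<close> from \<open>\<delta> k\<close> to \<open>b k / 4\<close>
  induce the same trace, since \<open>K\<close> has no points between \<open>I k\<close> and the
  outer cut-off. The width can thus be chosen separately for each norm.\<close>

lemma zero_off_scaled_bump_power:
  assumes k: "k \<ge> 1" and w: "\<delta> k \<le> w" "w \<le> b k / 4"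
  shows "zero_off K (scaled_bump_power N (b k) w) = (\<lambda>x. if x \<in> I k then (x - b k) ^ N else 0)"
proof
  fix x
  have w0: "w > 0" using w \<delta>_pos[of k] by linarith
  consider "x \<notin> K" | "x \<in> I k" | "x \<in> K" "x \<notin> I k" by blast
  then show "zero_off K (scaled_bump_power N (b k) w) x = (if x \<in> I k then (x - b k) ^ N else 0)"
  proof cases
    case 1
    then show ?thesis using I_subset_K[OF k] by (auto simp: zero_off_def)
  next
    case 2
    then have "\<bar>x - b k\<bar> \<le> w" using w by (auto simp: I_def)
    then show ?thesis
      using 2 I_subset_K[OF k] w0 by (auto simp: zero_off_def scaled_bump_power_eq(1))
  next
    case 3
    have "\<bar>x - b k\<bar> \<ge> 2 * w" using K_separated[OF k 3] w b_pos[of k] by auto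
    then show ?thesis using 3 w0 by (simp add: zero_off_def scaled_bump_power_eq(2))
  qed
qed

lemma \<delta>_le_quarter:
  assumes "k \<ge> 2" shows "\<delta> k \<le> b k / 4"
proof -
  have "b k \<le> 2 / 5 * b 1" using assms by (intro b_less_le) auto
  then have "b k \<le> 1 / 4" using b_le[of 1] by simp
  then have "b k * b k \<le> 1 / 4 * b k" using b_pos[of k] by (intro mult_right_mono) auto
  with \<delta>_le_b_sq[of k] assms show ?thesis by simp
qed

lemma \<delta>_lower_bound_of_extension_property:
  assumes "extension_property K"
  shows "\<exists>\<kappa>>0. \<exists>n. \<forall>k\<ge>2. \<kappa> * b k ^ n \<le> \<delta> k"
proof -
  obtain W where W: "\<And>f. f \<in> whitney_functions K \<Longrightarrow> smooth (W f)"
      "\<And>f x. f \<in> whitney_functions K \<Longrightarrow> x \<in> K \<Longrightarrow> W f x = f x"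
    and bound: "\<forall>n. \<exists>r C. \<forall>F S. S > 0 \<longrightarrow> smooth F \<longrightarrow> (\<forall>j\<le>r. \<forall>x\<in>{0..1}. \<bar>(deriv ^^ j) F x\<bar> \<le> S) \<longrightarrow>
      (\<forall>k\<le>n. \<forall>x\<in>{- real n..real n}. \<bar>(deriv ^^ k) (W (zero_off K F)) x\<bar> \<le> C * S)"
    using extension_propertyD[OF assms] by blast
  \<comment> \<open>The seminorm of index \<open>1\<close> is taken for its interval
    \<open>{- 1..1}\<close>; index \<open>0\<close> would only see the point
    \<open>0\<close>.\<close>
  obtain p C0 where p: "\<And>F S k x. S > 0 \<Longrightarrow> smooth F \<Longrightarrow> (\<forall>j\<le>p. \<forall>x\<in>{0..1}. \<bar>(deriv ^^ j) F x\<bar> \<le> S) \<Longrightarrow>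
      k \<le> 1 \<Longrightarrow> x \<in> {- real 1..real 1} \<Longrightarrow> \<bar>(deriv ^^ k) (W (zero_off K F)) x\<bar> \<le> C0 * S"
    using spec[OF bound, of 1] by blast
  have C0: "\<bar>W (zero_off K F) x\<bar> \<le> C0 * S"
    if "S > 0" "smooth F" "\<forall>j\<le>p. \<forall>x\<in>{0..1}. \<bar>(deriv ^^ j) F x\<bar> \<le> S" "x \<in> {-1..1}" for F S x
    using p[of S F 0 x] that by simp
  \<comment> \<open>With \<open>N > p\<close>, each derivative of order at most \<open>p\<close> of
    the function of width \<open>\<delta> k\<close> retains a factor
    \<open>\<delta> k\<close>.\<close>
  define N where "N = Suc p"
  obtain r C1 where C1: "\<And>F S x. S > 0 \<Longrightarrow> smooth F \<Longrightarrow> (\<forall>j\<le>r. \<forall>x\<in>{0..1}. \<bar>(deriv ^^ j) F x\<bar> \<le> S) \<Longrightarrow>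
      x \<in> {- real (Suc N)..real (Suc N)} \<Longrightarrow> \<bar>(deriv ^^ Suc N) (W (zero_off K F)) x\<bar> \<le> C1 * S"
    using spec[OF bound, of "Suc N"] by blast
  obtain P where P: "P > 0" "\<And>j y. j \<le> max p r \<Longrightarrow> \<bar>(deriv ^^ j) (bump_power N) y\<bar> \<le> P"
    using bump_power_bounded by metis
  obtain D where D: "D > 0" and small: "\<And>F c L A. smooth F \<Longrightarrow> L > 0 \<Longrightarrow> (\<forall>x\<in>{c..c + L}. \<bar>F x\<bar> \<le> A) \<Longrightarrow>
     (\<exists>\<xi>\<in>{c..c + L}. \<bar>(deriv ^^ N) F \<xi>\<bar> \<le> D * A / L ^ N)"
    using exists_small_higher_deriv[of N] by blast
  \<comment> \<open>Chosen so that the \<open>N\<close>-th derivative of the extension varies by at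
    most \<open>1 / 2\<close> over an interval of length \<open>\<mu> * b k ^ r\<close>.\<close>
  define \<mu> where "\<mu> = 1 / (2 * 4 ^ r * (\<bar>C1\<bar> * P + 1))"
  have \<mu>: "\<mu> > 0" using P unfolding \<mu>_def by (intro divide_pos_pos mult_pos_pos) (auto intro: add_nonneg_pos)
  define \<kappa> where "\<kappa> = \<mu> ^ N / (2 * (D * ((\<bar>C0\<bar> + 1) * P)))"
  have \<kappa>: "\<kappa> > 0" unfolding \<kappa>_def using \<mu> D P
    by (intro divide_pos_pos mult_pos_pos zero_less_power) (auto intro: add_nonneg_pos)
  have "\<kappa> * b k ^ (r * N) \<le> \<delta> k" if k2: "k \<ge> 2" for k
  proof -
    have k: "k \<ge> 1" using k2 by simp
    define f where "f = (\<lambda>x. if x \<in> I k then (x - b k) ^ N else 0)"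
    define F where "F = scaled_bump_power N (b k)"
    have zF: "zero_off K (F w) = f" if "\<delta> k \<le> w" "w \<le> b k / 4" for w
      unfolding F_def f_def using k that by (rule zero_off_scaled_bump_power)
    have smF: "smooth (F w)" for w unfolding F_def by (rule smooth_scaled_bump_power)
    have z1: "zero_off K (F (\<delta> k)) = f" and z2: "zero_off K (F (b k / 4)) = f"
      using \<delta>_le_quarter[OF k2] by (auto intro: zF)
    have f: "f \<in> whitney_functions K" unfolding whitney_functions_iff using z1 smF by metis
    define H where "H = W f"
    have smH: "smooth H" unfolding H_def by (rule W(1)[OF f])
    have b1: "b k \<le> 2 / 5" by (rule b_le[OF k])
    \<comment> \<open>The narrow width \<open>\<delta> k\<close> makes the low-order norms, and
      hence \<open>H\<close> itself, of size \<open>\<delta> k\<close>.\<close>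
    have H0: "\<bar>H x\<bar> \<le> (\<bar>C0\<bar> + 1) * (\<delta> k * P)" if x: "x \<in> {-1..1}" for x
    proof -
      have "\<bar>W (zero_off K (F (\<delta> k))) x\<bar> \<le> C0 * (\<delta> k * P)"
      proof (rule C0)
        show "\<forall>j\<le>p. \<forall>x\<in>{0..1}. \<bar>(deriv ^^ j) (F (\<delta> k)) x\<bar> \<le> \<delta> k * P"
        proof (intro allI impI ballI)
          fix j x assume j: "j \<le> p"
          have d: "\<delta> k > 0" "\<delta> k \<le> 1" using \<delta>_pos[of k] \<delta>_le_quarter[OF k2] b1 by auto
          have "\<delta> k ^ N * (1 / \<delta> k) ^ j = \<delta> k ^ (N - j)"
            using j d by (simp add: N_def power_diff power_one_over)
          also have "\<dots> \<le> \<delta> k ^ 1" using j d by (intro power_decreasing) (auto simp: N_def)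
          finally have "\<delta> k ^ N * (1 / \<delta> k) ^ j * \<bar>(deriv ^^ j) (bump_power N) y\<bar> \<le> \<delta> k * P" for y
            using P j d by (intro mult_mono) auto
          then show "\<bar>(deriv ^^ j) (F (\<delta> k)) x\<bar> \<le> \<delta> k * P"
            unfolding F_def scaled_bump_power_deriv using d by (simp add: abs_mult power_one_over mult.assoc)
        qed
      qed (use P \<delta>_pos[of k] smF x in auto)
      also have "\<dots> \<le> (\<bar>C0\<bar> + 1) * (\<delta> k * P)" using P \<delta>_pos[of k] by (intro mult_right_mono) auto
      finally show ?thesis unfolding z1 H_def .
    qed
    \<comment> \<open>The wide width \<open>b k / 4\<close> keeps the high-order norms polynomial in
      \<open>1 / b k\<close>, independently of \<open>\<delta> k\<close>.\<close>
    have H1: "\<bar>(deriv ^^ Suc N) H x\<bar> \<le> \<bar>C1\<bar> * ((4 / b k) ^ r * P)" if x: "x \<in> {-1..1}" for x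
    proof -
      have d: "b k / 4 > 0" "b k / 4 \<le> 1" "1 \<le> 4 / b k" using b_pos[of k] b1 by auto
      have "\<bar>(deriv ^^ Suc N) (W (zero_off K (F (b k / 4)))) x\<bar> \<le> C1 * ((4 / b k) ^ r * P)"
      proof (rule C1)
        show "\<forall>j\<le>r. \<forall>x\<in>{0..1}. \<bar>(deriv ^^ j) (F (b k / 4)) x\<bar> \<le> (4 / b k) ^ r * P"
        proof (intro allI impI ballI)
          fix j x assume j: "j \<le> r"
          have "(b k / 4) ^ N * ((1 / (b k / 4)) ^ j * \<bar>(deriv ^^ j) (bump_power N) y\<bar>) \<le> 1 * ((4 / b k) ^ r * P)" for y
          proof (intro mult_mono)
            show "(b k / 4) ^ N \<le> 1" using d by (intro power_le_one) auto
            have "(1 / (b k / 4)) ^ j = (4 / b k) ^ j" by simp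
            also have "\<dots> \<le> (4 / b k) ^ r" using d j by (intro power_increasing) auto
            finally show "(1 / (b k / 4)) ^ j \<le> (4 / b k) ^ r" .
          qed (use P j d in auto)
          then show "\<bar>(deriv ^^ j) (F (b k / 4)) x\<bar> \<le> (4 / b k) ^ r * P"
            unfolding F_def scaled_bump_power_deriv using d by (simp add: abs_mult power_abs)
        qed
        show "x \<in> {- real (Suc N)..real (Suc N)}" using x by auto
      qed (use P b_pos[of k] smF in auto)
      also have "\<dots> \<le> \<bar>C1\<bar> * ((4 / b k) ^ r * P)" using P b_pos[of k] by (intro mult_right_mono) auto
      finally show ?thesis unfolding z2 H_def .
    qed
    have HN: "(deriv ^^ N) H (b k) = fact N"
    proof -
      have "H x = F (b k / 4) x" if "x \<in> K" for x
        using W(2)[OF f that] fun_cong[OF z2, of x] that by (simp add: H_def zero_off_def)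
      then have "(deriv ^^ N) H (b k) = (deriv ^^ N) (F (b k / 4)) (b k)"
        by (intro higher_deriv_eq_on[of _ _ K] smH smF islimpt b_in_K k)
      also have "\<dots> = fact N"
        using b_pos[of k] unfolding F_def scaled_bump_power_deriv
        by (simp add: bump_power_deriv_at_0 power_divide flip: add_divide_distrib)
      finally show ?thesis .
    qed
    define L where "L = \<mu> * b k ^ r"
    have L0: "L > 0" using \<mu> b_pos[of k] by (simp add: L_def)
    have L1: "L \<le> 1 / 2"
    proof -
      have "\<mu> \<le> 1 / 2"
      proof -
        have "1 * 1 \<le> (4 ^ r :: real) * (\<bar>C1\<bar> * P + 1)"
          using P by (intro mult_mono) auto
        then show ?thesis unfolding \<mu>_def by (simp add: field_simps)
      qed
      then have "\<mu> * b k ^ r \<le> 1 / 2 * 1"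
        using b_pos[of k] b_le_1[of k] \<mu> by (intro mult_mono power_le_one) auto
      then show ?thesis by (simp add: L_def)
    qed
    have range: "t \<in> {-1..1}" if "t \<in> {b k..b k + L}" for t
      using that b_pos[of k] b1 L1 by auto
    obtain \<xi> where \<xi>: "\<xi> \<in> {b k..b k + L}" "\<bar>(deriv ^^ N) H \<xi>\<bar> \<le> D * ((\<bar>C0\<bar> + 1) * (\<delta> k * P)) / L ^ N"
      using small[OF smH L0, of "b k"] H0 range by blast
    have "\<bar>(deriv ^^ N) H (b k) - (deriv ^^ N) H \<xi>\<bar> \<le> L * (\<bar>C1\<bar> * ((4 / b k) ^ r * P))"
    proof (cases "\<xi> = b k")
      case True
      then show ?thesis using L0 P b_pos[of k] by simp
    next
      case False
      then have lt: "b k < \<xi>" using \<xi>(1) by auto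
      obtain z where z: "b k < z" "z < \<xi>"
        and mvt: "(deriv ^^ N) H \<xi> - (deriv ^^ N) H (b k) = (\<xi> - b k) * (deriv ^^ Suc N) H z"
        using MVT2[OF lt, of "(deriv ^^ N) H" "(deriv ^^ Suc N) H"] smooth_DERIV[OF smH, of N] by blast
      have "\<bar>(deriv ^^ N) H (b k) - (deriv ^^ N) H \<xi>\<bar> = \<bar>\<xi> - b k\<bar> * \<bar>(deriv ^^ Suc N) H z\<bar>"
        by (subst abs_minus_commute) (simp only: mvt abs_mult)
      also have "\<dots> \<le> L * (\<bar>C1\<bar> * ((4 / b k) ^ r * P))"
        using \<xi>(1) z L0 by (intro mult_mono H1 range) auto
      finally show ?thesis .
    qed
    also have "\<dots> \<le> 1 / 2"
    proof -
      define t where "t = (\<bar>C1\<bar> * P) / (\<bar>C1\<bar> * P + 1)"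
      have "L * (\<bar>C1\<bar> * ((4 / b k) ^ r * P)) = t / 2"
        unfolding t_def using b_pos[of k] by (simp add: L_def \<mu>_def power_divide)
      moreover have "t \<le> 1"
        unfolding t_def using P by (simp add: divide_le_eq_1 add_nonneg_pos)
      ultimately show ?thesis by simp
    qed
    \<comment> \<open>The derivative at \<open>b k\<close> is \<open>fact N \<ge> 1\<close>, so
      \<open>1 / 2\<close> remains at \<open>\<xi>\<close>, where smallness of \<open>H\<close>
      forces an upper bound proportional to \<open>\<delta> k\<close>.\<close>
    finally have "1 / 2 \<le> \<bar>(deriv ^^ N) H \<xi>\<bar>"
      unfolding HN using fact_ge_1[of N, where 'a = real] by linarith
    then have "1 / 2 \<le> D * ((\<bar>C0\<bar> + 1) * (\<delta> k * P)) / L ^ N" using \<xi>(2) by linarith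
    moreover define A where "A = D * ((\<bar>C0\<bar> + 1) * P)"
    ultimately have "1 / 2 \<le> \<delta> k * A / L ^ N" by (simp add: mult_ac)
    then have "L ^ N / 2 \<le> \<delta> k * A" using L0 by (simp add: field_simps)
    moreover have "A > 0" using D P by (simp add: A_def add_nonneg_pos)
    ultimately have "L ^ N / (2 * A) \<le> \<delta> k" by (simp add: field_simps)
    then have "L ^ N / (2 * (D * ((\<bar>C0\<bar> + 1) * P))) \<le> \<delta> k" by (simp only: A_def)
    then show ?thesis by (simp add: L_def \<kappa>_def power_mult_distrib power_mult)
  qed
  with \<kappa> show ?thesis by blast
qed

text \<open>Taking logarithms in the lower bound for \<open>\<delta> k\<close> and dividing by
  \<open>k\<close> bounds \<open>Q k\<close>; the value at \<open>1\<close>, outside the range of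
  that bound, is added by hand.\<close>

lemma bounded_of_extension_property:
  assumes "extension_property K"
  shows "bdd_above (Q ` {1..})"
proof -
  obtain \<kappa> n where \<kappa>: "\<kappa> > 0" "\<And>k. k \<ge> 2 \<Longrightarrow> \<kappa> * b k ^ n \<le> \<delta> k"
    using \<delta>_lower_bound_of_extension_property[OF assms] by blast
  have "Q k \<le> max (Q 1) (real n + \<bar>ln \<kappa>\<bar>)" if k: "k \<ge> 1" for k
  proof (cases "k = 1")
    case False
    then have k2: "k \<ge> 2" using k by simp
    have "ln (\<kappa> * b k ^ n) \<le> ln (\<delta> k)"
      using \<kappa>(1) \<kappa>(2)[OF k2] b_pos[of k] \<delta>_pos[of k] by (subst ln_le_cancel_iff) auto
    then have "ln \<kappa> - real n * real k \<le> - (real k * Q k)"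
      using \<kappa>(1) by (simp add: ln_mult ln_realpow b_def \<delta>_def)
    then have "real k * Q k \<le> real k * real n + 1 * \<bar>ln \<kappa>\<bar>" by (simp add: mult.commute)
    also have "\<dots> \<le> real k * real n + real k * \<bar>ln \<kappa>\<bar>"
      using k by (intro add_left_mono mult_right_mono) auto
    finally have "real k * Q k \<le> real k * (real n + \<bar>ln \<kappa>\<bar>)" by (simp add: algebra_simps)
    then show ?thesis using k by simp
  qed simp
  then show ?thesis by (intro bdd_aboveI2) auto
qed

end

section \<open>Hausdorff content of intervals\<close>

text \<open>Countable subadditivity of the measure, transferred to the unordered sum used in the
  content by enumerating an infinite cover.\<close>

lemma emeasure_Union_le_infsum:
  fixes g :: "'a set \<Rightarrow> ennreal" and \<kappa> :: ennreal
  assumes "countable \<C>" "\<C> \<subseteq> sets M" and le: "\<And>G. G \<in> \<C> \<Longrightarrow> \<kappa> * emeasure M G \<le> g G"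
  shows "\<kappa> * emeasure M (\<Union>\<C>) \<le> (\<Sum>\<^sub>\<infinity>G\<in>\<C>. g G)"
proof (cases "finite \<C>")
  case True
  have "\<kappa> * emeasure M (\<Union>G\<in>\<C>. G) \<le> \<kappa> * (\<Sum>G\<in>\<C>. emeasure M G)"
    using True assms(2) by (intro mult_left_mono emeasure_subadditive_finite) auto
  also have "\<dots> \<le> (\<Sum>G\<in>\<C>. g G)"
    unfolding sum_distrib_left by (intro sum_mono le)
  finally show ?thesis using True by simp
next
  case False
  define e where "e = from_nat_into \<C>"
  have e: "bij_betw e UNIV \<C>"
    unfolding e_def using assms(1) False by (rule bij_betw_from_nat_into)
  then have range: "range e = \<C>" by (rule bij_betw_imp_surj_on)
  have "\<kappa> * emeasure M (\<Union>i. e i) \<le> \<kappa> * (\<Sum>i. emeasure M (e i))"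
    using assms(2) range by (intro mult_left_mono emeasure_subadditive_countably) auto
  also have "\<dots> = (\<Sum>i. \<kappa> * emeasure M (e i))" by (rule ennreal_suminf_cmult[symmetric])
  also have "\<dots> \<le> (\<Sum>i. g (e i))"
    using range by (intro suminf_le le summableI) auto
  also have "\<dots> = (\<Sum>\<^sub>\<infinity>i\<in>UNIV. g (e i))"
    by (intro sums_unique[symmetric] has_sum_imp_sums has_sum_infsum nonneg_summable_on_complete) auto
  also have "\<dots> = (\<Sum>\<^sub>\<infinity>G\<in>\<C>. g G)"
    by (rule infsum_reindex_bij_betw[OF e])
  finally show ?thesis using range by simp
qed

lemma hausdorff_content_mono:
  "E \<subseteq> E' \<Longrightarrow> hausdorff_content T h E \<le> hausdorff_content T h E'"
  unfolding hausdorff_content_def by (rule INF_superset_mono) auto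

lemma hausdorff_content_interval_le:
  assumes "p < q" "q - p < T"
  shows "hausdorff_content T h {p..q} \<le> ennreal (h (q - p))"
proof -
  have "{{p..q}} \<in> {\<C>. countable \<C> \<and> \<C> \<subseteq> cover_intervals T \<and> {p..q} \<subseteq> \<Union>\<C>}"
    using assms unfolding cover_intervals_def by blast
  then have "hausdorff_content T h {p..q} \<le> (\<Sum>\<^sub>\<infinity>G\<in>{{p..q}}. ennreal (h (measure lborel G)))"
    unfolding hausdorff_content_def by (rule INF_lower)
  then show ?thesis using assms by simp
qed

text \<open>If some covering interval is at least as long as \<open>{p..q}\<close>, monotonicity
  suffices. Otherwise \<open>ratio\<close> gives each covering interval at least the share
  \<open>h (q - p) / (q - p)\<close> times its length, and subadditivity of Lebesgue measure adds
  these up.\<close>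

lemma hausdorff_content_interval_ge:
  assumes mono: "mono_on {0<..<T} h"
    and ratio: "\<And>s. 0 < s \<Longrightarrow> s \<le> q - p \<Longrightarrow> h (q - p) * s \<le> h s * (q - p)"
    and pos: "h (q - p) \<ge> 0" and pq: "p < q" "q - p < T"
  shows "ennreal (h (q - p)) \<le> hausdorff_content T h {p..q}"
  unfolding hausdorff_content_def
proof (rule INF_greatest)
  let ?L = "q - p"
  fix \<C> assume "\<C> \<in> {\<C>. countable \<C> \<and> \<C> \<subseteq> cover_intervals T \<and> {p..q} \<subseteq> \<Union>\<C>}"
  then have \<C>: "countable \<C>" "\<C> \<subseteq> cover_intervals T" "{p..q} \<subseteq> \<Union>\<C>" by auto
  have G: "\<exists>l. 0 < l \<and> l < T \<and> measure lborel G = l \<and> emeasure lborel G = ennreal l \<and> G \<in> sets lborel"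
    if "G \<in> \<C>" for G
  proof -
    obtain a b where "a < b" "b - a < T" "G = {a..b} \<or> G = {a<..<b}"
      using \<C>(2) \<open>G \<in> \<C>\<close> unfolding cover_intervals_def by auto
    then show ?thesis by (intro exI[of _ "b - a"]) auto
  qed
  show "ennreal (h ?L) \<le> (\<Sum>\<^sub>\<infinity>G\<in>\<C>. ennreal (h (measure lborel G)))"
  proof (cases "\<exists>G\<in>\<C>. ?L \<le> measure lborel G")
    case True
    then obtain A where A: "A \<in> \<C>" "?L \<le> measure lborel A" by blast
    have "h ?L \<le> h (measure lborel A)"
      using G[OF A(1)] A(2) pq by (intro mono_onD[OF mono]) auto
    then have "ennreal (h ?L) \<le> (\<Sum>\<^sub>\<infinity>G\<in>{A}. ennreal (h (measure lborel G)))"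
      by (simp add: ennreal_leI)
    also have "\<dots> \<le> (\<Sum>\<^sub>\<infinity>G\<in>\<C>. ennreal (h (measure lborel G)))"
      using A by (intro infsum_mono_neutral nonneg_summable_on_complete) auto
    finally show ?thesis .
  next
    case False
    have "ennreal (h ?L / ?L) * emeasure lborel (\<Union>\<C>) \<le> (\<Sum>\<^sub>\<infinity>G\<in>\<C>. ennreal (h (measure lborel G)))"
    proof (rule emeasure_Union_le_infsum[OF \<C>(1)])
      show "\<C> \<subseteq> sets lborel" using G by blast
      fix A assume A: "A \<in> \<C>"
      obtain l where l: "0 < l" "measure lborel A = l" "emeasure lborel A = ennreal l" using G[OF A] by blast
      have "l \<le> ?L" using False A l by auto
      then have "h ?L / ?L * l \<le> h l" using ratio[of l] l pq by (simp add: field_simps)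
      then show "ennreal (h ?L / ?L) * emeasure lborel A \<le> ennreal (h (measure lborel A))"
        using l pos pq by (simp add: ennreal_leI flip: ennreal_mult')
    qed
    moreover have "ennreal (h ?L / ?L) * emeasure lborel {p..q} \<le> ennreal (h ?L / ?L) * emeasure lborel (\<Union>\<C>)"
      using \<C>(1,3) G by (intro mult_left_mono emeasure_mono sets.countable_Union) auto
    moreover have "ennreal (h ?L / ?L) * emeasure lborel {p..q} = ennreal (h ?L)"
      using pq pos by (simp flip: ennreal_mult')
    ultimately show ?thesis by simp
  qed
qed

text \<open>With \<open>u = ln (1 / t)\<close>, the function \<open>h\<close> is squeezed between two powers of \<open>u\<close>,
  in the sense of ratios.\<close>

locale log_power_dimension =
  fixes h :: "real \<Rightarrow> real" and T c C U :: real
  assumes dim: "dimension_function_on T h"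
    and bounds: "c > 0" "C \<ge> 0" "U \<ge> 1" "C \<le> U" "exp (- U) < T"
    and lower: "U \<le> u \<Longrightarrow> u \<le> v \<Longrightarrow> exp (- C * (ln v - ln u)) * h (exp (- u)) \<le> h (exp (- v))"
    and upper: "U \<le> u \<Longrightarrow> u \<le> v \<Longrightarrow> h (exp (- v)) \<le> exp (- c * (ln v - ln u)) * h (exp (- u))"
begin

lemma h_pos: "0 < t \<Longrightarrow> t < T \<Longrightarrow> h t > 0"
  using dim unfolding dimension_function_on_def by auto

text \<open>This says that \<open>h t / t\<close> is nonincreasing. From
  \<open>ln v - ln u \<le> (v - u) / u\<close> and \<open>C \<le> U \<le> u\<close>, the loss
  \<open>C * (ln v - ln u)\<close> in the exponent is at most \<open>v - u\<close>.\<close>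

lemma ratio_mono:
  assumes "0 < s" "s \<le> t" "t \<le> exp (- U)"
  shows "h t * s \<le> h s * t"
proof -
  define u v where "u = - ln t" and "v = - ln s"
  have t: "t = exp (- u)" and s: "s = exp (- v)" using assms by (simp_all add: u_def v_def)
  have uv: "U \<le> u" "u \<le> v" using assms by (simp_all add: t s)
  have u: "u \<ge> 1" "v > 0" using uv bounds by auto
  have "ln v - ln u \<le> (v - u) / u"
    using ln_le_minus_one[of "v / u"] u by (simp add: ln_div diff_divide_distrib)
  then have "C * (ln v - ln u) \<le> C * ((v - u) / u)" using bounds by (intro mult_left_mono) auto
  also have "\<dots> = C / u * (v - u)" by simp
  also have "\<dots> \<le> 1 * (v - u)" using uv bounds u by (intro mult_right_mono) auto
  finally have "exp (- v) \<le> exp (- C * (ln v - ln u)) * exp (- u)"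
    by (simp flip: exp_add)
  moreover have "h t > 0" using assms bounds by (intro h_pos) auto
  ultimately have "h t * exp (- v) \<le> h t * (exp (- C * (ln v - ln u)) * exp (- u))"
    by (intro mult_left_mono) auto
  also have "\<dots> = (exp (- C * (ln v - ln u)) * h (exp (- u))) * exp (- u)" by (simp add: t)
  also have "\<dots> \<le> h (exp (- v)) * exp (- u)" by (intro mult_right_mono lower uv) auto
  finally show ?thesis by (simp add: t s)
qed

lemma content_interval_ge:
  assumes "p < q" "q - p \<le> exp (- U)"
  shows "ennreal (h (q - p)) \<le> hausdorff_content T h {p..q}"
proof (rule hausdorff_content_interval_ge)
  show qp: "q - p < T" using assms bounds by linarith
  show "h (q - p) \<ge> 0" using assms qp by (intro less_imp_le h_pos) auto
  show "mono_on {0<..<T} h" using dim by (simp add: dimension_function_on_def)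
qed (use assms ratio_mono in auto)

end

text \<open>With \<open>d = ln v - ln u\<close> the exponent \<open>A u * ln u\<close> grows by
  \<open>a * d\<close> up to two errors of size at most \<open>a / 4 * d\<close>: the deviation of
  \<open>A\<close> from \<open>a\<close>, and the variation of \<open>A\<close>.\<close>

lemma log_power_dimensionI:
  fixes h A :: "real \<Rightarrow> real"
  assumes dim: "T > 0" "dimension_function_on T h" and a: "a > 0"
    and h: "\<And>u. U0 \<le> u \<Longrightarrow> h (exp (- u)) = u powr (- A u)"
    and A1: "\<And>u. U0 \<le> u \<Longrightarrow> \<bar>A u - a\<bar> \<le> a / 4"
    and A2: "\<And>u v. U0 \<le> u \<Longrightarrow> u \<le> v \<Longrightarrow> \<bar>A v - A u\<bar> * ln u \<le> a / 4 * (ln v - ln u)"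
  shows "\<exists>U. log_power_dimension h T (a / 2) (2 * a) U"
proof -
  \<comment> \<open>The entry \<open>2 * a\<close> secures \<open>C \<le> U\<close>, and
    \<open>1 - ln T\<close> secures \<open>exp (- U) < T\<close>.\<close>
  define U where "U = Max {U0, 1, 2 * a, 1 - ln T}"
  have U: "U0 \<le> U" "1 \<le> U" "2 * a \<le> U" "1 - ln T \<le> U" unfolding U_def by auto
  have key: "a / 2 * (ln v - ln u) \<le> A v * ln v - A u * ln u"
       "A v * ln v - A u * ln u \<le> 2 * a * (ln v - ln u)" if "U \<le> u" "u \<le> v" for u v
  proof -
    have uv: "U0 \<le> u" "U0 \<le> v" "1 \<le> u" using that U by auto
    define d where "d = ln v - ln u"
    have d: "d \<ge> 0" using that uv by (simp add: d_def)
    have eq: "A v * ln v - A u * ln u = a * d + (A v - a) * d + (A v - A u) * ln u"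
      by (simp add: d_def algebra_simps)
    have "\<bar>(A v - a) * d\<bar> \<le> a / 4 * d"
      using mult_right_mono[OF A1[OF uv(2)] d] d by (simp only: abs_mult abs_of_nonneg)
    moreover have "\<bar>(A v - A u) * ln u\<bar> \<le> a / 4 * d"
      using A2[OF uv(1) that(2)] uv(3) by (simp add: abs_mult d_def)
    moreover have "a * d \<ge> 0" using a d by simp
    moreover have "a / 4 * d = a * d / 4" "a / 2 * d = a * d / 2" "2 * a * d = 2 * (a * d)" by simp_all
    ultimately show "a / 2 * (ln v - ln u) \<le> A v * ln v - A u * ln u"
      "A v * ln v - A u * ln u \<le> 2 * a * (ln v - ln u)"
      unfolding eq d_def[symmetric] by linarith+
  qed
  have hexp: "h (exp (- u)) = exp (- (A u * ln u))" if "U \<le> u" for u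
    using h[of u] that U by (simp add: powr_def)
  have "log_power_dimension h T (a / 2) (2 * a) U"
  proof
    show "exp (- U) < T"
    proof -
      have "- U < ln T" using U by simp
      then have "exp (- U) < exp (ln T)" by (simp only: exp_less_cancel_iff)
      then show ?thesis using dim by simp
    qed
    fix u v assume uv: "U \<le> u" "u \<le> v"
    show "exp (- (2 * a) * (ln v - ln u)) * h (exp (- u)) \<le> h (exp (- v))"
      using key(2)[OF uv] uv by (simp add: hexp flip: exp_add)
    show "h (exp (- v)) \<le> exp (- (a / 2) * (ln v - ln u)) * h (exp (- u))"
      using key(1)[OF uv] uv by (simp add: hexp flip: exp_add)
  qed (use U a dim in auto)
  then show ?thesis by blast
qed

section \<open>Slow variation of iterated logarithms\<close>

lemma filterlim_iterated_ln: "filterlim (ln ^^ n) at_top (at_top :: real filter)"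
  by (induction n) (auto intro: filterlim_compose[OF ln_at_top] simp: filterlim_ident o_def)

text \<open>Above \<open>1\<close> the logarithm does not increase distances. The second application
  gains the divisor \<open>ln u\<close>, and later ones preserve the bound.\<close>

lemma iterated_ln_increment:
  assumes "\<And>i. i \<le> n \<Longrightarrow> (ln ^^ i) u \<ge> (1 :: real)" "u \<le> v"
  shows "0 \<le> (ln ^^ n) v - (ln ^^ n) u \<and> (n \<ge> 2 \<longrightarrow> (ln ^^ n) v - (ln ^^ n) u \<le> (ln v - ln u) / ln u)"
  using assms(1)
proof (induction n)
  case 0
  then show ?case using assms(2) by simp
next
  case (Suc n)
  let ?a = "(ln ^^ n) u" and ?b = "(ln ^^ n) v"
  have a: "?a \<ge> 1" using Suc.prems by simp
  have IH: "0 \<le> ?b - ?a" "n \<ge> 2 \<longrightarrow> ?b - ?a \<le> (ln v - ln u) / ln u" using Suc by auto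
  have "ln ?b - ln ?a \<le> (?b - ?a) / ?a"
    using ln_le_minus_one[of "?b / ?a"] a IH(1) by (simp add: ln_div diff_divide_distrib)
  moreover have "(?b - ?a) / ?a \<le> (?b - ?a) / 1" using a IH(1) by (intro divide_left_mono) auto
  moreover have "0 \<le> ln ?b - ln ?a" using a IH(1) by simp
  moreover have "?a = ln u" "?b = ln v" if "n = 1" using that by simp_all
  ultimately show ?case using IH(2) by (cases "n = 1") auto
qed

lemma eps_exp: "m \<ge> 1 \<Longrightarrow> eps m (exp (- u)) = inverse ((ln ^^ (m - 1)) u)"
  by (cases m) (simp_all add: eps_def funpow_Suc_right exp_minus field_simps del: funpow.simps)

text \<open>In the variable \<open>u\<close> the function is the reciprocal of an
  \<open>(m - 1)\<close>-fold logarithm. As \<open>m > 2\<close>, its increment carries the divisor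
  \<open>ln u\<close>, which cancels the factor \<open>ln u\<close>; one of the two reciprocals
  arising supplies the small constant.\<close>

lemma eps_eventually_slow:
  assumes m: "m > 2" and a: "(a::real) > 0"
  shows "\<exists>U0. \<forall>u\<ge>U0. \<bar>eps m (exp (- u))\<bar> \<le> a / 4 \<and>
    (\<forall>v\<ge>u. \<bar>eps m (exp (- v)) - eps m (exp (- u))\<bar> * ln u \<le> a / 4 * (ln v - ln u))"
proof -
  define n where "n = m - 1"
  have n: "n \<ge> 2" using m by (simp add: n_def)
  have e: "eps m (exp (- u)) = inverse ((ln ^^ n) u)" for u using m by (simp add: eps_exp n_def)
  define \<Lambda> where "\<Lambda> = max 1 (4 / a)"
  have \<Lambda>: "\<Lambda> \<ge> 1" "inverse \<Lambda> \<le> a / 4"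
  proof -
    show "\<Lambda> \<ge> 1" by (simp add: \<Lambda>_def)
    have "inverse \<Lambda> \<le> inverse (4 / a)" using a by (intro le_imp_inverse_le) (auto simp: \<Lambda>_def)
    then show "inverse \<Lambda> \<le> a / 4" by simp
  qed
  have "eventually (\<lambda>u. \<forall>i\<in>{..n}. (ln ^^ i) u \<ge> \<Lambda>) at_top"
    using filterlim_iterated_ln unfolding filterlim_at_top by (intro eventually_ball_finite) auto
  then obtain U0 where U0: "\<And>u i. u \<ge> U0 \<Longrightarrow> i \<le> n \<Longrightarrow> (ln ^^ i) u \<ge> \<Lambda>"
    unfolding eventually_at_top_linorder by (metis atMost_iff)
  show ?thesis
  proof (intro exI[of _ U0] allI impI conjI)
    fix u assume u: "U0 \<le> u"
    have L: "(ln ^^ n) u \<ge> \<Lambda>" using U0[OF u] by simp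
    have "inverse ((ln ^^ n) u) \<le> inverse \<Lambda>" using L \<Lambda> by (intro le_imp_inverse_le) auto
    then have "inverse ((ln ^^ n) u) \<le> a / 4" using \<Lambda>(2) by linarith
    moreover have "0 \<le> inverse ((ln ^^ n) u)" using L \<Lambda> by simp
    ultimately show "\<bar>eps m (exp (- u))\<bar> \<le> a / 4" by (simp only: e abs_of_nonneg)
    fix v assume v: "u \<le> v"
    let ?a = "(ln ^^ n) u" and ?b = "(ln ^^ n) v"
    have b: "?b \<ge> \<Lambda>" using U0[of v n] u v by simp
    have "(ln ^^ i) u \<ge> 1" if "i \<le> n" for i using U0[OF u that] \<Lambda> by linarith
    from iterated_ln_increment[OF this v] n
    have inc: "0 \<le> ?b - ?a" "?b - ?a \<le> (ln v - ln u) / ln u" by auto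
    have lnu: "ln u \<ge> 1" using U0[OF u, of 1] n \<Lambda> by simp
    have "\<bar>inverse ?b - inverse ?a\<bar> = (?b - ?a) * (inverse ?a * inverse ?b)"
    proof -
      have "inverse ?b - inverse ?a = - ((?b - ?a) * (inverse ?a * inverse ?b))"
        using L b \<Lambda> by (simp add: field_simps)
      then show ?thesis using inc(1) L b \<Lambda> by (simp add: abs_mult)
    qed
    also have "\<dots> \<le> ((ln v - ln u) / ln u) * (inverse \<Lambda> * 1)"
      using inc L b \<Lambda> by (intro mult_mono le_imp_inverse_le) (auto simp: inverse_le_1_iff)
    also have "\<dots> \<le> ((ln v - ln u) / ln u) * (a / 4)"
      using \<Lambda> inc by (intro mult_left_mono) auto
    finally have "\<bar>inverse ?b - inverse ?a\<bar> * ln u \<le> (ln v - ln u) / ln u * (a / 4) * ln u"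
      using lnu by (intro mult_right_mono) auto
    then show "\<bar>eps m (exp (- v)) - eps m (exp (- u))\<bar> * ln u \<le> a / 4 * (ln v - ln u)"
      using lnu by (simp add: e mult_ac)
  qed
qed

lemma log_power_dimension_h0:
  fixes \<alpha>0 T :: real and \<alpha> h :: "real \<Rightarrow> real"
  assumes alpha: "((\<forall>t. \<alpha> t = \<alpha>0) \<and> 0 < \<alpha>0 \<and> \<alpha>0 \<le> 1) \<or>
      (0 < \<alpha>0 \<and> \<alpha>0 < 1 \<and>
        (\<exists>m>2. (\<forall>t. \<alpha> t = \<alpha>0 + eps m t) \<or> (\<forall>t. \<alpha> t = \<alpha>0 - eps m t)))"
    and h: "\<And>t. h t = h0 t powr \<alpha> t"
    and T: "T > 0" "dimension_function_on T h"
  shows "\<exists>c C U. log_power_dimension h T c C U"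
proof -
  have a: "\<alpha>0 > 0" using alpha by auto
  have "\<exists>U0. \<forall>u\<ge>U0. \<bar>\<alpha> (exp (- u)) - \<alpha>0\<bar> \<le> \<alpha>0 / 4 \<and>
    (\<forall>v\<ge>u. \<bar>\<alpha> (exp (- v)) - \<alpha> (exp (- u))\<bar> * ln u \<le> \<alpha>0 / 4 * (ln v - ln u))"
    using alpha
  proof (elim disjE conjE exE)
    assume "\<forall>t. \<alpha> t = \<alpha>0"
    then show ?thesis using a by (intro exI[of _ 1]) auto
  next
    fix m assume "m > 2" "\<forall>t. \<alpha> t = \<alpha>0 + eps m t"
    then show ?thesis using eps_eventually_slow[OF \<open>m > 2\<close> a] by simp
  next
    fix m assume "m > 2" "\<forall>t. \<alpha> t = \<alpha>0 - eps m t"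
    then show ?thesis using eps_eventually_slow[OF \<open>m > 2\<close> a] by (simp add: abs_minus_commute)
  qed
  then obtain U0 where U0: "\<And>u. u \<ge> U0 \<Longrightarrow> \<bar>\<alpha> (exp (- u)) - \<alpha>0\<bar> \<le> \<alpha>0 / 4"
    "\<And>u v. u \<ge> U0 \<Longrightarrow> v \<ge> u \<Longrightarrow>
      \<bar>\<alpha> (exp (- v)) - \<alpha> (exp (- u))\<bar> * ln u \<le> \<alpha>0 / 4 * (ln v - ln u)" by blast
  have "\<exists>U. log_power_dimension h T (\<alpha>0 / 2) (2 * \<alpha>0) U"
  proof (rule log_power_dimensionI[OF T a])
    fix u assume u: "max U0 1 \<le> u"
    show "\<bar>\<alpha> (exp (- u)) - \<alpha>0\<bar> \<le> \<alpha>0 / 4" using U0 u by simp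
    have "h0 (exp (- u)) = inverse u" by (simp add: h0_def ln_div)
    then show "h (exp (- u)) = u powr (- \<alpha> (exp (- u)))"
      using u by (simp add: h powr_minus powr_def ln_inverse exp_minus)
    show "\<bar>\<alpha> (exp (- v)) - \<alpha> (exp (- u))\<bar> * ln u \<le> \<alpha>0 / 4 * (ln v - ln u)" if "u \<le> v" for v
      using U0 u that by simp
  qed
  then show ?thesis by blast
qed

section \<open>Lower density of the content on \<open>K\<close>\<close>

locale interval_seq_dimension = interval_seq Q + log_power_dimension h T c C U
  for Q :: "nat \<Rightarrow> real" and h :: "real \<Rightarrow> real" and T c C U :: real
begin

text \<open>If \<open>x\<close> is close to \<open>0\<close>, the ball contains an interval
  \<open>I j\<close> with \<open>b j\<close> comparable to \<open>r\<close>. Otherwise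
  \<open>x\<close> lies in some \<open>I k\<close> with \<open>b k \<ge> r / 2\<close>, and the ball
  contains all of \<open>I k\<close> or a segment of it of length \<open>r / 2\<close>.\<close>

lemma inner_interval:
  assumes N: "N \<ge> 1" "\<And>k. k \<ge> 1 \<Longrightarrow> Q k \<le> real N" and x: "x \<in> K" and r: "0 < r" "r \<le> 1 / 24"
  shows "\<exists>p q. p < q \<and> {p..q} \<subseteq> K \<inter> cball x r \<and> (2 * r) ^ (2 * N) \<le> q - p"
proof -
  \<comment> \<open>The threshold \<open>1 / 24\<close> turns the constant in \<open>r / 6\<close>
    into a further power of \<open>2 * r\<close>, so that on the logarithmic scale only the factor
    \<open>2 * N\<close> is lost.\<close>
  have "r * r \<le> 1 / 24 * r" using r by (intro mult_right_mono) auto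
  then have sq: "(2 * r) ^ 2 \<le> r / 6" by (simp add: power2_eq_square)
  then have "((2 * r) ^ 2) ^ N \<le> (r / 6) ^ N" by (intro power_mono) auto
  then have small: "(2 * r) ^ (2 * N) \<le> (r / 6) ^ N" by (simp only: power_mult)
  show ?thesis
  proof (cases "x \<le> r / 2")
    case True
    have x0: "x \<ge> 0" using x subset by auto
    have "eventually (\<lambda>j. b j < r / 2) sequentially"
      using r by (intro order_tendstoD(2)[OF b_tendsto_0]) auto
    then obtain n where "\<forall>m\<ge>n. b m < r / 2" unfolding eventually_sequentially by blast
    then have "b n \<le> r / 2" by (simp add: less_imp_le)
    \<comment> \<open>By minimality of \<open>j\<close> the preceding point exceeds
      \<open>r / 2\<close>, so \<open>b j\<close> is at least a third of that, since
      \<open>exp 1 \<le> 3\<close>.\<close>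
    then obtain j where j: "b j \<le> r / 2" "\<And>i. i < j \<Longrightarrow> \<not> b i \<le> r / 2"
      using exists_least_iff[of "\<lambda>j. b j \<le> r / 2"] by blast
    have j1: "j \<ge> 1"
    proof (rule ccontr)
      assume "\<not> j \<ge> 1"
      then have "j = 0" by simp
      then show False using j(1) r by (simp add: b_def)
    qed
    have "b (j - 1) > r / 2" using j(2)[of "j - 1"] j1 by simp
    moreover have "b j = exp (- 1) * b (j - 1)" using j1 by (simp add: b_def of_nat_diff flip: exp_add)
    moreover have "exp (- 1 :: real) \<ge> 1 / 3"
      using exp_le by (simp add: exp_minus field_simps)
    ultimately have bj: "b j \<ge> r / 6"
      using mult_mono[of "1 / 3" "exp (- 1)" "r / 2" "b (j - 1)"] r by simp
    have "(r / 6) ^ N \<le> b j ^ N" using bj r by (intro power_mono) auto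
    with small \<delta>_ge_power[OF N(2)[OF j1]] have "(2 * r) ^ (2 * N) \<le> b j - (b j - \<delta> j)" by linarith
    moreover have "{b j - \<delta> j..b j} \<subseteq> K \<inter> cball x r"
    proof
      fix y assume "y \<in> {b j - \<delta> j..b j}"
      then have y: "y \<in> I j" by (simp add: I_def)
      then have "0 < y" "y \<le> r / 2" using I_pos[OF j1 y] j(1) by auto
      then show "y \<in> K \<inter> cball x r"
        using y I_subset_K[OF j1] True x0 by (auto simp: dist_real_def)
    qed
    ultimately show ?thesis using \<delta>_pos[of j] by (intro exI[of _ "b j - \<delta> j"] exI[of _ "b j"]) auto
  next
    case False
    then obtain k where k: "k \<ge> 1" "x \<in> I k" using x r by (auto elim: in_K_cases)
    have xk: "b k - \<delta> k \<le> x" "x \<le> b k" using k by (auto simp: I_def)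
    show ?thesis
    proof (cases "r \<le> \<delta> k")
      case True
      have "(r / 6) ^ N \<le> (r / 6) ^ 1" using r N by (intro power_decreasing) auto
      then have len: "(2 * r) ^ (2 * N) \<le> r / 2" using small r by simp
      show ?thesis
      proof (cases "x + r / 2 \<le> b k")
        case True
        have "{x..x + r / 2} \<subseteq> K \<inter> cball x r"
          using True xk r I_subset_K[OF k(1)] by (auto simp: I_def dist_real_def)
        then show ?thesis using len r by (intro exI[of _ x] exI[of _ "x + r / 2"]) auto
      next
        case False
        have "{x - r / 2..x} \<subseteq> K \<inter> cball x r"
          using False \<open>r \<le> \<delta> k\<close> xk r I_subset_K[OF k(1)] by (auto simp: I_def dist_real_def)
        then show ?thesis using len r by (intro exI[of _ "x - r / 2"] exI[of _ x]) auto
      qed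
    next
      case large: False
      have "b k \<ge> r / 2" using False xk by linarith
      then have "(r / 6) ^ N \<le> b k ^ N" using r by (intro power_mono) auto
      with small \<delta>_ge_power[OF N(2)[OF k(1)]] have "(2 * r) ^ (2 * N) \<le> b k - (b k - \<delta> k)" by linarith
      moreover have "{b k - \<delta> k..b k} \<subseteq> K \<inter> cball x r"
        using large xk I_subset_K[OF k(1)] by (auto simp: I_def dist_real_def)
      ultimately show ?thesis using \<delta>_pos[of k] by (intro exI[of _ "b k - \<delta> k"] exI[of _ "b k"]) auto
    qed
  qed
qed

text \<open>A length at least \<open>(2 * r) ^ (2 * N)\<close> means
  \<open>v \<le> 2 * N * u\<close> for the logarithmic variables, and \<open>lower\<close> turns
  this into a ratio of contents independent of \<open>x\<close> and \<open>r\<close>.\<close>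

lemma content_ratio_ge:
  assumes N: "N \<ge> 1" "\<And>k. k \<ge> 1 \<Longrightarrow> Q k \<le> real N" and x: "x \<in> K"
    and r: "0 < r" "r \<le> 1 / 24" "2 * r \<le> exp (- U)"
  shows "ennreal (exp (- C * ln (2 * real N))) \<le>
    hausdorff_content T h (K \<inter> cball x r) / hausdorff_content T h (cball x r)"
proof -
  let ?\<epsilon> = "exp (- C * ln (2 * real N))"
  have T: "2 * r < T" using r bounds by linarith
  obtain p q where pq: "p < q" "{p..q} \<subseteq> K \<inter> cball x r" "(2 * r) ^ (2 * N) \<le> q - p"
    using inner_interval[OF N x r(1,2)] by blast
  have "p \<in> {p..q}" "q \<in> {p..q}" using pq(1) by auto
  then have "p \<in> cball x r" "q \<in> cball x r" using pq(2) by blast+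
  then have len: "q - p \<le> 2 * r" by (auto simp: dist_real_def)
  define u v where "u = - ln (2 * r)" and "v = - ln (q - p)"
  have eu: "exp (- u) = 2 * r" and ev: "exp (- v) = q - p" using r pq by (simp_all add: u_def v_def)
  have "U \<le> u" using r(3) unfolding eu[symmetric] by simp
  have "u \<le> v" using len unfolding eu[symmetric] ev[symmetric] by simp
  have u1: "u \<ge> 1" using \<open>U \<le> u\<close> bounds by linarith
  have "ln ((2 * r) ^ (2 * N)) \<le> ln (q - p)" using pq(1,3) r by (subst ln_le_cancel_iff) auto
  moreover have "ln ((2 * r) ^ (2 * N)) = 2 * real N * ln (2 * r)" using r by (subst ln_realpow) auto
  ultimately have "v \<le> 2 * real N * u" by (simp add: u_def v_def)
  then have "ln v \<le> ln (2 * real N * u)" using u1 \<open>u \<le> v\<close> N(1) by (subst ln_le_cancel_iff) auto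
  then have "ln v - ln u \<le> ln (2 * real N)" using u1 N(1) by (simp add: ln_mult)
  then have "C * (ln v - ln u) \<le> C * ln (2 * real N)" using bounds by (intro mult_left_mono) auto
  then have "?\<epsilon> * h (exp (- u)) \<le> exp (- C * (ln v - ln u)) * h (exp (- u))"
    using h_pos[of "2 * r"] r T by (intro mult_right_mono) (auto simp: eu)
  also have "\<dots> \<le> h (exp (- v))" using \<open>U \<le> u\<close> \<open>u \<le> v\<close> by (rule lower)
  finally have h: "?\<epsilon> * h (2 * r) \<le> h (q - p)" by (simp add: eu ev)
  have ball: "cball x r = {x - r..x + r}" by (rule cball_eq_atLeastAtMost)
  have ub: "hausdorff_content T h (cball x r) \<le> ennreal (h (2 * r))"
    using hausdorff_content_interval_le[of "x - r" "x + r" T h] r T by (simp add: ball)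
  have lb: "ennreal (h (2 * r)) \<le> hausdorff_content T h (cball x r)"
    using content_interval_ge[of "x - r" "x + r"] r by (simp add: ball)
  have pos: "h (2 * r) > 0" using r T by (intro h_pos) auto
  let ?B = "hausdorff_content T h (cball x r)"
  have B: "?B \<noteq> 0" "?B \<noteq> top"
  proof -
    show "?B \<noteq> 0"
    proof
      assume "?B = 0"
      then show False using lb pos by (simp add: ennreal_eq_0_iff)
    qed
    show "?B \<noteq> top" using ub by (auto simp: top_unique)
  qed
  have "ennreal ?\<epsilon> * ?B \<le> ennreal ?\<epsilon> * ennreal (h (2 * r))" using ub by (intro mult_left_mono) auto
  also have "\<dots> \<le> ennreal (h (q - p))" using h by (simp add: ennreal_leI flip: ennreal_mult')
  also have "\<dots> \<le> hausdorff_content T h {p..q}" using pq(1) len r by (intro content_interval_ge) auto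
  also have "\<dots> \<le> hausdorff_content T h (K \<inter> cball x r)" using pq(2) by (rule hausdorff_content_mono)
  finally have "ennreal ?\<epsilon> * ?B / ?B \<le> hausdorff_content T h (K \<inter> cball x r) / ?B"
    by (rule divide_right_mono_ennreal)
  then show ?thesis using B by (simp add: ennreal_mult_divide_eq)
qed

lemma density_pos_of_bounded:
  assumes "bdd_above (Q ` {1..})"
  shows "lower_content_density T h K > 0"
proof -
  obtain M where M: "\<And>k. k \<ge> 1 \<Longrightarrow> Q k \<le> M" using assms unfolding bdd_above_def by auto
  define N where "N = nat \<lceil>M\<rceil>"
  have N: "Q k \<le> real N" if "k \<ge> 1" for k
    using M[OF that] of_nat_ceiling[of M] unfolding N_def by linarith
  have N1: "N \<ge> 1" using N[of 1] Q_ge2[of 1] by (cases N) auto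
  let ?\<epsilon> = "ennreal (exp (- C * ln (2 * real N)))"
  have "eventually (\<lambda>r. ?\<epsilon> \<le> (INF x\<in>K. hausdorff_content T h (K \<inter> cball x r) / hausdorff_content T h (cball x r)))
      (at_right 0)"
  proof -
    have "eventually (\<lambda>r. r \<in> {0<..<min (1 / 24) (exp (- U) / 2)}) (at_right 0)"
      by (intro eventually_at_right_real) auto
    then show ?thesis
    proof eventually_elim
      case (elim r)
      then show ?case by (intro INF_greatest content_ratio_ge N N1) auto
    qed
  qed
  then have "?\<epsilon> \<le> lower_content_density T h K"
    unfolding lower_content_density_def by (rule Liminf_bounded)
  then show ?thesis by (rule less_le_trans[rotated]) simp
qed

lemma content_ratio_le:
  assumes k: "k \<ge> 1" and small: "b k / 2 \<le> exp (- U)"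
  shows "hausdorff_content T h (K \<inter> cball (b k) (b k / 4)) / hausdorff_content T h (cball (b k) (b k / 4))
    \<le> ennreal (exp (- c * ln (Q k / 2)))"
proof -
  \<comment> \<open>The logarithmic variables of the ball's length \<open>b k / 2\<close> and of
    \<open>\<delta> k\<close>. Since \<open>u \<le> 2 * k\<close>, their ratio \<open>v / u\<close>
    is at least \<open>Q k / 2\<close>.\<close>
  define u v where "u = real k + ln 2" and "v = real k * Q k"
  have eu: "exp (- u) = b k / 2" by (simp add: u_def b_def exp_diff exp_minus field_simps exp_add)
  have ev: "exp (- v) = \<delta> k" by (simp add: v_def \<delta>_def)
  have "U \<le> u" using small unfolding eu[symmetric] by simp
  have ln2: "ln 2 \<le> (1 :: real)" using ln_le_minus_one[of 2] by simp
  have "real k * 2 \<le> v" unfolding v_def using Q_ge2[OF k] by (intro mult_left_mono) auto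
  moreover have uk: "u \<le> 2 * real k" using k ln2 by (simp add: u_def)
  ultimately have "u \<le> v" by linarith
  have u0: "u > 0" using k by (simp add: u_def add_pos_nonneg)
  have \<delta>T: "\<delta> k < T"
    using \<open>U \<le> u\<close> \<open>u \<le> v\<close> bounds(5) unfolding ev[symmetric] by (simp add: le_less_trans[of "exp (- v)" "exp (- U)"])
  have "Q k / 2 \<le> v / u"
  proof -
    have "Q k * u \<le> Q k * (2 * real k)" using uk Q_ge2[OF k] by (intro mult_left_mono) auto
    then show ?thesis using u0 by (simp add: v_def field_simps)
  qed
  then have "ln (Q k / 2) \<le> ln (v / u)"
    using Q_ge2[OF k] u0 \<open>u \<le> v\<close> by (subst ln_le_cancel_iff) auto
  also have "\<dots> = ln v - ln u" using u0 \<open>u \<le> v\<close> by (simp add: ln_div)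
  finally have "c * ln (Q k / 2) \<le> c * (ln v - ln u)" using bounds by (intro mult_left_mono) auto
  then have *: "exp (- c * (ln v - ln u)) \<le> exp (- c * ln (Q k / 2))" by simp
  let ?z = "exp (- c * ln (Q k / 2))"
  have hb: "h (b k / 2) > 0" using small bounds b_pos[of k] by (intro h_pos) auto
  have "h (exp (- v)) \<le> exp (- c * (ln v - ln u)) * h (exp (- u))"
    using \<open>U \<le> u\<close> \<open>u \<le> v\<close> by (rule upper)
  also have "\<dots> \<le> ?z * h (exp (- u))" using * hb by (intro mult_right_mono) (auto simp: eu)
  finally have h: "h (\<delta> k) \<le> ?z * h (b k / 2)" by (simp add: eu ev)
  let ?A = "hausdorff_content T h (K \<inter> cball (b k) (b k / 4))"
  let ?B = "hausdorff_content T h (cball (b k) (b k / 4))"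
  have "K \<inter> cball (b k) (b k / 4) \<subseteq> {b k - \<delta> k..b k}"
  proof
    fix x assume x: "x \<in> K \<inter> cball (b k) (b k / 4)"
    then have "\<bar>b k - x\<bar> \<le> b k / 4" by (auto simp: dist_real_def)
    then have "\<not> (x \<le> 2 / 5 * b k \<or> x \<ge> 3 / 2 * b k)" using b_pos[of k] by auto
    then show "x \<in> {b k - \<delta> k..b k}" using K_separated[OF k, of x] x by (auto simp: I_def)
  qed
  then have "?A \<le> hausdorff_content T h {b k - \<delta> k..b k}" by (rule hausdorff_content_mono)
  also have "\<dots> \<le> ennreal (h (b k - (b k - \<delta> k)))"
    using \<delta>_pos[of k] \<delta>T by (intro hausdorff_content_interval_le) auto
  also have "\<dots> \<le> ennreal ?z * ennreal (h (b k / 2))"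
    using h by (simp add: ennreal_leI flip: ennreal_mult')
  also have ball: "cball (b k) (b k / 4) = {b k - b k / 4..b k + b k / 4}"
    by (rule cball_eq_atLeastAtMost)
  have lb: "ennreal (h (b k / 2)) \<le> ?B"
    using content_interval_ge[of "b k - b k / 4" "b k + b k / 4"] small b_pos[of k] by (simp add: ball)
  then have "ennreal ?z * ennreal (h (b k / 2)) \<le> ennreal ?z * ?B" by (intro mult_left_mono) auto
  finally have AB: "?A \<le> ennreal ?z * ?B" .
  have B: "?B \<noteq> 0" "?B \<noteq> top"
  proof -
    show "?B \<noteq> 0"
    proof
      assume "?B = 0"
      then show False using lb hb by (simp add: ennreal_eq_0_iff)
    qed
    have "?B \<le> ennreal (h (b k + b k / 4 - (b k - b k / 4)))"
      unfolding ball using b_pos[of k] small bounds by (intro hausdorff_content_interval_le) auto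
    then show "?B \<noteq> top" by (auto simp: top_unique)
  qed
  have "?A / ?B \<le> ennreal ?z * ?B / ?B" using AB by (rule divide_right_mono_ennreal)
  then show ?thesis using B by (simp add: ennreal_mult_divide_eq)
qed

text \<open>The balls around \<open>b k\<close> of radius \<open>b k / 4\<close> test the lower
  limit along a sequence of radii tending to \<open>0\<close>, and there
  \<open>content_ratio_le\<close> tends to \<open>0\<close> with \<open>1 / Q k\<close>.\<close>

lemma density_zero_of_unbounded:
  assumes "filterlim Q at_top sequentially"
  shows "lower_content_density T h K = 0"
proof (rule ccontr)
  let ?X = "\<lambda>r. INF x\<in>K. hausdorff_content T h (K \<inter> cball x r) / hausdorff_content T h (cball x r)"
  assume "lower_content_density T h K \<noteq> 0"
  then have "0 < lower_content_density T h K" by (simp add: zero_less_iff_neq_zero)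
  then obtain y where y: "0 < y" "y < lower_content_density T h K" using dense by blast
  then have "eventually (\<lambda>r. y < ?X r) (at_right 0)"
    unfolding lower_content_density_def by (intro less_LiminfD)
  moreover have "b k \<noteq> 0" for k using b_pos[of k] by simp
  then have "filterlim (\<lambda>k. b k / 4) (at_right 0) sequentially"
    unfolding filterlim_at using tendsto_divide[OF b_tendsto_0 tendsto_const, of 4] b_pos by simp
  ultimately have 1: "eventually (\<lambda>k. y < ?X (b k / 4)) sequentially"
    by (rule eventually_compose_filterlim)
  have 2: "eventually (\<lambda>k. b k / 2 < exp (- U)) sequentially"
    using tendsto_divide[OF b_tendsto_0 tendsto_const, of 2] by (intro order_tendstoD(2)[where y = 0]) auto
  have "((\<lambda>q. exp (- c * ln (q / 2))) \<longlongrightarrow> 0) at_top"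
    using bounds(1) by real_asymp
  from filterlim_compose[OF this assms]
  have "(\<lambda>k. ennreal (exp (- c * ln (Q k / 2)))) \<longlonglongrightarrow> ennreal 0" by (rule tendsto_ennrealI)
  then have 3: "eventually (\<lambda>k. ennreal (exp (- c * ln (Q k / 2))) < y) sequentially"
    using y(1) by (intro order_tendstoD(2)) auto
  have "eventually (\<lambda>k. False) sequentially"
    using 1 2 3 eventually_ge_at_top[of 1]
  proof eventually_elim
    case (elim k)
    have "?X (b k / 4) \<le> hausdorff_content T h (K \<inter> cball (b k) (b k / 4)) / hausdorff_content T h (cball (b k) (b k / 4))"
      using elim by (intro INF_lower b_in_K) auto
    also have "\<dots> \<le> ennreal (exp (- c * ln (Q k / 2)))" using elim by (intro content_ratio_le) auto
    finally show False using elim by auto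
  qed
  then show False by simp
qed

end

theorem proposition9p3:
  fixes Q :: "nat \<Rightarrow> real" and \<alpha>0 T :: real and \<alpha> h :: "real \<Rightarrow> real"
  assumes Q_mono: "mono_on {1..} Q"
    and Q_ge2: "\<And>k. k \<ge> 1 \<Longrightarrow> Q k \<ge> 2"
    and Q_cases: "bdd_above (Q ` {1..}) \<or>
      (filterlim Q at_top sequentially \<and> (\<forall>\<^sub>F k in sequentially. Q k < ln (real k)))"
    and alpha: "((\<forall>t. \<alpha> t = \<alpha>0) \<and> 0 < \<alpha>0 \<and> \<alpha>0 \<le> 1) \<or>
      (0 < \<alpha>0 \<and> \<alpha>0 < 1 \<and>
        (\<exists>m>2. (\<forall>t. \<alpha> t = \<alpha>0 + eps m t) \<or> (\<forall>t. \<alpha> t = \<alpha>0 - eps m t)))"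
    and h: "\<And>t. h t = h0 t powr \<alpha> t"
    and T: "T > 0" "dimension_function_on T h"
  shows "extension_property (interval_seq_set Q) \<longleftrightarrow>
         lower_content_density T h (interval_seq_set Q) > 0"
proof -
  obtain c C U where "log_power_dimension h T c C U"
    using log_power_dimension_h0[OF alpha h T] by blast
  then interpret log_power_dimension h T c C U .
  interpret interval_seq_dimension Q h T c C U
    by unfold_locales (rule Q_ge2)
  \<comment> \<open>For bounded \<open>Q\<close> both sides hold. If \<open>Q\<close> tends to
    infinity the density is \<open>0\<close>, while the extension property would bound
    \<open>Q\<close> and make the density positive.\<close>
  show ?thesis
    using Q_cases bounded_of_extension_property extension_property_of_bounded
      density_pos_of_bounded density_zero_of_unbounded by auto
qed

end
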